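(* Let $G$ be a symmetry group of a discrete Lagrange--D'Alembert--Poincaré system $\mathcal{M}=(E,L_d,\mathcal{D}_d,\mathcal{D},\mathcal{P})$ over a fiber bundle $\phi:E\to M$, and let $\mathcal{A}_d$ be a discrete connection on the principal $G$-bundle $\pi^{M,G}:M\to M/G$. Let $(\epsilon_\cdot,m_\cdot)=((\epsilon_0,m_1),\ldots,(\epsilon_{N-1},m_N))$ be a discrete path in $C'(E)$ and define the discrete path $(v_\cdot,r_\cdot)$ in $C'(\widetilde{G}_E)$ by $(v_k,r_{k+1}):=\Upsilon_{\mathcal{A}_d}(\epsilon_k,m_{k+1})$ for $k=0,\ldots,N-1$. Then the following statements are equivalent. (1) $(\epsilon_\cdot,m_\cdot)$ is a trajectory of $\mathcal{M}$. (2) $(\epsilon_k,m_{k+1})\in\mathcal{D}_d$ for all $k=0,\ldots,N-1$ and $\nu_d^{\mathcal{M}}((\epsilon_{k-1},m_k),(\epsilon_k,m_{k+1}))=0$ for all $k=1,\ldots,N-1$. (3) $(v_\cdot,r_\cdot)$ is a trajectory of the reduced system $\mathcal{M}/(G,\mathcal{A}_d)=(\widetilde{G}_E,\check L_d,\check{\mathcal{D}}_d,\check{\mathcal{D}},\check{\mathcal{P}})$. (4) $(v_k,r_{k+1})\in\check{\mathcal{D}}_d$ for all $k=0,\ldots,N-1$ and $\nu_d^{\mathcal{M}/(G,\mathcal{A}_d)}((v_{k-1},r_k),(v_k,r_{k+1}))=0$ for all $k=1,\ldots,N-1$.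
   Context: All manifolds, maps and actions are smooth; $p_j$ denotes projection onto the $j$-th factor of a product; $D_1,D_2$ are partial differentials with respect to the first and second factor. DLDPS. For a fiber bundle $\phi:E\to M$ put $C'(E):=E\times M$ and $C''(E):=\{((\epsilon_0,m_1),(\epsilon_1,m_2))\in C'(E)\times C'(E):\phi(\epsilon_1)=m_1\}$, with $\tilde p_{34}:C''(E)\to C'(E)$, $\tilde p_{34}((\epsilon_0,m_1),(\epsilon_1,m_2))=(\epsilon_1,m_2)$. $p_1^*TE\subset T(C'(E))$ is the subbundle of vectors $(\delta\epsilon,0)$. A discrete Lagrange--D'Alembert--Poincaré system (DLDPS) over $E$ is $\mathcal{M}=(E,L_d,\mathcal{D}_d,\mathcal{D},\mathcal{P})$ where $L_d:C'(E)\to\mathbb{R}$ is smooth, $\mathcal{D}_d\subset C'(E)$ is a regular (embedded) submanifold, $\mathcal{D}\subset p_1^*TE$ is a vector subbundle, and $\mathcal{P}:\tilde p_{34}^*\mathcal{D}\to\ker(d\phi)\subset TE$ is a vector bundle homomorphism over $((\epsilon_0,m_1),(\epsilon_1,m_2))\mapsto\epsilon_0$; i.e. $\mathcal{P}((\epsilon_0,m_1),(\epsilon_1,m_2)):\mathcal{D}_{(\epsilon_1,m_2)}\to\ker d\phi(\epsilon_0)$ is linear and depends smoothly on the base point. Trajectories. A discrete path in $C'(E)$ is $(\epsilon_\cdot,m_\cdot)=((\epsilon_0,m_1),\ldots,(\epsilon_{N-1},m_N))\in C'(E)^N$ ($N\ge 2$) with $\phi(\epsilon_k)=m_k$ for $k=1,\ldots,N-1$.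 A nonholonomic infinitesimal variation with fixed endpoints over it is a tangent vector $(\delta\epsilon_\cdot,\delta m_\cdot)=((\delta\epsilon_0,\delta m_1),\ldots,(\delta\epsilon_{N-1},\delta m_N))\in T_{(\epsilon_\cdot,m_\cdot)}(C'(E)^N)$ such that $\delta m_k=d\phi(\epsilon_k)(\delta\epsilon_k)$ for $k=1,\ldots,N-1$, $\delta m_N=0$, and, for some $(\widetilde{\delta\epsilon_k},0)\in\mathcal{D}_{(\epsilon_k,m_{k+1})}$, $k=1,\ldots,N-1$: $\delta\epsilon_{N-1}=\widetilde{\delta\epsilon_{N-1}}$; $\delta\epsilon_k=\widetilde{\delta\epsilon_k}+\mathcal{P}((\epsilon_k,m_{k+1}),(\epsilon_{k+1},m_{k+2}))(\widetilde{\delta\epsilon_{k+1}},0)$ for $k=1,\ldots,N-2$; $\delta\epsilon_0=\mathcal{P}((\epsilon_0,m_1),(\epsilon_1,m_2))(\widetilde{\delta\epsilon_1},0)$. With $S_d(\epsilon_\cdot,m_\cdot):=\sum_{k=0}^{N-1}L_d(\epsilon_k,m_{k+1})$, a trajectory of $\mathcal{M}$ is a discrete path with $(\epsilon_k,m_{k+1})\in\mathcal{D}_d$ for $k=0,\ldots,N-1$ and $dS_d(\epsilon_\cdot,m_\cdot)(\delta\epsilon_\cdot,\delta m_\cdot)=0$ for all such variations. Section of motion. For a DLDPS $\mathcal{M}$, $\nu_d=\nu_d^{\mathcal{M}}$ is the section of $(\tilde p_{34}^*\mathcal{D})^*\to C''(E)$ given, for $(\delta\epsilon_1,0)\in\mathcal{D}_{(\epsilon_1,m_2)}$,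 by $\nu_d((\epsilon_0,m_1),(\epsilon_1,m_2))(\delta\epsilon_1,0):=D_1L_d(\epsilon_1,m_2)(\delta\epsilon_1)+D_2L_d(\epsilon_0,m_1)(d\phi(\epsilon_1)(\delta\epsilon_1))+D_1L_d(\epsilon_0,m_1)\big(\mathcal{P}((\epsilon_0,m_1),(\epsilon_1,m_2))(\delta\epsilon_1,0)\big)$. Group actions. A Lie group $G$ acts on the fiber bundle $\phi:E\to M$ with fiber $F_0$ if there are free left $G$-actions on $E$ and $M$ and a right $G$-action on $F_0$ such that $\pi^{M,G}:M\to M/G$ is a principal $G$-bundle, $\phi$ is $G$-equivariant, and every $m\in M$ has a $G$-invariant open neighborhood $U$ with a trivialization $\Phi_U:\phi^{-1}(U)\to U\times F_0$ that is equivariant for $g\cdot(m,f)=(g\cdot m,f\cdot g^{-1})$. $G$ acts diagonally on $C'(E)$ and on $C''(E)$. For a left action of $G$ on $X$, $\pi^{X,G}:X\to X/G$ is the quotient map. $G$ is a symmetry group of the DLDPS $\mathcal{M}$ if $G$ acts on the fiber bundle $\phi$, $L_d$ and $\mathcal{D}_d$ are invariant under the diagonal action, $\mathcal{D}$ is invariant under the lifted (differential) action, and $\mathcal{P}$ is equivariant for the induced actions on $\tilde p_{34}^*\mathcal{D}$ and on $\ker d\phi\subset TE$. Discrete connections. An (affine) discrete connection $\mathcal{A}_d$ on a principal $G$-bundle $\pi^{M,G}:M\to M/G$ is given by a submanifold $Hor\subset M\times M$, invariant under the diagonal $G$-action and containing $\{(m,\gamma(m)\cdot m):m\in M\}$ for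 some smooth $\gamma:M\to G$ with $\gamma(g\cdot m)=g\gamma(m)g^{-1}$, such that $(id_M\times\pi^{M,G})|_{Hor}:Hor\to M\times(M/G)$ is an injective local diffeomorphism. Its domain is $\{(m_0,g\cdot m_1):(m_0,m_1)\in Hor,\ g\in G\}$, and for $(m_0,m_1)$ in the domain $\mathcal{A}_d(m_0,m_1)\in G$ is the unique $g$ with $(m_0,g^{-1}\cdot m_1)\in Hor$; it is smooth and $\mathcal{A}_d(g_0\cdot m_0,g_1\cdot m_1)=g_1\mathcal{A}_d(m_0,m_1)g_0^{-1}$. Convention: the domain is all of $M\times M$. Reduction. Let $\widetilde{G}_E:=(E\times G)/G$ for the action $g\cdot(\epsilon,w)=(g\cdot\epsilon,gwg^{-1})$, a fiber bundle over $M/G$ via $p^{M/G}(\pi^{E\times G,G}(\epsilon,w)):=\pi^{M,G}(\phi(\epsilon))$. Define $\Upsilon_{\mathcal{A}_d}:C'(E)\to C'(\widetilde{G}_E)=\widetilde{G}_E\times(M/G)$ by $\Upsilon_{\mathcal{A}_d}(\epsilon,m):=(\pi^{E\times G,G}(\epsilon,\mathcal{A}_d(\phi(\epsilon),m)),\pi^{M,G}(m))$; it is a principal $G$-bundle for the diagonal action. The reduced system $\mathcal{M}/(G,\mathcal{A}_d)=(\widetilde{G}_E,\check L_d,\check{\mathcal{D}}_d,\check{\mathcal{D}},\check{\mathcal{P}})$ is the DLDPS over $p^{M/G}$ with $\check L_d\circ\Upsilon_{\mathcal{A}_d}=L_d$, $\check{\mathcal{D}}_d:=\Upsilon_{\mathcal{A}_d}(\mathcal{D}_d)$,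 $\check{\mathcal{D}}:=d\Upsilon_{\mathcal{A}_d}(\mathcal{D})$ and $\check{\mathcal{P}}((v_0,r_1),(v_1,r_2))(\delta v_1,0):=d(p_1\circ\Upsilon_{\mathcal{A}_d})(\epsilon_0,m_1)\big(\mathcal{P}((\epsilon_0,m_1),(\epsilon_1,m_2))(\delta\epsilon_1,0),d\phi(\epsilon_1)(\delta\epsilon_1)\big)$, for any $((\epsilon_0,m_1),(\epsilon_1,m_2))\in C''(E)$ with $\Upsilon_{\mathcal{A}_d}(\epsilon_0,m_1)=(v_0,r_1)$, $\Upsilon_{\mathcal{A}_d}(\epsilon_1,m_2)=(v_1,r_2)$ and the unique $(\delta\epsilon_1,0)\in\mathcal{D}_{(\epsilon_1,m_2)}$ with $d\Upsilon_{\mathcal{A}_d}(\epsilon_1,m_2)(\delta\epsilon_1,0)=(\delta v_1,0)$ (this is well defined). *)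

theory Defs
  imports "HOL-Analysis.Analysis" "HOL-Algebra.Group_Action"
begin

section \<open>Smooth manifolds\<close>

text \<open>
  The libraries contain no general theory of manifolds.  A manifold is a carrier set with an atlas
  of charts whose values lie in a finite-dimensional linear subspace \<open>V\<close> of some normed space
  type; using a subspace rather than the whole type allows every dimension, including 0.
  A chart is a pair of its domain and its coordinate map.  As part of the data every point \<open>p\<close> has
  a preferred chart around it, and a tangent vector at \<open>p\<close> is represented by its
  coordinates in that chart, so that the tangent space at every point is the set \<open>V\<close>.
\<close>

type_synonym ('a, 'e) chart = "'a set \<times> ('a \<Rightarrow> 'e)"

record ('a, 'e) mfd =
  mcarrier :: "'a set"
  mmodel :: "'e set"
  matlas :: "('a, 'e) chart set"
  mpref :: "'a \<Rightarrow> ('a, 'e) chart"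

text \<open>\<open>Ck_on V k S f\<close>: \<open>f\<close> is of class \<open>C\<^sup>k\<close> on the relatively open subset \<open>S\<close> of \<open>V\<close>.\<close>

primrec Ck_on :: "'e::real_normed_vector set \<Rightarrow> nat \<Rightarrow> 'e set \<Rightarrow> ('e \<Rightarrow> 'f::real_normed_vector) \<Rightarrow> bool" where
  "Ck_on V 0 S f \<longleftrightarrow> continuous_on S f"
| "Ck_on V (Suc k) S f \<longleftrightarrow>
    (\<exists>f'. (\<forall>x\<in>S. (f has_derivative f' x) (at x within S)) \<and> (\<forall>v\<in>V. Ck_on V k S (\<lambda>x. f' x v)))"

definition Cinf_on :: "'e::real_normed_vector set \<Rightarrow> 'e set \<Rightarrow> ('e \<Rightarrow> 'f::real_normed_vector) \<Rightarrow> bool" where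
  "Cinf_on V S f \<longleftrightarrow> openin (top_of_set V) S \<and> (\<forall>k. Ck_on V k S f)"

text \<open>The coordinate expression of a map in a chart of the source and a chart of the target.\<close>

definition chart_rep :: "('a, 'e) chart \<Rightarrow> ('b, 'f) chart \<Rightarrow> ('a \<Rightarrow> 'b) \<Rightarrow> 'e \<Rightarrow> 'f" where
  "chart_rep c d f = snd d \<circ> f \<circ> inv_into (fst c) (snd c)"

definition compatible_charts ::
    "'e::real_normed_vector set \<Rightarrow> ('a, 'e) chart \<Rightarrow> ('a, 'e) chart \<Rightarrow> bool" where
  "compatible_charts V c d \<longleftrightarrow>
     Cinf_on V (snd c ` (fst c \<inter> fst d)) (chart_rep c d id) \<and>
     Cinf_on V (snd d ` (fst c \<inter> fst d)) (chart_rep d c id)"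

definition mtopology :: "('a, 'e::real_normed_vector) mfd \<Rightarrow> 'a topology" where
  "mtopology M = topology (\<lambda>U. U \<subseteq> mcarrier M \<and>
     (\<forall>c\<in>matlas M. openin (top_of_set (mmodel M)) (snd c ` (U \<inter> fst c))))"

definition is_manifold :: "('a, 'e::real_normed_vector) mfd \<Rightarrow> bool" where
  "is_manifold M \<longleftrightarrow>
     (\<exists>B. finite B \<and> mmodel M = span B) \<and>
     (\<forall>c\<in>matlas M. fst c \<subseteq> mcarrier M \<and> inj_on (snd c) (fst c) \<and>
        openin (top_of_set (mmodel M)) (snd c ` fst c)) \<and>
     (\<forall>c\<in>matlas M. \<forall>d\<in>matlas M. compatible_charts (mmodel M) c d) \<and>
     (\<forall>p\<in>mcarrier M. mpref M p \<in> matlas M \<and> p \<in> fst (mpref M p)) \<and>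
     Hausdorff_space (mtopology M) \<and> second_countable (mtopology M)"

text \<open>The members of the maximal atlas.\<close>

definition is_chart :: "('a, 'e::real_normed_vector) mfd \<Rightarrow> ('a, 'e) chart \<Rightarrow> bool" where
  "is_chart M c \<longleftrightarrow> fst c \<subseteq> mcarrier M \<and> inj_on (snd c) (fst c) \<and>
     openin (top_of_set (mmodel M)) (snd c ` fst c) \<and>
     (\<forall>d\<in>matlas M. compatible_charts (mmodel M) c d)"

definition msmooth_open ::
    "('a, 'e::real_normed_vector) mfd \<Rightarrow> ('b, 'f::real_normed_vector) mfd \<Rightarrow> 'a set \<Rightarrow> ('a \<Rightarrow> 'b) \<Rightarrow> bool" where
  "msmooth_open M N U f \<longleftrightarrow> openin (mtopology M) U \<and> f \<in> U \<rightarrow> mcarrier N \<and>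
     (\<forall>p\<in>U. \<exists>c\<in>matlas M. \<exists>d\<in>matlas N. \<exists>W.
        openin (mtopology M) W \<and> p \<in> W \<and> W \<subseteq> U \<inter> fst c \<and> f ` W \<subseteq> fst d \<and>
        Cinf_on (mmodel M) (snd c ` W) (chart_rep c d f))"

text \<open>
  Smoothness on an arbitrary subset means local extendability to smooth maps on open sets.  On an
  open set, and on an embedded submanifold with its induced structure, this is the usual notion.
\<close>

definition msmooth ::
    "('a, 'e::real_normed_vector) mfd \<Rightarrow> ('b, 'f::real_normed_vector) mfd \<Rightarrow> 'a set \<Rightarrow> ('a \<Rightarrow> 'b) \<Rightarrow> bool" where
  "msmooth M N S f \<longleftrightarrow> S \<subseteq> mcarrier M \<and> f \<in> S \<rightarrow> mcarrier N \<and>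
     (\<forall>p\<in>S. \<exists>W h. p \<in> W \<and> msmooth_open M N W h \<and> (\<forall>x\<in>S \<inter> W. h x = f x))"

definition mdiff ::
    "('a, 'e::real_normed_vector) mfd \<Rightarrow> ('b, 'f::real_normed_vector) mfd \<Rightarrow> ('a \<Rightarrow> 'b) \<Rightarrow> 'a \<Rightarrow> 'e \<Rightarrow> 'f" where
  "mdiff M N f p = frechet_derivative (chart_rep (mpref M p) (mpref N (f p)) f)
     (at (snd (mpref M p) p) within mmodel M)"

definition diffeo_on ::
    "('a, 'e::real_normed_vector) mfd \<Rightarrow> ('b, 'f::real_normed_vector) mfd \<Rightarrow> 'a set \<Rightarrow> 'b set \<Rightarrow> ('a \<Rightarrow> 'b) \<Rightarrow> bool" where
  "diffeo_on M N A B f \<longleftrightarrow> bij_betw f A B \<and> msmooth M N A f \<and> msmooth N M B (inv_into A f)"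

definition embedded_submanifold :: "('a, 'e::real_normed_vector) mfd \<Rightarrow> 'a set \<Rightarrow> bool" where
  "embedded_submanifold M S \<longleftrightarrow> S \<subseteq> mcarrier M \<and>
     (\<forall>p\<in>S. \<exists>c W. is_chart M c \<and> p \<in> fst c \<and> subspace W \<and> W \<subseteq> mmodel M \<and>
        snd c ` (S \<inter> fst c) = snd c ` fst c \<inter> W)"

text \<open>For an embedded submanifold \<open>S\<close> of \<open>M\<close>: the restriction of \<open>f\<close> to \<open>S\<close> is a local diffeomorphism into \<open>N\<close>.\<close>

definition local_diffeo_on ::
    "('a, 'e::real_normed_vector) mfd \<Rightarrow> ('b, 'f::real_normed_vector) mfd \<Rightarrow> 'a set \<Rightarrow> ('a \<Rightarrow> 'b) \<Rightarrow> bool" where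
  "local_diffeo_on M N S f \<longleftrightarrow> (\<forall>p\<in>S. \<exists>W. openin (mtopology M) W \<and> p \<in> W \<and>
     openin (mtopology N) (f ` (S \<inter> W)) \<and> diffeo_on M N (S \<inter> W) (f ` (S \<inter> W)) f)"

subsection \<open>Constructions\<close>

definition linear_mfd :: "'e set \<Rightarrow> ('e, 'e) mfd" where
  "linear_mfd V = \<lparr>mcarrier = V, mmodel = V, matlas = {(V, id)}, mpref = (\<lambda>_. (V, id))\<rparr>"

abbreviation real_mfd :: "(real, real) mfd" where
  "real_mfd \<equiv> linear_mfd UNIV"

definition prod_chart :: "('a, 'e) chart \<Rightarrow> ('b, 'f) chart \<Rightarrow> ('a \<times> 'b, 'e \<times> 'f) chart" where
  "prod_chart c d = (fst c \<times> fst d, map_prod (snd c) (snd d))"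

text \<open>By the choice of preferred charts, a tangent vector of a product is a pair of tangent vectors.\<close>

definition prod_mfd :: "('a, 'e) mfd \<Rightarrow> ('b, 'f) mfd \<Rightarrow> ('a \<times> 'b, 'e \<times> 'f) mfd" where
  "prod_mfd M N = \<lparr>mcarrier = mcarrier M \<times> mcarrier N, mmodel = mmodel M \<times> mmodel N,
     matlas = {prod_chart c d | c d. c \<in> matlas M \<and> d \<in> matlas N},
     mpref = (\<lambda>(p, q). prod_chart (mpref M p) (mpref N q))\<rparr>"

text \<open>
  The \<open>n\<close>-fold power of a manifold.  Its points are functions on \<open>{..<n}\<close>; its model consists of
  sequences vanishing from \<open>n\<close> on, inside the normed space of bounded sequences.
\<close>

definition power_chart :: "nat \<Rightarrow> (nat \<Rightarrow> ('a, 'e::real_normed_vector) chart) \<Rightarrow> (nat \<Rightarrow> 'a, nat \<Rightarrow>\<^sub>C 'e) chart" where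
  "power_chart n c = (PiE {..<n} (\<lambda>k. fst (c k)),
     \<lambda>x. Bcontfun (\<lambda>k. if k < n then snd (c k) (x k) else 0))"

definition power_mfd :: "nat \<Rightarrow> ('a, 'e::real_normed_vector) mfd \<Rightarrow> (nat \<Rightarrow> 'a, nat \<Rightarrow>\<^sub>C 'e) mfd" where
  "power_mfd n M = \<lparr>mcarrier = PiE {..<n} (\<lambda>_. mcarrier M),
     mmodel = {v. (\<forall>k<n. apply_bcontfun v k \<in> mmodel M) \<and> (\<forall>k\<ge>n. apply_bcontfun v k = 0)},
     matlas = {power_chart n c | c. \<forall>k<n. c k \<in> matlas M},
     mpref = (\<lambda>x. power_chart n (\<lambda>k. mpref M (x k)))\<rparr>"

text \<open>
  The tangent bundle: \<open>(p, v)\<close> is the tangent vector at \<open>p\<close> with coordinates \<open>v\<close> in the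
  preferred chart at \<open>p\<close>.
\<close>

definition tangent_chart :: "('a, 'e::real_normed_vector) mfd \<Rightarrow> ('a, 'e) chart \<Rightarrow> ('a \<times> 'e, 'e \<times> 'e) chart" where
  "tangent_chart M c = (fst c \<times> mmodel M, \<lambda>(p, v). (snd c p,
     frechet_derivative (chart_rep (mpref M p) c id) (at (snd (mpref M p) p) within mmodel M) v))"

definition tangent_mfd :: "('a, 'e::real_normed_vector) mfd \<Rightarrow> ('a \<times> 'e, 'e \<times> 'e) mfd" where
  "tangent_mfd M = \<lparr>mcarrier = mcarrier M \<times> mmodel M, mmodel = mmodel M \<times> mmodel M,
     matlas = tangent_chart M ` matlas M, mpref = (\<lambda>(p, v). tangent_chart M (mpref M p))\<rparr>"

text \<open>
  A vector subbundle \<open>D\<close> of the tangent bundle, given by its fibers: it is locally spanned by a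
  frame of linearly independent smooth vector fields.
\<close>

definition vector_subbundle :: "('a, 'e::real_normed_vector) mfd \<Rightarrow> ('a \<Rightarrow> 'e set) \<Rightarrow> bool" where
  "vector_subbundle M D \<longleftrightarrow> (\<forall>p\<in>mcarrier M. \<exists>W (n::nat) s. openin (mtopology M) W \<and> p \<in> W \<and>
     (\<forall>i<n. msmooth M (tangent_mfd M) W (\<lambda>q. (q, s i q))) \<and>
     (\<forall>q\<in>W. inj_on (\<lambda>i. s i q) {..<n} \<and> independent ((\<lambda>i. s i q) ` {..<n}) \<and>
        span ((\<lambda>i. s i q) ` {..<n}) = D q))"

definition fiber_bundle ::
    "('a, 'e::real_normed_vector) mfd \<Rightarrow> ('b, 'f::real_normed_vector) mfd \<Rightarrow>
     ('c, 'h::real_normed_vector) mfd \<Rightarrow> ('a \<Rightarrow> 'b) \<Rightarrow> bool" where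
  "fiber_bundle E M F \<phi> \<longleftrightarrow> is_manifold E \<and> is_manifold M \<and> is_manifold F \<and>
     msmooth E M (mcarrier E) \<phi> \<and>
     (\<forall>m\<in>mcarrier M. \<exists>U \<Phi>. openin (mtopology M) U \<and> m \<in> U \<and>
        diffeo_on E (prod_mfd M F) {e \<in> mcarrier E. \<phi> e \<in> U} (U \<times> mcarrier F) \<Phi> \<and>
        (\<forall>e\<in>mcarrier E. \<phi> e \<in> U \<longrightarrow> fst (\<Phi> e) = \<phi> e))"

section \<open>Lie groups, actions and principal bundles\<close>

definition lie_group :: "('g, 'z) monoid_scheme \<Rightarrow> ('g, 'k::real_normed_vector) mfd \<Rightarrow> bool" where
  "lie_group G MG \<longleftrightarrow> group G \<and> is_manifold MG \<and> mcarrier MG = carrier G \<and>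
     msmooth (prod_mfd MG MG) MG (carrier G \<times> carrier G) (\<lambda>(g, h). g \<otimes>\<^bsub>G\<^esub> h) \<and>
     msmooth MG MG (carrier G) (\<lambda>g. inv\<^bsub>G\<^esub> g)"

definition smooth_left_action ::
    "('g, 'z) monoid_scheme \<Rightarrow> ('g, 'k::real_normed_vector) mfd \<Rightarrow> ('a, 'e::real_normed_vector) mfd \<Rightarrow>
     ('g \<Rightarrow> 'a \<Rightarrow> 'a) \<Rightarrow> bool" where
  "smooth_left_action G MG X act \<longleftrightarrow>
     msmooth (prod_mfd MG X) X (carrier G \<times> mcarrier X) (\<lambda>(g, x). act g x) \<and>
     (\<forall>x\<in>mcarrier X. act \<one>\<^bsub>G\<^esub> x = x) \<and>
     (\<forall>g\<in>carrier G. \<forall>h\<in>carrier G. \<forall>x\<in>mcarrier X. act (g \<otimes>\<^bsub>G\<^esub> h) x = act g (act h x))"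

definition smooth_right_action ::
    "('g, 'z) monoid_scheme \<Rightarrow> ('g, 'k::real_normed_vector) mfd \<Rightarrow> ('a, 'e::real_normed_vector) mfd \<Rightarrow>
     ('a \<Rightarrow> 'g \<Rightarrow> 'a) \<Rightarrow> bool" where
  "smooth_right_action G MG X act \<longleftrightarrow>
     msmooth (prod_mfd X MG) X (mcarrier X \<times> carrier G) (\<lambda>(x, g). act x g) \<and>
     (\<forall>x\<in>mcarrier X. act x \<one>\<^bsub>G\<^esub> = x) \<and>
     (\<forall>g\<in>carrier G. \<forall>h\<in>carrier G. \<forall>x\<in>mcarrier X. act x (g \<otimes>\<^bsub>G\<^esub> h) = act (act x g) h)"

definition free_action :: "('g, 'z) monoid_scheme \<Rightarrow> 'a set \<Rightarrow> ('g \<Rightarrow> 'a \<Rightarrow> 'a) \<Rightarrow> bool" where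
  "free_action G X act \<longleftrightarrow> (\<forall>g\<in>carrier G. \<forall>x\<in>X. act g x = x \<longrightarrow> g = \<one>\<^bsub>G\<^esub>)"

text \<open>
  The quotient manifold \<open>X/G\<close> of a free action.  Its points are the orbits; the charts are the
  injective coordinate maps, with open domain and open image, whose composition with the
  projection \<open>X \<rightarrow> X/G\<close> is a smooth submersion.  Whenever \<open>X/G\<close> has a smooth structure for
  which the projection is a submersion, that structure is unique and these charts are its
  maximal atlas.  The model is any subspace of dimension \<open>dim X - dim G\<close>.
\<close>

definition quot_model :: "('g, 'k::real_normed_vector) mfd \<Rightarrow> ('a, 'e::real_normed_vector) mfd \<Rightarrow> 'e set" where
  "quot_model MG X = (SOME V. subspace V \<and> V \<subseteq> mmodel X \<and> dim V = dim (mmodel X) - dim (mmodel MG))"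

definition quot_atlas ::
    "('g, 'z) monoid_scheme \<Rightarrow> ('g, 'k::real_normed_vector) mfd \<Rightarrow> ('a, 'e::real_normed_vector) mfd \<Rightarrow>
     ('g \<Rightarrow> 'a \<Rightarrow> 'a) \<Rightarrow> ('a set, 'e) chart set" where
  "quot_atlas G MG X act = {(U, \<psi>). U \<subseteq> orbits G (mcarrier X) act \<and> inj_on \<psi> U \<and>
     openin (top_of_set (quot_model MG X)) (\<psi> ` U) \<and>
     (let A = {x \<in> mcarrier X. orbit G act x \<in> U};
          f = (\<lambda>x. \<psi> (orbit G act x));
          N = linear_mfd (quot_model MG X)
      in openin (mtopology X) A \<and> msmooth X N A f \<and>
         (\<forall>x\<in>A. mdiff X N f x ` mmodel X = quot_model MG X))}"

definition quot_mfd ::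
    "('g, 'z) monoid_scheme \<Rightarrow> ('g, 'k::real_normed_vector) mfd \<Rightarrow> ('a, 'e::real_normed_vector) mfd \<Rightarrow>
     ('g \<Rightarrow> 'a \<Rightarrow> 'a) \<Rightarrow> ('a set, 'e) mfd" where
  "quot_mfd G MG X act = \<lparr>mcarrier = orbits G (mcarrier X) act, mmodel = quot_model MG X,
     matlas = quot_atlas G MG X act,
     mpref = (\<lambda>r. SOME c. c \<in> quot_atlas G MG X act \<and> r \<in> fst c)\<rparr>"

definition principal_bundle ::
    "('g, 'z) monoid_scheme \<Rightarrow> ('g, 'k::real_normed_vector) mfd \<Rightarrow> ('a, 'e::real_normed_vector) mfd \<Rightarrow>
     ('g \<Rightarrow> 'a \<Rightarrow> 'a) \<Rightarrow> bool" where
  "principal_bundle G MG X act \<longleftrightarrow> lie_group G MG \<and> is_manifold X \<and>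
     smooth_left_action G MG X act \<and> free_action G (mcarrier X) act \<and>
     is_manifold (quot_mfd G MG X act) \<and>
     msmooth X (quot_mfd G MG X act) (mcarrier X) (orbit G act) \<and>
     (\<forall>r\<in>orbits G (mcarrier X) act. \<exists>U \<Psi>. openin (mtopology (quot_mfd G MG X act)) U \<and> r \<in> U \<and>
        diffeo_on X (prod_mfd (quot_mfd G MG X act) MG)
          {x \<in> mcarrier X. orbit G act x \<in> U} (U \<times> carrier G) \<Psi> \<and>
        (\<forall>x\<in>mcarrier X. orbit G act x \<in> U \<longrightarrow> fst (\<Psi> x) = orbit G act x \<and>
           (\<forall>g\<in>carrier G. snd (\<Psi> (act g x)) = g \<otimes>\<^bsub>G\<^esub> snd (\<Psi> x))))"

definition diag_act :: "('g \<Rightarrow> 'a \<Rightarrow> 'a) \<Rightarrow> ('g \<Rightarrow> 'b \<Rightarrow> 'b) \<Rightarrow> 'g \<Rightarrow> 'a \<times> 'b \<Rightarrow> 'a \<times> 'b" where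
  "diag_act a b g = map_prod (a g) (b g)"

definition acts_on_bundle ::
    "('g, 'z) monoid_scheme \<Rightarrow> ('g, 'k::real_normed_vector) mfd \<Rightarrow> ('a, 'e::real_normed_vector) mfd \<Rightarrow>
     ('b, 'f::real_normed_vector) mfd \<Rightarrow> ('c, 'h::real_normed_vector) mfd \<Rightarrow> ('a \<Rightarrow> 'b) \<Rightarrow>
     ('g \<Rightarrow> 'a \<Rightarrow> 'a) \<Rightarrow> ('g \<Rightarrow> 'b \<Rightarrow> 'b) \<Rightarrow> ('c \<Rightarrow> 'g \<Rightarrow> 'c) \<Rightarrow> bool" where
  "acts_on_bundle G MG E M F \<phi> actE actM actF \<longleftrightarrow>
     smooth_left_action G MG E actE \<and> free_action G (mcarrier E) actE \<and>
     smooth_left_action G MG M actM \<and> free_action G (mcarrier M) actM \<and>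
     smooth_right_action G MG F actF \<and>
     principal_bundle G MG M actM \<and>
     (\<forall>g\<in>carrier G. \<forall>e\<in>mcarrier E. \<phi> (actE g e) = actM g (\<phi> e)) \<and>
     (\<forall>m\<in>mcarrier M. \<exists>U \<Phi>. openin (mtopology M) U \<and> m \<in> U \<and>
        (\<forall>g\<in>carrier G. \<forall>u\<in>U. actM g u \<in> U) \<and>
        diffeo_on E (prod_mfd M F) {e \<in> mcarrier E. \<phi> e \<in> U} (U \<times> mcarrier F) \<Phi> \<and>
        (\<forall>e\<in>mcarrier E. \<phi> e \<in> U \<longrightarrow> fst (\<Phi> e) = \<phi> e \<and>
           (\<forall>g\<in>carrier G. \<Phi> (actE g e) = (actM g (\<phi> e), actF (snd (\<Phi> e)) (inv\<^bsub>G\<^esub> g)))))"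

section \<open>Discrete Lagrange--D'Alembert--Poincare systems\<close>

text \<open>
  \<open>dDist S x\<close> is the fiber over \<open>x = (\<epsilon>, m)\<close> of the subbundle of nonholonomic variations; its
  elements are the pairs \<open>(\<delta>\<epsilon>, 0)\<close>.  \<open>dP S x\<^sub>0 x\<^sub>1\<close> is the linear map on the fiber over \<open>x\<^sub>1\<close>.
\<close>

record ('a, 'e, 'b, 'f) dldps =
  dE :: "('a, 'e) mfd"
  dM :: "('b, 'f) mfd"
  dphi :: "'a \<Rightarrow> 'b"
  dL :: "'a \<times> 'b \<Rightarrow> real"
  dDd :: "('a \<times> 'b) set"
  dDist :: "'a \<times> 'b \<Rightarrow> ('e \<times> 'f) set"
  dP :: "'a \<times> 'b \<Rightarrow> 'a \<times> 'b \<Rightarrow> 'e \<times> 'f \<Rightarrow> 'e"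

definition C1 :: "('a, 'e, 'b, 'f) dldps \<Rightarrow> ('a \<times> 'b, 'e \<times> 'f) mfd" where
  "C1 S = prod_mfd (dE S) (dM S)"

definition C2 :: "('a, 'e, 'b, 'f) dldps \<Rightarrow> (('a \<times> 'b) \<times> ('a \<times> 'b)) set" where
  "C2 S = {(x0, x1). x0 \<in> mcarrier (C1 S) \<and> x1 \<in> mcarrier (C1 S) \<and> dphi S (fst x1) = snd x0}"

definition is_dldps ::
    "('c, 'h::real_normed_vector) mfd \<Rightarrow>
     ('a, 'e::real_normed_vector, 'b, 'f::real_normed_vector) dldps \<Rightarrow> bool" where
  "is_dldps F S \<longleftrightarrow> fiber_bundle (dE S) (dM S) F (dphi S) \<and>
     msmooth (C1 S) real_mfd (mcarrier (C1 S)) (dL S) \<and>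
     embedded_submanifold (C1 S) (dDd S) \<and>
     vector_subbundle (C1 S) (dDist S) \<and>
     (\<forall>x\<in>mcarrier (C1 S). \<forall>\<delta>\<in>dDist S x. snd \<delta> = 0) \<and>
     (\<forall>(x0, x1)\<in>C2 S.
        (\<forall>\<delta>\<in>dDist S x1. dP S x0 x1 \<delta> \<in> mmodel (dE S) \<and>
           mdiff (dE S) (dM S) (dphi S) (fst x0) (dP S x0 x1 \<delta>) = 0) \<and>
        (\<forall>\<delta>\<in>dDist S x1. \<forall>\<eta>\<in>dDist S x1. dP S x0 x1 (\<delta> + \<eta>) = dP S x0 x1 \<delta> + dP S x0 x1 \<eta>) \<and>
        (\<forall>\<delta>\<in>dDist S x1. \<forall>t. dP S x0 x1 (t *\<^sub>R \<delta>) = t *\<^sub>R dP S x0 x1 \<delta>)) \<and>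
     msmooth (prod_mfd (C1 S) (tangent_mfd (C1 S))) (tangent_mfd (dE S))
       {(x0, (x1, \<delta>)) | x0 x1 \<delta>. (x0, x1) \<in> C2 S \<and> \<delta> \<in> dDist S x1}
       (\<lambda>(x0, (x1, \<delta>)). (fst x0, dP S x0 x1 \<delta>))"

subsection \<open>Trajectories and the section of motion\<close>

text \<open>
  A discrete path is \<open>x \<in> C'(E)\<^sup>N\<close> with \<open>x k = (\<epsilon>\<^sub>k, m\<^sub>k\<^sub>+\<^sub>1)\<close> for \<open>k < N\<close>; similarly
  \<open>\<delta> k = (\<delta>\<epsilon>\<^sub>k, \<delta>m\<^sub>k\<^sub>+\<^sub>1)\<close> for a variation \<open>\<delta>\<close>.
\<close>

definition discrete_path ::
    "('a, 'e::real_normed_vector, 'b, 'f::real_normed_vector) dldps \<Rightarrow> nat \<Rightarrow> (nat \<Rightarrow> 'a \<times> 'b) \<Rightarrow> bool" where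
  "discrete_path S N x \<longleftrightarrow> N \<ge> 2 \<and> x \<in> mcarrier (power_mfd N (C1 S)) \<and>
     (\<forall>k\<in>{1..N-1}. dphi S (fst (x k)) = snd (x (k-1)))"

definition nh_variation ::
    "('a, 'e::real_normed_vector, 'b, 'f::real_normed_vector) dldps \<Rightarrow> nat \<Rightarrow> (nat \<Rightarrow> 'a \<times> 'b) \<Rightarrow>
     (nat \<Rightarrow>\<^sub>C ('e \<times> 'f)) \<Rightarrow> bool" where
  "nh_variation S N x \<delta> \<longleftrightarrow> \<delta> \<in> mmodel (power_mfd N (C1 S)) \<and>
     (\<forall>k\<in>{1..N-1}. snd (\<delta> (k-1)) = mdiff (dE S) (dM S) (dphi S) (fst (x k)) (fst (\<delta> k))) \<and>
     snd (\<delta> (N-1)) = 0 \<and>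
     (\<exists>\<eta>. (\<forall>k\<in>{1..N-1}. \<eta> k \<in> dDist S (x k)) \<and>
        fst (\<delta> (N-1)) = fst (\<eta> (N-1)) \<and>
        (\<forall>k\<in>{1..N-2}. fst (\<delta> k) = fst (\<eta> k) + dP S (x k) (x (k+1)) (\<eta> (k+1))) \<and>
        fst (\<delta> 0) = dP S (x 0) (x 1) (\<eta> 1))"

definition discrete_action :: "('a, 'e, 'b, 'f) dldps \<Rightarrow> nat \<Rightarrow> (nat \<Rightarrow> 'a \<times> 'b) \<Rightarrow> real" where
  "discrete_action S N x = (\<Sum>k<N. dL S (x k))"

definition trajectory ::
    "('a, 'e::real_normed_vector, 'b, 'f::real_normed_vector) dldps \<Rightarrow> nat \<Rightarrow> (nat \<Rightarrow> 'a \<times> 'b) \<Rightarrow> bool" where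
  "trajectory S N x \<longleftrightarrow> discrete_path S N x \<and> (\<forall>k<N. x k \<in> dDd S) \<and>
     (\<forall>\<delta>. nh_variation S N x \<delta> \<longrightarrow>
        mdiff (power_mfd N (C1 S)) real_mfd (discrete_action S N) x \<delta> = 0)"

definition motion_section ::
    "('a, 'e::real_normed_vector, 'b, 'f::real_normed_vector) dldps \<Rightarrow> 'a \<times> 'b \<Rightarrow> 'a \<times> 'b \<Rightarrow> 'e \<times> 'f \<Rightarrow> real" where
  "motion_section S x0 x1 \<delta> =
     mdiff (dE S) real_mfd (\<lambda>e. dL S (e, snd x1)) (fst x1) (fst \<delta>) +
     mdiff (dM S) real_mfd (\<lambda>m. dL S (fst x0, m)) (snd x0)
       (mdiff (dE S) (dM S) (dphi S) (fst x1) (fst \<delta>)) +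
     mdiff (dE S) real_mfd (\<lambda>e. dL S (e, snd x0)) (fst x0) (dP S x0 x1 \<delta>)"

definition satisfies_motion ::
    "('a, 'e::real_normed_vector, 'b, 'f::real_normed_vector) dldps \<Rightarrow> nat \<Rightarrow> (nat \<Rightarrow> 'a \<times> 'b) \<Rightarrow> bool" where
  "satisfies_motion S N x \<longleftrightarrow> (\<forall>k<N. x k \<in> dDd S) \<and>
     (\<forall>k\<in>{1..N-1}. \<forall>\<delta>\<in>dDist S (x k). motion_section S (x (k-1)) (x k) \<delta> = 0)"

section \<open>Symmetries, discrete connections and reduction\<close>

definition symmetry_group ::
    "('g, 'z) monoid_scheme \<Rightarrow> ('g, 'k::real_normed_vector) mfd \<Rightarrow> ('c, 'h::real_normed_vector) mfd \<Rightarrow>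
     ('g \<Rightarrow> 'a \<Rightarrow> 'a) \<Rightarrow> ('g \<Rightarrow> 'b \<Rightarrow> 'b) \<Rightarrow> ('c \<Rightarrow> 'g \<Rightarrow> 'c) \<Rightarrow>
     ('a, 'e::real_normed_vector, 'b, 'f::real_normed_vector) dldps \<Rightarrow> bool" where
  "symmetry_group G MG F actE actM actF S \<longleftrightarrow>
     acts_on_bundle G MG (dE S) (dM S) F (dphi S) actE actM actF \<and>
     (\<forall>g\<in>carrier G. let a = diag_act actE actM g in
        (\<forall>x\<in>mcarrier (C1 S). dL S (a x) = dL S x) \<and>
        (\<forall>x\<in>dDd S. a x \<in> dDd S) \<and>
        (\<forall>x\<in>mcarrier (C1 S). \<forall>\<delta>\<in>dDist S x. mdiff (C1 S) (C1 S) a x \<delta> \<in> dDist S (a x)) \<and>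
        (\<forall>(x0, x1)\<in>C2 S. \<forall>\<delta>\<in>dDist S x1.
           dP S (a x0) (a x1) (mdiff (C1 S) (C1 S) a x1 \<delta>) =
           mdiff (dE S) (dE S) (actE g) (fst x0) (dP S x0 x1 \<delta>)))"

definition discrete_connection ::
    "('g, 'z) monoid_scheme \<Rightarrow> ('g, 'k::real_normed_vector) mfd \<Rightarrow> ('b, 'f::real_normed_vector) mfd \<Rightarrow>
     ('g \<Rightarrow> 'b \<Rightarrow> 'b) \<Rightarrow> ('b \<times> 'b) set \<Rightarrow> bool" where
  "discrete_connection G MG M act Hor \<longleftrightarrow>
     embedded_submanifold (prod_mfd M M) Hor \<and>
     (\<forall>g\<in>carrier G. \<forall>x\<in>Hor. diag_act act act g x \<in> Hor) \<and>
     (\<exists>\<gamma>. msmooth M MG (mcarrier M) \<gamma> \<and>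
        (\<forall>g\<in>carrier G. \<forall>m\<in>mcarrier M. \<gamma> (act g m) = g \<otimes>\<^bsub>G\<^esub> \<gamma> m \<otimes>\<^bsub>G\<^esub> inv\<^bsub>G\<^esub> g) \<and>
        (\<forall>m\<in>mcarrier M. (m, act (\<gamma> m) m) \<in> Hor)) \<and>
     inj_on (map_prod id (orbit G act)) Hor \<and>
     local_diffeo_on (prod_mfd M M) (prod_mfd M (quot_mfd G MG M act)) Hor (map_prod id (orbit G act))"

definition connection_domain ::
    "('g, 'z) monoid_scheme \<Rightarrow> ('g \<Rightarrow> 'b \<Rightarrow> 'b) \<Rightarrow> ('b \<times> 'b) set \<Rightarrow> ('b \<times> 'b) set" where
  "connection_domain G act Hor = {(m0, act g m1) | m0 m1 g. (m0, m1) \<in> Hor \<and> g \<in> carrier G}"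

definition connection_form ::
    "('g, 'z) monoid_scheme \<Rightarrow> ('g \<Rightarrow> 'b \<Rightarrow> 'b) \<Rightarrow> ('b \<times> 'b) set \<Rightarrow> 'b \<Rightarrow> 'b \<Rightarrow> 'g" where
  "connection_form G act Hor m0 m1 = (THE g. g \<in> carrier G \<and> (m0, act (inv\<^bsub>G\<^esub> g) m1) \<in> Hor)"

definition conj_act :: "('g, 'z) monoid_scheme \<Rightarrow> ('g \<Rightarrow> 'a \<Rightarrow> 'a) \<Rightarrow> 'g \<Rightarrow> 'a \<times> 'g \<Rightarrow> 'a \<times> 'g" where
  "conj_act G act g = (\<lambda>(e, w). (act g e, g \<otimes>\<^bsub>G\<^esub> w \<otimes>\<^bsub>G\<^esub> inv\<^bsub>G\<^esub> g))"

definition conjugate_bundle ::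
    "('g, 'z) monoid_scheme \<Rightarrow> ('g, 'k::real_normed_vector) mfd \<Rightarrow> ('a, 'e::real_normed_vector) mfd \<Rightarrow>
     ('g \<Rightarrow> 'a \<Rightarrow> 'a) \<Rightarrow> (('a \<times> 'g) set, 'e \<times> 'k) mfd" where
  "conjugate_bundle G MG E act = quot_mfd G MG (prod_mfd E MG) (conj_act G act)"

definition conjugate_proj ::
    "('g, 'z) monoid_scheme \<Rightarrow> ('g \<Rightarrow> 'b \<Rightarrow> 'b) \<Rightarrow> ('a \<Rightarrow> 'b) \<Rightarrow> ('a \<times> 'g) set \<Rightarrow> 'b set" where
  "conjugate_proj G actM \<phi> v = (THE r. \<exists>e w. (e, w) \<in> v \<and> r = orbit G actM (\<phi> e))"

definition Upsilon ::
    "('g, 'z) monoid_scheme \<Rightarrow> ('g \<Rightarrow> 'a \<Rightarrow> 'a) \<Rightarrow> ('g \<Rightarrow> 'b \<Rightarrow> 'b) \<Rightarrow> ('b \<times> 'b) set \<Rightarrow> ('a \<Rightarrow> 'b) \<Rightarrow>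
     'a \<times> 'b \<Rightarrow> ('a \<times> 'g) set \<times> 'b set" where
  "Upsilon G actE actM Hor \<phi> = (\<lambda>(e, m).
     (orbit G (conj_act G actE) (e, connection_form G actM Hor (\<phi> e) m), orbit G actM m))"

text \<open>
  The descriptions \<open>THE\<close> below are to be read on the image of \<open>\<Upsilon>\<close> and on the reduced
  subbundle, where the values do not depend on the representatives.
\<close>

definition reduced_system ::
    "('g, 'z) monoid_scheme \<Rightarrow> ('g, 'k::real_normed_vector) mfd \<Rightarrow>
     ('g \<Rightarrow> 'a \<Rightarrow> 'a) \<Rightarrow> ('g \<Rightarrow> 'b \<Rightarrow> 'b) \<Rightarrow> ('b \<times> 'b) set \<Rightarrow>
     ('a, 'e::real_normed_vector, 'b, 'f::real_normed_vector) dldps \<Rightarrow>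
     (('a \<times> 'g) set, 'e \<times> 'k, 'b set, 'f) dldps" where
  "reduced_system G MG actE actM Hor S = (let
       C = mcarrier (C1 S);
       Q = conjugate_bundle G MG (dE S) actE;
       B = quot_mfd G MG (dM S) actM;
       \<Upsilon> = Upsilon G actE actM Hor (dphi S)
     in \<lparr>dE = Q, dM = B, dphi = conjugate_proj G actM (dphi S),
         dL = (\<lambda>y. THE l. \<exists>x\<in>C. \<Upsilon> x = y \<and> l = dL S x),
         dDd = \<Upsilon> ` dDd S,
         dDist = (\<lambda>y. \<Union>x\<in>{x \<in> C. \<Upsilon> x = y}. mdiff (C1 S) (prod_mfd Q B) \<Upsilon> x ` dDist S x),
         dP = (\<lambda>y0 y1 \<zeta>. THE \<xi>. \<exists>x0 x1 \<delta>. (x0, x1) \<in> C2 S \<and> \<Upsilon> x0 = y0 \<and> \<Upsilon> x1 = y1 \<and>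
            \<delta> \<in> dDist S x1 \<and> mdiff (C1 S) (prod_mfd Q B) \<Upsilon> x1 \<delta> = \<zeta> \<and>
            \<xi> = mdiff (C1 S) Q (fst \<circ> \<Upsilon>) x0
                  (dP S x0 x1 \<delta>, mdiff (dE S) (dM S) (dphi S) (fst x1) (fst \<delta>)))\<rparr>)"

end

theory Submission
  imports Defs
begin

text \<open>
  The equivalence of trajectories with solutions of the equations of motion holds for systems whose
  data are merely differentiable: summing by parts, the differential of the action on the variation
  generated by \<open>\<eta>\<close> is the sum of the values of the section of motion on the components of \<open>\<eta>\<close>, and
  these can be prescribed one at a time.  To apply this to the reduced system one needs charts of
  \<open>(E \<times> G)/G\<close>, which come from the slice \<open>\<sigma> = 1\<close> of a local equivariant map \<open>\<sigma>\<close> to \<open>G\<close>, and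
  differentiable local sections of \<open>\<Upsilon>\<close>, which express the reduced Lagrangian locally as \<open>L\<^sub>d\<close> composed
  with a section.  The two sections of motion correspond under \<open>d\<Upsilon>\<close> by the chain rule, because \<open>L\<^sub>d\<close>
  is the reduced Lagrangian composed with \<open>\<Upsilon>\<close>, and the fibers of \<open>\<Upsilon>\<close> are \<open>G\<close>-orbits.
\<close>

section \<open>Calculus on open subsets of subspaces\<close>

definition rnhds :: "'e::topological_space set \<Rightarrow> 'e \<Rightarrow> 'e filter" where
  "rnhds V x = inf (nhds x) (principal V)"

lemma eventually_rnhds:
  assumes "x \<in> V"
  shows "eventually P (rnhds V x) \<longleftrightarrow> (\<exists>S. openin (top_of_set V) S \<and> x \<in> S \<and> (\<forall>y\<in>S. P y))"
proof
  assume "eventually P (rnhds V x)"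
  then obtain T where T: "open T" "x \<in> T" "\<And>y. y \<in> T \<Longrightarrow> y \<in> V \<Longrightarrow> P y"
    unfolding rnhds_def eventually_inf_principal eventually_nhds by blast
  show "\<exists>S. openin (top_of_set V) S \<and> x \<in> S \<and> (\<forall>y\<in>S. P y)"
    using T assms by (intro exI[of _ "V \<inter> T"]) (auto intro: openin_open_Int)
next
  assume "\<exists>S. openin (top_of_set V) S \<and> x \<in> S \<and> (\<forall>y\<in>S. P y)"
  then obtain S where S: "openin (top_of_set V) S" "x \<in> S" "\<forall>y\<in>S. P y" by blast
  then obtain T where "open T" "S = V \<inter> T" by (auto simp: openin_open)
  then show "eventually P (rnhds V x)"
    using S unfolding rnhds_def eventually_inf_principal eventually_nhds by blast
qed

lemma eventually_rnhds_at:
  assumes "x \<in> V"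
  shows "eventually P (rnhds V x) \<longleftrightarrow> P x \<and> eventually P (at x within V)"
proof -
  have "eventually P (rnhds V x) \<longleftrightarrow> eventually (\<lambda>y. y \<in> V \<longrightarrow> P y) (nhds x)"
    by (simp add: rnhds_def eventually_inf_principal)
  also have "\<dots> \<longleftrightarrow> P x \<and> eventually (\<lambda>y. y \<noteq> x \<longrightarrow> y \<in> V \<longrightarrow> P y) (nhds x)"
    using assms by (auto elim: eventually_mono dest: eventually_nhds_x_imp_x)
  finally show ?thesis by (simp add: eventually_at_filter)
qed

lemma eventually_rnhds_self: "x \<in> V \<Longrightarrow> eventually P (rnhds V x) \<Longrightarrow> P x"
  by (auto simp: eventually_rnhds)

lemma eventually_rnhds_in: "eventually (\<lambda>x. x \<in> V) (rnhds V x)"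
  by (simp add: rnhds_def eventually_inf_principal)

lemma eventually_rnhds_openin: "openin (top_of_set V) S \<Longrightarrow> x \<in> S \<Longrightarrow> eventually (\<lambda>x. x \<in> S) (rnhds V x)"
  by (subst eventually_rnhds) (auto dest: openin_imp_subset)

lemma openin_iff_rnhds:
  "openin (top_of_set V) S \<longleftrightarrow> S \<subseteq> V \<and> (\<forall>x\<in>S. eventually (\<lambda>x. x \<in> S) (rnhds V x))"
proof
  assume "openin (top_of_set V) S"
  then show "S \<subseteq> V \<and> (\<forall>x\<in>S. eventually (\<lambda>x. x \<in> S) (rnhds V x))"
    by (auto dest: openin_imp_subset intro: eventually_rnhds_openin)
next
  assume R: "S \<subseteq> V \<and> (\<forall>x\<in>S. eventually (\<lambda>x. x \<in> S) (rnhds V x))"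
  show "openin (top_of_set V) S"
  proof (subst openin_subopen, intro ballI)
    fix x assume "x \<in> S"
    with R have "x \<in> V" "eventually (\<lambda>x. x \<in> S) (rnhds V x)" by auto
    then show "\<exists>T. openin (top_of_set V) T \<and> x \<in> T \<and> T \<subseteq> S" by (subst (asm) eventually_rnhds) auto
  qed
qed

lemma at_within_openin:
  assumes "openin (top_of_set V) S" "x \<in> S"
  shows "at x within S = at x within V"
proof -
  obtain T where "open T" "S = V \<inter> T" using assms by (auto simp: openin_open)
  then show ?thesis using assms by (intro at_within_nhd[of _ T]) auto
qed

lemma filterlim_rnhds:
  assumes "continuous (at x within V) f" "eventually (\<lambda>x. f x \<in> W) (rnhds V x)" "x \<in> V"
  shows "filterlim f (rnhds W (f x)) (rnhds V x)"
proof -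
  have "filterlim f (nhds (f x)) (rnhds V x)"
    unfolding filterlim_iff
    using assms by (auto simp: eventually_rnhds_at continuous_within filterlim_iff dest: eventually_nhds_x_imp_x)
  then show ?thesis
    using assms(2) unfolding rnhds_def by (auto simp: filterlim_inf filterlim_principal)
qed

lemma has_derivative_rnhds_cong:
  assumes "x \<in> V" "eventually (\<lambda>x. f x = g x) (rnhds V x)" "(f has_derivative D) (at x within V)"
  shows "(g has_derivative D) (at x within V)"
proof -
  have "eventually (\<lambda>x. f x = g x) (at x within V)" "f x = g x"
    using assms by (auto simp: eventually_rnhds_at)
  then show ?thesis using has_derivative_transform_eventually[OF assms(3)] assms(1) by blast
qed

lemma has_derivative_compose_rnhds:
  assumes "(f has_derivative f') (at x within V)" "(g has_derivative g') (at (f x) within W)"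
    and "eventually (\<lambda>x. f x \<in> W) (rnhds V x)" "x \<in> V"
  shows "((\<lambda>x. g (f x)) has_derivative (\<lambda>v. g' (f' v))) (at x within V)"
proof -
  obtain S where S: "openin (top_of_set V) S" "x \<in> S" "\<forall>x\<in>S. f x \<in> W"
    using assms(3,4) by (auto simp: eventually_rnhds)
  have eq: "at x within S = at x within V" using S by (intro at_within_openin)
  have "(g has_derivative g') (at (f x) within f ` S)"
    using assms(2) by (rule has_derivative_subset) (use S in auto)
  then have "(g \<circ> f has_derivative g' \<circ> f') (at x within S)"
    using assms(1) eq by (intro diff_chain_within) auto
  then show ?thesis by (simp add: eq o_def)
qed

lemma has_derivative_line:
  assumes "(f has_derivative D) (at x within V)" "subspace V" "x \<in> V" "v \<in> V"
  shows "((\<lambda>t::real. f (x + t *\<^sub>R v)) has_derivative (\<lambda>t. t *\<^sub>R D v)) (at 0)"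
proof -
  interpret D: bounded_linear D using assms(1) by (rule has_derivative_bounded_linear)
  have "((\<lambda>t::real. x + t *\<^sub>R v) has_derivative (\<lambda>t. t *\<^sub>R v)) (at 0 within UNIV)"
    by (auto intro!: derivative_eq_intros)
  then have "((\<lambda>t::real. f (x + t *\<^sub>R v)) has_derivative (\<lambda>t. D (t *\<^sub>R v))) (at 0 within UNIV)"
  proof (rule has_derivative_compose_rnhds)
    show "(f has_derivative D) (at (x + 0 *\<^sub>R v) within V)" using assms(1) by simp
    show "\<forall>\<^sub>F t in rnhds UNIV 0. x + t *\<^sub>R v \<in> V"
      using assms by (intro always_eventually) (auto intro: subspace_add subspace_scale)
  qed simp
  then show ?thesis by (simp add: D.scaleR)
qed

lemma has_derivative_unique_subspace:
  assumes "(f has_derivative D) (at x within V)" "(f has_derivative D') (at x within V)"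
    and "subspace V" "x \<in> V" "v \<in> V"
  shows "D v = D' v"
  using has_derivative_unique[OF has_derivative_line[OF assms(1,3-5)] has_derivative_line[OF assms(2,3-5)]]
  by (metis scaleR_one)

lemma has_derivative_in_subspace:
  fixes f :: "'e::real_normed_vector \<Rightarrow> 'f::euclidean_space"
  assumes "(f has_derivative D) (at x within V)" "subspace V" "x \<in> V" "v \<in> V"
    and "subspace W" "eventually (\<lambda>x. f x \<in> W) (rnhds V x)"
  shows "D v \<in> W"
proof -
  let ?h = "\<lambda>t::real. f (x + t *\<^sub>R v)"
  have lim: "((\<lambda>t. (1 / t) *\<^sub>R (?h t - ?h 0)) \<longlongrightarrow> D v) (at 0)"
  proof -
    have "((\<lambda>t. norm (?h t - ?h 0 - t *\<^sub>R D v) / norm t) \<longlongrightarrow> 0) (at 0)"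
      using has_derivative_line[OF assms(1-4)] by (simp add: has_derivative_iff_norm)
    moreover have "norm (?h t - ?h 0 - t *\<^sub>R D v) / norm t = norm ((1 / t) *\<^sub>R (?h t - ?h 0) - D v)"
      if "t \<noteq> 0" for t :: real
    proof -
      have "(1 / t) *\<^sub>R (?h t - ?h 0) - D v = (1 / t) *\<^sub>R (?h t - ?h 0 - t *\<^sub>R D v)"
        using that by (simp add: scaleR_diff_right)
      then show ?thesis by (simp only: norm_scaleR) simp
    qed
    ultimately have "((\<lambda>t. norm ((1 / t) *\<^sub>R (?h t - ?h 0) - D v)) \<longlongrightarrow> 0) (at 0)"
      by (auto elim!: Lim_transform_eventually simp: eventually_at_filter)
    then have "((\<lambda>t. (1 / t) *\<^sub>R (?h t - ?h 0) - D v) \<longlongrightarrow> 0) (at 0)"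
      by (rule tendsto_norm_zero_cancel)
    then show ?thesis by (rule LIM_zero_cancel)
  qed
  have fl: "filterlim (\<lambda>t::real. x + t *\<^sub>R v) (rnhds V x) (at 0)"
  proof -
    have "((\<lambda>t::real. x + t *\<^sub>R v) \<longlongrightarrow> x + 0 *\<^sub>R v) (at 0)" by (intro tendsto_intros)
    then show ?thesis using assms
      by (auto simp: rnhds_def filterlim_inf filterlim_principal intro!: always_eventually subspace_add subspace_scale)
  qed
  have "eventually (\<lambda>t. (1 / t) *\<^sub>R (?h t - ?h 0) \<in> W) (at 0)"
  proof -
    have "eventually (\<lambda>t. ?h t \<in> W) (at 0)"
      using fl assms(6) unfolding filterlim_iff by blast
    moreover have "f x \<in> W" using assms(3,6) eventually_rnhds_self by blast
    ultimately show ?thesis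
      by (elim eventually_mono) (use assms(5) in \<open>auto intro!: subspace_scale subspace_diff\<close>)
  qed
  then show ?thesis
    using Lim_in_closed_set[OF closed_subspace[OF assms(5)] _ _ lim] by simp
qed

subsection \<open>Smooth functions on subspaces\<close>

lemma Ck_on_cong: "Ck_on V k S f \<Longrightarrow> (\<And>x. x \<in> S \<Longrightarrow> f x = g x) \<Longrightarrow> Ck_on V k S g"
proof (cases k)
  case (Suc j)
  assume "Ck_on V k S f" and eq: "\<And>x. x \<in> S \<Longrightarrow> f x = g x"
  then obtain f' where "\<forall>x\<in>S. (f has_derivative f' x) (at x within S)" "\<forall>v\<in>V. Ck_on V j S (\<lambda>x. f' x v)"
    using Suc by auto
  then show ?thesis using eq Suc
    by (auto intro!: exI[of _ f'] has_derivative_transform[of _ S g f])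
qed (auto cong: continuous_on_cong)

lemma Ck_on_subset: "Ck_on V k S f \<Longrightarrow> T \<subseteq> S \<Longrightarrow> Ck_on V k T f"
proof (induction k arbitrary: f)
  case (Suc k)
  then obtain f' where "\<forall>x\<in>S. (f has_derivative f' x) (at x within S)" "\<forall>v\<in>V. Ck_on V k S (\<lambda>x. f' x v)"
    by auto
  then show ?case using Suc
    by (auto intro!: exI[of _ f'] intro: has_derivative_subset)
qed (auto intro: continuous_on_subset)

lemma Ck_on_continuous: "Ck_on V k S f \<Longrightarrow> continuous_on S f"
  by (cases k) (auto simp: continuous_on_eq_continuous_within intro: has_derivative_continuous)

lemma Ck_on_Suc_imp: "Ck_on V (Suc k) S f \<Longrightarrow> Ck_on V k S f"
proof (induction k arbitrary: f)
  case 0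
  then show ?case using Ck_on_continuous by fastforce
next
  case (Suc k)
  then obtain f' where "\<forall>x\<in>S. (f has_derivative f' x) (at x within S)" "\<forall>v\<in>V. Ck_on V (Suc k) S (\<lambda>x. f' x v)"
    by (auto simp del: Ck_on.simps(2) simp: Ck_on.simps(2)[of _ "Suc k"])
  then show ?case using Suc.IH by (subst Ck_on.simps) blast
qed

lemma Ck_on_const: "Ck_on V k S (\<lambda>x. c)"
proof (induction k arbitrary: c)
  case (Suc k)
  then show ?case by (auto intro!: exI[of _ "\<lambda>_ _. 0"])
qed simp

lemma Ck_on_bounded_linear: "bounded_linear L \<Longrightarrow> Ck_on V k S f \<Longrightarrow> Ck_on V k S (\<lambda>x. L (f x))"
proof (induction k arbitrary: f)
  case 0
  then show ?case by (auto intro: bounded_linear.continuous_on)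
next
  case (Suc k)
  then obtain f' where "\<forall>x\<in>S. (f has_derivative f' x) (at x within S)" "\<forall>v\<in>V. Ck_on V k S (\<lambda>x. f' x v)"
    by auto
  then show ?case using Suc
    by (auto intro!: exI[of _ "\<lambda>x v. L (f' x v)"] intro: bounded_linear.has_derivative)
qed

lemma Ck_on_id: "Ck_on V k S (\<lambda>x. x)"
proof (cases k)
  case (Suc j)
  then show ?thesis by (auto intro!: exI[of _ "\<lambda>_ v. v"] Ck_on_const)
qed simp

lemma Ck_on_Pair: "Ck_on V k S f \<Longrightarrow> Ck_on V k S g \<Longrightarrow> Ck_on V k S (\<lambda>x. (f x, g x))"
proof (induction k arbitrary: f g)
  case 0
  then show ?case by (auto intro: continuous_on_Pair)
next
  case (Suc k)
  then obtain f' g' where "\<forall>x\<in>S. (f has_derivative f' x) (at x within S)" "\<forall>v\<in>V. Ck_on V k S (\<lambda>x. f' x v)"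
    "\<forall>x\<in>S. (g has_derivative g' x) (at x within S)" "\<forall>v\<in>V. Ck_on V k S (\<lambda>x. g' x v)"
    by auto
  then show ?case using Suc
    by (auto intro!: exI[of _ "\<lambda>x v. (f' x v, g' x v)"] intro: has_derivative_Pair)
qed

lemma Ck_on_add: "Ck_on V k S f \<Longrightarrow> Ck_on V k S g \<Longrightarrow> Ck_on V k S (\<lambda>x. f x + g x)"
  using Ck_on_bounded_linear[OF bounded_linear_add[OF bounded_linear_fst bounded_linear_snd] Ck_on_Pair]
  by auto

lemma Ck_on_sum: "(\<And>i. i \<in> I \<Longrightarrow> Ck_on V k S (f i)) \<Longrightarrow> Ck_on V k S (\<lambda>x. \<Sum>i\<in>I. f i x)"
proof (induction I rule: infinite_finite_induct)
  case (insert i I)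
  then show ?case by (simp add: Ck_on_add)
qed (auto simp: Ck_on_const)

lemma Ck_on_scaleR:
  fixes a :: "'e::real_normed_vector \<Rightarrow> real"
  shows "Ck_on V k S a \<Longrightarrow> Ck_on V k S f \<Longrightarrow> Ck_on V k S (\<lambda>x. a x *\<^sub>R f x)"
proof (induction k arbitrary: a f)
  case 0
  then show ?case by (auto intro: continuous_on_scaleR)
next
  case (Suc k)
  then obtain f' a' where *: "\<forall>x\<in>S. (f has_derivative f' x) (at x within S)" "\<forall>v\<in>V. Ck_on V k S (\<lambda>x. f' x v)"
    "\<forall>x\<in>S. (a has_derivative a' x) (at x within S)" "\<forall>v\<in>V. Ck_on V k S (\<lambda>x. a' x v)"
    by auto
  have "Ck_on V k S a" "Ck_on V k S f" using Suc.prems Ck_on_Suc_imp by blast+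
  then show ?case using * Suc.IH
    by (auto intro!: exI[of _ "\<lambda>x v. a x *\<^sub>R f' x v + a' x v *\<^sub>R f x"] Ck_on_add intro: has_derivative_scaleR)
qed

lemma Ck_on_compose:
  fixes f :: "'e::real_normed_vector \<Rightarrow> 'f::euclidean_space"
  assumes "subspace V" "openin (top_of_set V) S" "subspace W" "f ` S \<subseteq> T" "T \<subseteq> W"
  shows "Ck_on V k S f \<Longrightarrow> Ck_on W k T g \<Longrightarrow> Ck_on V k S (\<lambda>x. g (f x))"
proof (induction k arbitrary: g)
  case 0
  then show ?case using assms by (auto intro: continuous_on_compose2)
next
  case (Suc k)
  then obtain f' g' where *: "\<forall>x\<in>S. (f has_derivative f' x) (at x within S)" "\<forall>v\<in>V. Ck_on V k S (\<lambda>x. f' x v)"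
    "\<forall>y\<in>T. (g has_derivative g' y) (at y within T)" "\<forall>w\<in>W. Ck_on W k T (\<lambda>y. g' y w)"
    by auto
  obtain B where B: "B \<subseteq> W" "pairwise orthogonal B" "\<And>x. x \<in> B \<Longrightarrow> norm x = 1" "independent B" "span B = W"
    using orthonormal_basis_subspace[OF assms(3)] by metis
  have expand: "(\<Sum>b\<in>B. (w \<bullet> b) *\<^sub>R b) = w" if "w \<in> W" for w
    using orthonormal_basis_expand[of B w] B that independent_imp_finite by auto
  have inW: "f' x v \<in> W" if "x \<in> S" "v \<in> V" for x v
  proof (rule has_derivative_in_subspace[of f _ x V])
    show "(f has_derivative f' x) (at x within V)"
      using * that at_within_openin[OF assms(2)] by auto
    show "eventually (\<lambda>x. f x \<in> W) (rnhds V x)"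
      using that assms by (intro eventually_mono[OF eventually_rnhds_openin[OF assms(2)]]) auto
  qed (use that assms openin_imp_subset in blast)+
  have der: "((\<lambda>x. g (f x)) has_derivative (\<lambda>v. g' (f x) (f' x v))) (at x within S)" if "x \<in> S" for x
  proof (rule has_derivative_compose_rnhds[where f=f and g=g and W=T and f'="f' x" and g'="g' (f x)"])
    show "(f has_derivative f' x) (at x within S)" using * that by blast
    show "(g has_derivative g' (f x)) (at (f x) within T)" using * that assms(4) by blast
    show "eventually (\<lambda>x. f x \<in> T) (rnhds S x)"
      using assms(4) by (intro eventually_mono[OF eventually_rnhds_in]) auto
  qed (rule that)
  have "Ck_on V k S (\<lambda>x. g' (f x) (f' x v))" if v: "v \<in> V" for v
  proof -
    have "Ck_on V k S (\<lambda>x. \<Sum>b\<in>B. (f' x v \<bullet> b) *\<^sub>R g' (f x) b)"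
    proof (rule Ck_on_sum, rule Ck_on_scaleR)
      fix b assume b: "b \<in> B"
      have "Ck_on V k S (\<lambda>x. f' x v)" using * v by blast
      then show "Ck_on V k S (\<lambda>x. f' x v \<bullet> b)"
        by (rule Ck_on_bounded_linear[OF bounded_linear_inner_left])
      have "Ck_on W k T (\<lambda>y. g' y b)" using * b B by blast
      then show "Ck_on V k S (\<lambda>x. g' (f x) b)"
        by (rule Suc.IH[OF Ck_on_Suc_imp[OF Suc.prems(1)]])
    qed
    moreover have "(\<Sum>b\<in>B. (f' x v \<bullet> b) *\<^sub>R g' (f x) b) = g' (f x) (f' x v)" if "x \<in> S" for x
    proof -
      have "linear (g' (f x))" using * that assms(4) by (blast intro: has_derivative_linear)
      then have "(\<Sum>b\<in>B. (f' x v \<bullet> b) *\<^sub>R g' (f x) b) = g' (f x) (\<Sum>b\<in>B. (f' x v \<bullet> b) *\<^sub>R b)"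
        by (simp add: linear_sum linear_cmul)
      then show ?thesis using expand[OF inW[OF that v]] by simp
    qed
    ultimately show ?thesis by (rule Ck_on_cong)
  qed
  with der show ?case
    unfolding Ck_on.simps by (intro exI[of _ "\<lambda>x v. g' (f x) (f' x v)"]) blast
qed

subsection \<open>Regularity of functions at a point\<close>

text \<open>
  Two regularity classes are treated together: charts of \<open>(E \<times> G)/G\<close> require smoothness, whereas
  its local sections are only shown to be differentiable at a point.
\<close>

definition creg :: "bool \<Rightarrow> 'e::real_normed_vector set \<Rightarrow> ('e \<Rightarrow> 'f::real_normed_vector) \<Rightarrow> 'e \<Rightarrow> bool" where
  "creg b V f x \<longleftrightarrow> (if b then \<exists>S. openin (top_of_set V) S \<and> x \<in> S \<and> (\<forall>k. Ck_on V k S f)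
     else f differentiable (at x within V))"

lemma creg_weaken: "creg True V f x \<Longrightarrow> creg b V f x"
proof (cases b)
  case False
  assume "creg True V f x"
  then obtain S where S: "openin (top_of_set V) S" "x \<in> S" "Ck_on V (Suc 0) S f"
    by (auto simp: creg_def simp del: Ck_on.simps)
  then obtain D where "(f has_derivative D) (at x within S)" by auto
  then show ?thesis using False at_within_openin[OF S(1,2)]
    by (auto simp: creg_def differentiable_def)
qed auto

lemma creg_differentiable: "creg b V f x \<Longrightarrow> f differentiable (at x within V)"
  using creg_weaken[where b=False] by (cases b) (auto simp: creg_def[where b=False])

lemma creg_cong:
  assumes "x \<in> V" "eventually (\<lambda>x. f x = g x) (rnhds V x)" "creg b V f x"
  shows "creg b V g x"
proof (cases b)
  case False
  then show ?thesis using assms has_derivative_rnhds_cong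
    unfolding creg_def differentiable_def by metis
next
  case True
  then obtain S where S: "openin (top_of_set V) S" "x \<in> S" "\<forall>k. Ck_on V k S f"
    using assms by (auto simp: creg_def)
  obtain T where T: "openin (top_of_set V) T" "x \<in> T" "\<forall>x\<in>T. f x = g x"
    using assms by (auto simp: eventually_rnhds)
  show ?thesis using S T True unfolding creg_def
    by (auto intro!: exI[of _ "S \<inter> T"] openin_Int intro: Ck_on_cong[of V _ "S \<inter> T" f] Ck_on_subset[of V _ S f])
qed

lemma creg_const: "creg b V (\<lambda>x. c) x" if "x \<in> V"
  by (rule creg_weaken) (use that in \<open>auto simp: creg_def intro!: exI[of _ V] Ck_on_const\<close>)

lemma creg_id: "creg b V (\<lambda>x. x) x" if "x \<in> V"
  by (rule creg_weaken) (use that in \<open>auto simp: creg_def intro!: exI[of _ V] Ck_on_id\<close>)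

lemma creg_bounded_linear: "bounded_linear L \<Longrightarrow> creg b V f x \<Longrightarrow> creg b V (\<lambda>x. L (f x)) x"
  by (cases b) (auto simp: creg_def differentiable_def intro: Ck_on_bounded_linear bounded_linear.has_derivative)

lemma creg_Pair: "creg b V f x \<Longrightarrow> creg b V g x \<Longrightarrow> creg b V (\<lambda>x. (f x, g x)) x"
proof (cases b)
  case False
  assume "creg b V f x" "creg b V g x"
  then show ?thesis using False by (auto simp: creg_def differentiable_def intro: has_derivative_Pair)
next
  case True
  assume "creg b V f x" "creg b V g x"
  then obtain S T where "openin (top_of_set V) S" "x \<in> S" "\<forall>k. Ck_on V k S f"
     "openin (top_of_set V) T" "x \<in> T" "\<forall>k. Ck_on V k T g"
    using True by (auto simp: creg_def)
  then show ?thesis using True unfolding creg_def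
    by (auto intro!: exI[of _ "S \<inter> T"] openin_Int Ck_on_Pair intro: Ck_on_subset)
qed

lemma creg_compose:
  fixes f :: "'e::real_normed_vector \<Rightarrow> 'f::euclidean_space"
  assumes "subspace V" "x \<in> V" "subspace W" "eventually (\<lambda>x. f x \<in> W) (rnhds V x)"
    and "creg b V f x" "creg b W g (f x)"
  shows "creg b V (\<lambda>x. g (f x)) x"
proof (cases b)
  case False
  then show ?thesis using assms
    by (auto simp: creg_def differentiable_def intro: has_derivative_compose_rnhds)
next
  case True
  then obtain S T where S: "openin (top_of_set V) S" "x \<in> S" "\<forall>k. Ck_on V k S f"
     and T: "openin (top_of_set W) T" "f x \<in> T" "\<forall>k. Ck_on W k T g"
    using assms by (auto simp: creg_def)
  have "continuous (at x within V) f"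
    using creg_differentiable[OF assms(5)] differentiable_imp_continuous_within by blast
  then have "filterlim f (rnhds W (f x)) (rnhds V x)" using assms by (intro filterlim_rnhds)
  then have "eventually (\<lambda>x. f x \<in> T) (rnhds V x)"
    using eventually_rnhds_openin[OF T(1,2)] unfolding filterlim_iff by blast
  then obtain S' where S': "openin (top_of_set V) S'" "x \<in> S'" "\<forall>x\<in>S'. f x \<in> T"
    using assms(2) by (auto simp: eventually_rnhds)
  have SS: "openin (top_of_set V) (S \<inter> S')" using S S' by (intro openin_Int)
  have "T \<subseteq> W" using T openin_imp_subset by blast
  have Ck: "Ck_on V k (S \<inter> S') (\<lambda>x. g (f x))" for k
  proof (rule Ck_on_compose[OF assms(1) SS assms(3) _ \<open>T \<subseteq> W\<close>])
    show "f ` (S \<inter> S') \<subseteq> T" using S' by auto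
    show "Ck_on V k (S \<inter> S') f" using S Ck_on_subset by blast
    show "Ck_on W k T g" using T by blast
  qed
  then show ?thesis using True S(2) S'(2) SS Ck unfolding creg_def by (auto intro!: exI[of _ "S \<inter> S'"])
qed

lemma creg_continuous: "creg b V f x \<Longrightarrow> continuous (at x within V) f"
  using creg_differentiable differentiable_imp_continuous_within by blast

lemma creg_filterlim:
  "creg b V f x \<Longrightarrow> eventually (\<lambda>x. f x \<in> W) (rnhds V x) \<Longrightarrow> x \<in> V \<Longrightarrow> filterlim f (rnhds W (f x)) (rnhds V x)"
  by (intro filterlim_rnhds creg_continuous)

lemma Cinf_on_creg: "Cinf_on V S f \<Longrightarrow> x \<in> S \<Longrightarrow> creg b V f x"
  by (rule creg_weaken) (auto simp: creg_def Cinf_on_def)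

section \<open>Maps between manifolds near a point\<close>

text \<open>
  The calculus below only looks at the preferred charts at a point and at its image.  It therefore
  applies to the quotient \<open>(E \<times> G)/G\<close> without knowing that the charts of the latter are compatible.
\<close>

definition wmfd :: "('a, 'e::real_normed_vector) mfd \<Rightarrow> bool" where
  "wmfd M \<longleftrightarrow> subspace (mmodel M) \<and> (\<forall>p\<in>mcarrier M. p \<in> fst (mpref M p) \<and>
     fst (mpref M p) \<subseteq> mcarrier M \<and> inj_on (snd (mpref M p)) (fst (mpref M p)) \<and>
     openin (top_of_set (mmodel M)) (snd (mpref M p) ` fst (mpref M p)))"

abbreviation mdom :: "('a, 'e) mfd \<Rightarrow> 'a \<Rightarrow> 'a set" where
  "mdom M p \<equiv> fst (mpref M p)"

abbreviation mcoord :: "('a, 'e) mfd \<Rightarrow> 'a \<Rightarrow> 'a \<Rightarrow> 'e" where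
  "mcoord M p \<equiv> snd (mpref M p)"

abbreviation mpar :: "('a, 'e) mfd \<Rightarrow> 'a \<Rightarrow> 'e \<Rightarrow> 'a" where
  "mpar M p \<equiv> inv_into (mdom M p) (mcoord M p)"

abbreviation mrep :: "('a, 'e) mfd \<Rightarrow> ('b, 'f) mfd \<Rightarrow> ('a \<Rightarrow> 'b) \<Rightarrow> 'a \<Rightarrow> 'e \<Rightarrow> 'f" where
  "mrep M N f p \<equiv> chart_rep (mpref M p) (mpref N (f p)) f"

definition mnhds :: "('a, 'e::real_normed_vector) mfd \<Rightarrow> 'a \<Rightarrow> 'a filter" where
  "mnhds M p = filtermap (mpar M p) (rnhds (mmodel M) (mcoord M p p))"

definition mreg :: "bool \<Rightarrow> ('a, 'e::real_normed_vector) mfd \<Rightarrow> ('b, 'f::real_normed_vector) mfd \<Rightarrow>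
    ('a \<Rightarrow> 'b) \<Rightarrow> 'a \<Rightarrow> bool" where
  "mreg b M N f p \<longleftrightarrow> p \<in> mcarrier M \<and> f p \<in> mcarrier N \<and>
     eventually (\<lambda>x. f x \<in> mdom N (f p)) (mnhds M p) \<and> creg b (mmodel M) (mrep M N f p) (mcoord M p p)"

lemma wmfdD:
  assumes "wmfd M"
  shows "subspace (mmodel M)" "p \<in> mcarrier M \<Longrightarrow> p \<in> mdom M p"
    "p \<in> mcarrier M \<Longrightarrow> x \<in> mdom M p \<Longrightarrow> x \<in> mcarrier M"
    "p \<in> mcarrier M \<Longrightarrow> inj_on (mcoord M p) (mdom M p)"
    "p \<in> mcarrier M \<Longrightarrow> openin (top_of_set (mmodel M)) (mcoord M p ` mdom M p)"
    "p \<in> mcarrier M \<Longrightarrow> x \<in> mdom M p \<Longrightarrow> mcoord M p x \<in> mmodel M"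
    "p \<in> mcarrier M \<Longrightarrow> mpar M p (mcoord M p p) = p"
    "p \<in> mcarrier M \<Longrightarrow> x \<in> mdom M p \<Longrightarrow> mpar M p (mcoord M p x) = x"
    "p \<in> mcarrier M \<Longrightarrow> mcoord M p p \<in> mmodel M"
  using assms unfolding wmfd_def by (auto dest: openin_imp_subset)

lemma eventually_mnhds:
  "eventually P (mnhds M p) \<longleftrightarrow> eventually (\<lambda>u. P (mpar M p u)) (rnhds (mmodel M) (mcoord M p p))"
  by (simp add: mnhds_def eventually_filtermap)

lemma eventually_mnhds_self:
  "wmfd M \<Longrightarrow> p \<in> mcarrier M \<Longrightarrow> eventually P (mnhds M p) \<Longrightarrow> P p"
  unfolding eventually_mnhds by (drule eventually_rnhds_self[rotated]) (auto simp: wmfdD)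

lemma eventually_rnhds_chart:
  "wmfd M \<Longrightarrow> p \<in> mcarrier M \<Longrightarrow>
    eventually (\<lambda>u. u \<in> mcoord M p ` mdom M p) (rnhds (mmodel M) (mcoord M p p))"
  by (intro eventually_rnhds_openin) (auto simp: wmfdD)

lemma eventually_mnhds_dom:
  "wmfd M \<Longrightarrow> p \<in> mcarrier M \<Longrightarrow> eventually (\<lambda>x. x \<in> mdom M p) (mnhds M p)"
  unfolding eventually_mnhds
  by (rule eventually_mono[OF eventually_rnhds_chart]) (auto simp: inv_into_into)

lemma eventually_mnhds_carrier:
  "wmfd M \<Longrightarrow> p \<in> mcarrier M \<Longrightarrow> eventually (\<lambda>x. x \<in> mcarrier M) (mnhds M p)"
  by (rule eventually_mono[OF eventually_mnhds_dom]) (auto intro: wmfdD)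

lemma mregD:
  assumes "mreg b M N f p"
  shows "p \<in> mcarrier M" "f p \<in> mcarrier N" "eventually (\<lambda>x. f x \<in> mdom N (f p)) (mnhds M p)"
    "creg b (mmodel M) (mrep M N f p) (mcoord M p p)"
  using assms by (auto simp: mreg_def)

lemma mrep_eventually_model:
  assumes "mreg b M N f p" "wmfd N"
  shows "eventually (\<lambda>u. mrep M N f p u \<in> mmodel N) (rnhds (mmodel M) (mcoord M p p))"
  using mregD(3)[OF assms(1)] unfolding eventually_mnhds
  by (rule eventually_mono) (auto simp: chart_rep_def intro: wmfdD assms mregD(2)[OF assms(1)])

lemma mrep_base: "wmfd M \<Longrightarrow> p \<in> mcarrier M \<Longrightarrow> mrep M N f p (mcoord M p p) = mcoord N (f p) (f p)"
  by (simp add: chart_rep_def wmfdD)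

lemma mreg_filterlim:
  assumes "mreg b M N f p" "wmfd M" "wmfd N"
  shows "filterlim f (mnhds N (f p)) (mnhds M p)"
proof -
  let ?F = "rnhds (mmodel M) (mcoord M p p)"
  note D = mregD[OF assms(1)]
  have 1: "filterlim (mrep M N f p) (rnhds (mmodel N) (mcoord N (f p) (f p))) ?F"
    using creg_filterlim[OF D(4) mrep_eventually_model[OF assms(1,3)]] D assms mrep_base[of M p N f]
    by (simp add: wmfdD)
  have "filterlim (\<lambda>u. mpar N (f p) (mrep M N f p u)) (mnhds N (f p)) ?F"
    unfolding mnhds_def by (rule filterlim_compose[OF _ 1]) (simp add: filterlim_filtermap filterlim_def)
  moreover have "eventually (\<lambda>u. mpar N (f p) (mrep M N f p u) = f (mpar M p u)) ?F"
    using D(3) unfolding eventually_mnhds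
    by (rule eventually_mono) (auto simp: chart_rep_def wmfdD assms D)
  ultimately have "filterlim (\<lambda>u. f (mpar M p u)) (mnhds N (f p)) ?F"
    by (subst (asm) filterlim_cong) auto
  then show ?thesis by (simp add: mnhds_def[of M] filterlim_filtermap)
qed

lemma mreg_eventually:
  "mreg b M N f p \<Longrightarrow> wmfd M \<Longrightarrow> wmfd N \<Longrightarrow> eventually P (mnhds N (f p)) \<Longrightarrow>
    eventually (\<lambda>x. P (f x)) (mnhds M p)"
  by (rule mreg_filterlim[unfolded filterlim_iff, rule_format])

lemma mrep_cong:
  assumes "eventually (\<lambda>x. f x = g x) (mnhds M p)" "f p = g p"
  shows "eventually (\<lambda>u. mrep M N f p u = mrep M N g p u) (rnhds (mmodel M) (mcoord M p p))"
  using assms(1) unfolding eventually_mnhds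
  by (rule eventually_mono) (auto simp: chart_rep_def assms)

lemma mreg_cong:
  assumes "mreg b M N f p" "wmfd M" "eventually (\<lambda>x. f x = g x) (mnhds M p)"
  shows "mreg b M N g p"
proof -
  note D = mregD[OF assms(1)]
  have eq: "f p = g p" using assms D by (intro eventually_mnhds_self[of M p "\<lambda>x. f x = g x"])
  have "creg b (mmodel M) (mrep M N g p) (mcoord M p p)"
    using creg_cong[OF _ mrep_cong[OF assms(3) eq] D(4)] assms D by (simp add: wmfdD)
  moreover have "eventually (\<lambda>x. g x \<in> mdom N (g p)) (mnhds M p)"
    using assms(3) D(3) by eventually_elim (simp add: eq)
  ultimately show ?thesis using D eq by (simp add: mreg_def)
qed

lemma mreg_const: "wmfd M \<Longrightarrow> wmfd N \<Longrightarrow> p \<in> mcarrier M \<Longrightarrow> q \<in> mcarrier N \<Longrightarrow> mreg b M N (\<lambda>_. q) p"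
  by (auto simp: mreg_def chart_rep_def o_def wmfdD creg_const)

lemma mreg_id: "wmfd M \<Longrightarrow> p \<in> mcarrier M \<Longrightarrow> mreg b M M (\<lambda>x. x) p"
  unfolding mreg_def
proof (intro conjI)
  assume M: "wmfd M" "p \<in> mcarrier M"
  show "creg b (mmodel M) (mrep M M (\<lambda>x. x) p) (mcoord M p p)"
  proof (rule creg_cong)
    show "creg b (mmodel M) (\<lambda>u. u) (mcoord M p p)" using M by (simp add: creg_id wmfdD)
    show "\<forall>\<^sub>F u in rnhds (mmodel M) (mcoord M p p). u = mrep M M (\<lambda>x. x) p u"
      using eventually_rnhds_chart[OF M] by eventually_elim (auto simp: chart_rep_def f_inv_into_f)
  qed (use M in \<open>simp add: wmfdD\<close>)
qed (auto intro: eventually_mnhds_dom)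

lemma mrep_compose:
  assumes "mreg b M N f p" "wmfd N"
  shows "eventually (\<lambda>u. mrep N K g (f p) (mrep M N f p u) = mrep M K (\<lambda>x. g (f x)) p u)
    (rnhds (mmodel M) (mcoord M p p))"
  using mregD(3)[OF assms(1)] unfolding eventually_mnhds
  by (rule eventually_mono) (auto simp: chart_rep_def wmfdD assms mregD(2)[OF assms(1)])

lemma mreg_compose:
  fixes M :: "('a, 'e::real_normed_vector) mfd" and N :: "('b, 'f::euclidean_space) mfd"
    and K :: "('c, 'h::real_normed_vector) mfd"
  assumes "mreg b M N f p" "mreg b N K g (f p)" "wmfd M" "wmfd N"
  shows "mreg b M K (\<lambda>x. g (f x)) p"
proof -
  note D = mregD[OF assms(1)] and D' = mregD[OF assms(2)]
  have "creg b (mmodel M) (\<lambda>u. mrep N K g (f p) (mrep M N f p u)) (mcoord M p p)"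
    using assms D(1) D(4) D'(4) mrep_eventually_model[OF assms(1,4)] mrep_base[of M p N f]
    by (intro creg_compose[where W="mmodel N" and f="mrep M N f p" and g="mrep N K g (f p)"]) (simp_all add: wmfdD)
  then have "creg b (mmodel M) (mrep M K (\<lambda>x. g (f x)) p) (mcoord M p p)"
    using creg_cong[OF _ mrep_compose[OF assms(1,4)]] assms D by (simp add: wmfdD)
  then show ?thesis
    using D D' mreg_eventually[OF assms(1,3,4) D'(3)] by (simp add: mreg_def)
qed

subsection \<open>Products\<close>

lemma prod_mfd_simps:
  "mcarrier (prod_mfd M N) = mcarrier M \<times> mcarrier N"
  "mmodel (prod_mfd M N) = mmodel M \<times> mmodel N"
  "mdom (prod_mfd M N) (p, q) = mdom M p \<times> mdom N q"
  "mcoord (prod_mfd M N) (p, q) = map_prod (mcoord M p) (mcoord N q)"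
  by (simp_all add: prod_mfd_def prod_chart_def)

lemma wmfd_prod: "wmfd M \<Longrightarrow> wmfd N \<Longrightarrow> wmfd (prod_mfd M N)"
  unfolding wmfd_def
  by (auto simp: prod_mfd_simps map_prod_surj_on subspace_Times map_prod_inj_on intro: openin_Times)

lemma mpar_prod:
  assumes "wmfd M" "wmfd N" "p \<in> mcarrier M" "q \<in> mcarrier N"
    and "u \<in> mcoord M p ` mdom M p" "v \<in> mcoord N q ` mdom N q"
  shows "mpar (prod_mfd M N) (p, q) (u, v) = (mpar M p u, mpar N q v)"
  using assms by (intro inv_into_f_eq)
    (auto simp: prod_mfd_simps wmfdD f_inv_into_f inv_into_into map_prod_inj_on)

lemma eventually_rnhds_prod_chart:
  assumes "wmfd M" "wmfd N" "p \<in> mcarrier M" "q \<in> mcarrier N"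
  shows "eventually (\<lambda>u. fst u \<in> mcoord M p ` mdom M p \<and> snd u \<in> mcoord N q ` mdom N q)
    (rnhds (mmodel (prod_mfd M N)) (mcoord (prod_mfd M N) (p, q) (p, q)))"
  using assms eventually_rnhds_chart[OF wmfd_prod[OF assms(1,2)], of "(p, q)"]
  by (auto simp: prod_mfd_simps elim!: eventually_mono)

lemma mreg_Pair:
  "mreg b M N f p \<Longrightarrow> mreg b M K g p \<Longrightarrow> mreg b M (prod_mfd N K) (\<lambda>x. (f x, g x)) p"
  unfolding mreg_def
proof (elim conjE, intro conjI)
  assume "creg b (mmodel M) (mrep M N f p) (mcoord M p p)" "creg b (mmodel M) (mrep M K g p) (mcoord M p p)"
  then show "creg b (mmodel M) (mrep M (prod_mfd N K) (\<lambda>x. (f x, g x)) p) (mcoord M p p)"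
    using creg_Pair by (auto simp: prod_mfd_simps chart_rep_def o_def)
qed (auto simp: prod_mfd_simps eventually_conj_iff)

lemma mrep_fst:
  assumes "wmfd M" "wmfd N" "p \<in> mcarrier M" "q \<in> mcarrier N"
  shows "eventually (\<lambda>u. fst u = mrep (prod_mfd M N) M fst (p, q) u)
    (rnhds (mmodel (prod_mfd M N)) (mcoord (prod_mfd M N) (p, q) (p, q)))"
  using eventually_rnhds_prod_chart[OF assms]
  by eventually_elim (auto simp: chart_rep_def mpar_prod assms wmfdD)

lemma mrep_snd:
  assumes "wmfd M" "wmfd N" "p \<in> mcarrier M" "q \<in> mcarrier N"
  shows "eventually (\<lambda>u. snd u = mrep (prod_mfd M N) N snd (p, q) u)
    (rnhds (mmodel (prod_mfd M N)) (mcoord (prod_mfd M N) (p, q) (p, q)))"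
  using eventually_rnhds_prod_chart[OF assms]
  by eventually_elim (auto simp: chart_rep_def mpar_prod assms wmfdD)

lemma mreg_fst:
  assumes "wmfd M" "wmfd N" "x \<in> mcarrier (prod_mfd M N)"
  shows "mreg b (prod_mfd M N) M fst x"
proof -
  obtain p q where x: "x = (p, q)" "p \<in> mcarrier M" "q \<in> mcarrier N"
    using assms by (auto simp: prod_mfd_simps)
  have "eventually (\<lambda>x. x \<in> mdom (prod_mfd M N) (p, q)) (mnhds (prod_mfd M N) (p, q))"
    using assms x by (intro eventually_mnhds_dom wmfd_prod) auto
  then have "eventually (\<lambda>x. fst x \<in> mdom M p) (mnhds (prod_mfd M N) (p, q))"
    by eventually_elim (auto simp: prod_mfd_simps)
  moreover have "creg b (mmodel (prod_mfd M N)) (mrep (prod_mfd M N) M fst (p, q)) (mcoord (prod_mfd M N) (p, q) (p, q))"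
    by (rule creg_cong[OF _ mrep_fst creg_bounded_linear[OF bounded_linear_fst creg_id]])
       (use assms x wmfdD(9)[OF wmfd_prod[OF assms(1,2)], of "(p, q)"] in auto)
  ultimately show ?thesis using x by (simp add: mreg_def prod_mfd_simps)
qed

lemma mreg_snd:
  assumes "wmfd M" "wmfd N" "x \<in> mcarrier (prod_mfd M N)"
  shows "mreg b (prod_mfd M N) N snd x"
proof -
  obtain p q where x: "x = (p, q)" "p \<in> mcarrier M" "q \<in> mcarrier N"
    using assms by (auto simp: prod_mfd_simps)
  have "eventually (\<lambda>x. x \<in> mdom (prod_mfd M N) (p, q)) (mnhds (prod_mfd M N) (p, q))"
    using assms x by (intro eventually_mnhds_dom wmfd_prod) auto
  then have "eventually (\<lambda>x. snd x \<in> mdom N q) (mnhds (prod_mfd M N) (p, q))"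
    by eventually_elim (auto simp: prod_mfd_simps)
  moreover have "creg b (mmodel (prod_mfd M N)) (mrep (prod_mfd M N) N snd (p, q)) (mcoord (prod_mfd M N) (p, q) (p, q))"
    by (rule creg_cong[OF _ mrep_snd creg_bounded_linear[OF bounded_linear_snd creg_id]])
       (use assms x wmfdD(9)[OF wmfd_prod[OF assms(1,2)], of "(p, q)"] in auto)
  ultimately show ?thesis using x by (simp add: mreg_def prod_mfd_simps)
qed

subsection \<open>Differentials\<close>

lemma mreg_has_derivative:
  assumes "mreg b M N f p"
  shows "(mrep M N f p has_derivative mdiff M N f p) (at (mcoord M p p) within mmodel M)"
  using creg_differentiable[OF mregD(4)[OF assms]]
  by (simp add: mdiff_def frechet_derivative_works[symmetric])

lemma mdiff_eqI:
  assumes "wmfd M" "p \<in> mcarrier M" "v \<in> mmodel M"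
    and "(mrep M N f p has_derivative D) (at (mcoord M p p) within mmodel M)"
  shows "mdiff M N f p v = D v"
proof -
  have "(mrep M N f p has_derivative mdiff M N f p) (at (mcoord M p p) within mmodel M)"
    using assms(4) unfolding mdiff_def frechet_derivative_works[symmetric] differentiable_def by blast
  then show ?thesis
    using has_derivative_unique_subspace assms by (metis wmfdD(1,9))
qed

lemma mdiff_cong:
  assumes "mreg b M N f p" "wmfd M" "eventually (\<lambda>x. f x = g x) (mnhds M p)" "v \<in> mmodel M"
  shows "mdiff M N g p v = mdiff M N f p v"
proof -
  note D = mregD[OF assms(1)]
  have eq: "f p = g p" using assms D by (intro eventually_mnhds_self[of M p "\<lambda>x. f x = g x"])
  show ?thesis
    by (rule mdiff_eqI[OF _ _ _ has_derivative_rnhds_cong[OF _ mrep_cong[OF assms(3) eq] mreg_has_derivative[OF assms(1)]]])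
       (use assms D in \<open>auto simp: wmfdD\<close>)
qed

lemma mdiff_compose:
  fixes M :: "('a, 'e::real_normed_vector) mfd" and N :: "('b, 'f::euclidean_space) mfd"
    and K :: "('c, 'h::real_normed_vector) mfd"
  assumes "mreg b M N f p" "mreg b' N K g (f p)" "wmfd M" "wmfd N" "v \<in> mmodel M"
  shows "mdiff M K (\<lambda>x. g (f x)) p v = mdiff N K g (f p) (mdiff M N f p v)"
proof -
  note D = mregD[OF assms(1)] and D' = mregD[OF assms(2)]
  have comp: "((\<lambda>u. mrep N K g (f p) (mrep M N f p u)) has_derivative (\<lambda>v. mdiff N K g (f p) (mdiff M N f p v)))
    (at (mcoord M p p) within mmodel M)"
    using assms mreg_has_derivative[OF assms(1)] mreg_has_derivative[OF assms(2)] D(1)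
      mrep_eventually_model[OF assms(1,4)] mrep_base[of M p N f]
    by (intro has_derivative_compose_rnhds[where W="mmodel N" and f="mrep M N f p" and g="mrep N K g (f p)"])
      (simp_all add: wmfdD)
  have "(mrep M K (\<lambda>x. g (f x)) p has_derivative (\<lambda>v. mdiff N K g (f p) (mdiff M N f p v)))
    (at (mcoord M p p) within mmodel M)"
    by (rule has_derivative_rnhds_cong[OF _ mrep_compose[OF assms(1,4)] comp]) (use D in \<open>auto simp: wmfdD assms\<close>)
  then show ?thesis using D assms by (intro mdiff_eqI)
qed

lemma mdiff_id: "wmfd M \<Longrightarrow> p \<in> mcarrier M \<Longrightarrow> v \<in> mmodel M \<Longrightarrow> mdiff M M (\<lambda>x. x) p v = v"
proof -
  assume M: "wmfd M" "p \<in> mcarrier M" "v \<in> mmodel M"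
  have "\<forall>\<^sub>F u in rnhds (mmodel M) (mcoord M p p). u = mrep M M (\<lambda>x. x) p u"
    using eventually_rnhds_chart[OF M(1,2)] by eventually_elim (auto simp: chart_rep_def f_inv_into_f)
  from has_derivative_rnhds_cong[OF _ this has_derivative_ident] show ?thesis using M
    by (intro mdiff_eqI[where D="\<lambda>v. v"]) (auto simp: wmfdD)
qed

lemma mdiff_const: "wmfd M \<Longrightarrow> p \<in> mcarrier M \<Longrightarrow> v \<in> mmodel M \<Longrightarrow> mdiff M N (\<lambda>_. q) p v = 0"
  by (rule mdiff_eqI[where D="\<lambda>_. 0"]) (auto simp: chart_rep_def o_def)

lemma mdiff_Pair:
  assumes "mreg b M N f p" "mreg b' M K g p" "wmfd M" "v \<in> mmodel M"
  shows "mdiff M (prod_mfd N K) (\<lambda>x. (f x, g x)) p v = (mdiff M N f p v, mdiff M K g p v)"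
  using has_derivative_Pair[OF mreg_has_derivative[OF assms(1)] mreg_has_derivative[OF assms(2)]]
  by (intro mdiff_eqI[where D="\<lambda>v. (mdiff M N f p v, mdiff M K g p v)"] assms mregD(1)[OF assms(1)]) (auto simp: chart_rep_def o_def prod_mfd_simps)

lemma mdiff_fst:
  assumes "wmfd M" "wmfd N" "x \<in> mcarrier (prod_mfd M N)" "v \<in> mmodel (prod_mfd M N)"
  shows "mdiff (prod_mfd M N) M fst x v = fst v"
proof -
  obtain p q where x: "x = (p, q)" "p \<in> mcarrier M" "q \<in> mcarrier N"
    using assms by (auto simp: prod_mfd_simps)
  note W = wmfd_prod[OF assms(1,2)]
  show ?thesis unfolding x
    by (rule mdiff_eqI[OF W _ assms(4) has_derivative_rnhds_cong[OF _ mrep_fst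
         bounded_linear_imp_has_derivative[OF bounded_linear_fst]]])
       (use assms x wmfdD(9)[OF W, of "(p, q)"] in \<open>simp_all add: prod_mfd_simps\<close>)
qed

lemma mdiff_snd:
  assumes "wmfd M" "wmfd N" "x \<in> mcarrier (prod_mfd M N)" "v \<in> mmodel (prod_mfd M N)"
  shows "mdiff (prod_mfd M N) N snd x v = snd v"
proof -
  obtain p q where x: "x = (p, q)" "p \<in> mcarrier M" "q \<in> mcarrier N"
    using assms by (auto simp: prod_mfd_simps)
  note W = wmfd_prod[OF assms(1,2)]
  show ?thesis unfolding x
    by (rule mdiff_eqI[OF W _ assms(4) has_derivative_rnhds_cong[OF _ mrep_snd
         bounded_linear_imp_has_derivative[OF bounded_linear_snd]]])
       (use assms x wmfdD(9)[OF W, of "(p, q)"] in \<open>simp_all add: prod_mfd_simps\<close>)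
qed

lemma mdiff_in_model:
  fixes N :: "('b, 'f::euclidean_space) mfd"
  assumes "mreg b M N f p" "wmfd M" "wmfd N" "v \<in> mmodel M"
  shows "mdiff M N f p v \<in> mmodel N"
  using has_derivative_in_subspace[OF mreg_has_derivative[OF assms(1)] _ _ _ _ mrep_eventually_model[OF assms(1,3)]]
    assms mregD(1)[OF assms(1)] by (simp add: wmfdD)

lemma mdiff_linear: "mreg b M N f p \<Longrightarrow> linear (mdiff M N f p)"
  by (rule has_derivative_linear[OF mreg_has_derivative])

lemma mdiff_0: "mreg b M N f p \<Longrightarrow> mdiff M N f p 0 = 0"
  by (rule linear_0[OF mdiff_linear])

section \<open>Smoothness in compatible atlases\<close>

definition pmfd :: "('a, 'e::real_normed_vector) mfd \<Rightarrow> bool" where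
  "pmfd M \<longleftrightarrow> subspace (mmodel M) \<and>
     (\<forall>c\<in>matlas M. fst c \<subseteq> mcarrier M \<and> inj_on (snd c) (fst c) \<and>
        openin (top_of_set (mmodel M)) (snd c ` fst c)) \<and>
     (\<forall>c\<in>matlas M. \<forall>d\<in>matlas M. compatible_charts (mmodel M) c d) \<and>
     (\<forall>p\<in>mcarrier M. mpref M p \<in> matlas M \<and> p \<in> fst (mpref M p))"

lemma is_manifold_pmfd: "is_manifold M \<Longrightarrow> pmfd M"
  unfolding is_manifold_def pmfd_def by (auto simp: subspace_span)

lemma pmfd_wmfd: "pmfd M \<Longrightarrow> wmfd M"
  unfolding pmfd_def wmfd_def by blast

lemma pmfdD:
  assumes "pmfd M" "c \<in> matlas M"
  shows "fst c \<subseteq> mcarrier M" "inj_on (snd c) (fst c)" "openin (top_of_set (mmodel M)) (snd c ` fst c)"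
    "d \<in> matlas M \<Longrightarrow> Cinf_on (mmodel M) (snd c ` (fst c \<inter> fst d)) (chart_rep c d id)"
    "x \<in> fst c \<Longrightarrow> snd c x \<in> mmodel M"
    "x \<in> fst c \<Longrightarrow> inv_into (fst c) (snd c) (snd c x) = x"
  using assms unfolding pmfd_def compatible_charts_def by (auto dest: openin_imp_subset)

lemma pmfd_pref: "pmfd M \<Longrightarrow> p \<in> mcarrier M \<Longrightarrow> mpref M p \<in> matlas M"
  unfolding pmfd_def by blast

lemma openin_mtopology:
  assumes "pmfd M"
  shows "openin (mtopology M) U \<longleftrightarrow> U \<subseteq> mcarrier M \<and>
    (\<forall>c\<in>matlas M. openin (top_of_set (mmodel M)) (snd c ` (U \<inter> fst c)))"
proof -
  have "istopology (\<lambda>U. U \<subseteq> mcarrier M \<and>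
    (\<forall>c\<in>matlas M. openin (top_of_set (mmodel M)) (snd c ` (U \<inter> fst c))))" (is "istopology ?P")
    unfolding istopology_def
  proof (rule conjI; intro allI impI)
    fix S T assume "?P S" "?P T"
    then have "openin (top_of_set (mmodel M)) (snd c ` (S \<inter> fst c) \<inter> snd c ` (T \<inter> fst c))" if "c \<in> matlas M" for c
      using that by (auto intro: openin_Int)
    moreover have "snd c ` (S \<inter> fst c) \<inter> snd c ` (T \<inter> fst c) = snd c ` (S \<inter> T \<inter> fst c)" if "c \<in> matlas M" for c
      using pmfdD(2)[OF assms that] by (auto simp: inj_on_def)
    ultimately show "?P (S \<inter> T)" using \<open>?P S\<close> by (auto simp: Int_assoc)
  next
    fix \<K> assume K: "\<forall>K\<in>\<K>. ?P K"
    have "snd c ` (\<Union>\<K> \<inter> fst c) = (\<Union>K\<in>\<K>. snd c ` (K \<inter> fst c))" for c :: "('a, 'b) chart"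
      by blast
    then show "?P (\<Union>\<K>)" using K by (auto intro!: openin_Union)
  qed
  then show ?thesis by (simp add: mtopology_def topology_inverse')
qed

lemma eventually_chart_nhds:
  assumes "pmfd M" "c \<in> matlas M" "p \<in> fst c" "openin (top_of_set (mmodel M)) S" "snd c p \<in> S"
  shows "eventually (\<lambda>u. u \<in> S \<and> u \<in> snd c ` fst c) (rnhds (mmodel M) (snd c p))"
  using assms pmfdD(3)[OF assms(1,2)] by (intro eventually_conj eventually_rnhds_openin) auto

lemma eventually_chart_change:
  assumes M: "pmfd M" and c: "c \<in> matlas M" "d \<in> matlas M" "p \<in> fst c" "p \<in> fst d"
    and P: "eventually (\<lambda>u. P (inv_into (fst d) (snd d) u)) (rnhds (mmodel M) (snd d p))"
  shows "eventually (\<lambda>u. P (inv_into (fst c) (snd c) u)) (rnhds (mmodel M) (snd c p))"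
proof -
  let ?t = "chart_rep c d id"
  note Cc = pmfdD[OF M c(1)] and Cd = pmfdD[OF M c(2)]
  have S: "openin (top_of_set (mmodel M)) (snd c ` (fst c \<inter> fst d))" "creg True (mmodel M) ?t (snd c p)"
    using Cc(4)[OF c(2)] Cinf_on_creg[of "mmodel M" "snd c ` (fst c \<inter> fst d)" ?t "snd c p"] c
    by (auto simp: Cinf_on_def)
  have ev: "eventually (\<lambda>u. u \<in> snd c ` (fst c \<inter> fst d)) (rnhds (mmodel M) (snd c p))"
    using S c by (intro eventually_rnhds_openin) auto
  have "eventually (\<lambda>u. ?t u \<in> mmodel M) (rnhds (mmodel M) (snd c p))"
    using ev by eventually_elim (auto simp: chart_rep_def Cc Cd)
  then have "filterlim ?t (rnhds (mmodel M) (?t (snd c p))) (rnhds (mmodel M) (snd c p))"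
    using S(2) c Cc by (intro creg_filterlim) auto
  moreover have "?t (snd c p) = snd d p" using c by (simp add: chart_rep_def Cc)
  ultimately have "filterlim ?t (rnhds (mmodel M) (snd d p)) (rnhds (mmodel M) (snd c p))" by simp
  then have "eventually (\<lambda>u. P (inv_into (fst d) (snd d) (?t u))) (rnhds (mmodel M) (snd c p))"
    by (rule eventually_compose_filterlim[OF P])
  then show ?thesis using ev by eventually_elim (auto simp: chart_rep_def Cc Cd)
qed

lemma eventually_mnhds_chart:
  assumes "pmfd M" "c \<in> matlas M" "p \<in> fst c"
  shows "eventually P (mnhds M p) \<longleftrightarrow>
    eventually (\<lambda>u. P (inv_into (fst c) (snd c) u)) (rnhds (mmodel M) (snd c p))"
proof -
  have p: "p \<in> mcarrier M" using assms pmfdD by blast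
  then have "mpref M p \<in> matlas M" "p \<in> mdom M p" using assms pmfd_pref unfolding pmfd_def by blast+
  then show ?thesis
    unfolding eventually_mnhds using eventually_chart_change[OF assms(1)] assms by metis
qed

lemma openin_iff_mnhds:
  assumes "pmfd M"
  shows "openin (mtopology M) U \<longleftrightarrow> U \<subseteq> mcarrier M \<and> (\<forall>p\<in>U. eventually (\<lambda>x. x \<in> U) (mnhds M p))"
proof (intro iffI conjI ballI)
  assume U: "openin (mtopology M) U"
  then show "U \<subseteq> mcarrier M" by (simp add: openin_mtopology[OF assms])
  fix p assume p: "p \<in> U"
  let ?c = "mpref M p"
  have c: "?c \<in> matlas M" "p \<in> fst ?c" using p \<open>U \<subseteq> mcarrier M\<close> assms unfolding pmfd_def by auto
  have "openin (top_of_set (mmodel M)) (snd ?c ` (U \<inter> fst ?c))"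
    using U c by (simp add: openin_mtopology[OF assms])
  then have "eventually (\<lambda>u. u \<in> snd ?c ` (U \<inter> fst ?c)) (rnhds (mmodel M) (snd ?c p))"
    using p c by (intro eventually_rnhds_openin) auto
  then show "eventually (\<lambda>x. x \<in> U) (mnhds M p)"
    unfolding eventually_mnhds by eventually_elim (auto simp: pmfdD[OF assms c(1)])
next
  assume U: "U \<subseteq> mcarrier M \<and> (\<forall>p\<in>U. eventually (\<lambda>x. x \<in> U) (mnhds M p))"
  show "openin (mtopology M) U"
    unfolding openin_mtopology[OF assms] openin_iff_rnhds
  proof (intro conjI ballI)
    show "U \<subseteq> mcarrier M" using U by blast
    fix c assume c: "c \<in> matlas M"
    show "snd c ` (U \<inter> fst c) \<subseteq> mmodel M" using pmfdD[OF assms c] by auto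
    fix u assume "u \<in> snd c ` (U \<inter> fst c)"
    then obtain q where q: "q \<in> U" "q \<in> fst c" "u = snd c q" by auto
    have "eventually (\<lambda>u. inv_into (fst c) (snd c) u \<in> U) (rnhds (mmodel M) u)"
      using U q eventually_mnhds_chart[OF assms c q(2)] by auto
    moreover have "eventually (\<lambda>u. u \<in> snd c ` fst c) (rnhds (mmodel M) u)"
      using pmfdD[OF assms c] q by (intro eventually_rnhds_openin) auto
    ultimately show "eventually (\<lambda>v. v \<in> snd c ` (U \<inter> fst c)) (rnhds (mmodel M) u)"
      by eventually_elim (auto simp: pmfdD[OF assms c])
  qed
qed

lemma eventually_mnhds_openin:
  "pmfd M \<Longrightarrow> openin (mtopology M) U \<Longrightarrow> p \<in> U \<Longrightarrow> eventually (\<lambda>x. x \<in> U) (mnhds M p)"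
  by (simp add: openin_iff_mnhds)

lemma chart_mreg:
  fixes M :: "('a, 'e::euclidean_space) mfd" and N :: "('b, 'f::euclidean_space) mfd"
  assumes M: "pmfd M" and N: "pmfd N" and c: "c \<in> matlas M" "p \<in> fst c" and d: "d \<in> matlas N" "f p \<in> fst d"
    and ev: "eventually (\<lambda>x. f x \<in> fst d) (mnhds M p)"
    and reg: "creg b (mmodel M) (chart_rep c d f) (snd c p)"
  shows "mreg b M N f p"
proof -
  let ?c = "mpref M p" and ?d = "mpref N (f p)" and ?V = "mmodel M" and ?W = "mmodel N"
  note Cc = pmfdD[OF M c(1)] and Cd = pmfdD[OF N d(1)]
  have p: "p \<in> mcarrier M" "f p \<in> mcarrier N" using Cc(1) Cd(1) c d by auto
  have c0: "?c \<in> matlas M" "p \<in> fst ?c" and d0: "?d \<in> matlas N" "f p \<in> fst ?d"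
    using p M N unfolding pmfd_def by auto
  note Cc0 = pmfdD[OF M c0(1)] and Cd0 = pmfdD[OF N d0(1)]
  have subs: "subspace ?V" "subspace ?W" using M N by (auto simp: pmfd_def)
  let ?g1 = "chart_rep ?c c id" and ?g2 = "chart_rep c d f" and ?g3 = "chart_rep d ?d id"
  have b1: "?g1 (snd ?c p) = snd c p" using c0 by (simp add: chart_rep_def Cc0)
  have b2: "?g2 (snd c p) = snd d (f p)" using c by (simp add: chart_rep_def Cc)
  have r1: "creg b ?V ?g1 (snd ?c p)"
    by (rule Cinf_on_creg[OF Cc0(4)[OF c(1)]]) (use c c0 in auto)
  have r3: "creg b ?W ?g3 (snd d (f p))"
    by (rule Cinf_on_creg[OF Cd(4)[OF d0(1)]]) (use d d0 in auto)
  have e1: "eventually (\<lambda>u. u \<in> snd ?c ` (fst ?c \<inter> fst c)) (rnhds ?V (snd ?c p))"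
    using Cc0(4)[OF c(1)] c c0 by (intro eventually_rnhds_openin) (auto simp: Cinf_on_def)
  have e1': "eventually (\<lambda>u. ?g1 u \<in> ?V) (rnhds ?V (snd ?c p))"
    using e1 by eventually_elim (auto simp: chart_rep_def Cc Cc0)
  have e2: "eventually (\<lambda>u. ?g2 u \<in> ?W) (rnhds ?V (snd c p))"
    using ev unfolding eventually_mnhds_chart[OF M c]
    by eventually_elim (auto simp: chart_rep_def Cd)
  have r12: "creg b ?V (\<lambda>u. ?g2 (?g1 u)) (snd ?c p)"
    by (rule creg_compose[where W="?V" and f="?g1" and g="?g2"])
       (use subs e1' r1 reg b1 in \<open>auto simp: Cc0(5)[OF c0(2)]\<close>)
  have fl1: "filterlim ?g1 (rnhds ?V (snd c p)) (rnhds ?V (snd ?c p))"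
    using creg_filterlim[OF r1 e1'] Cc0(5)[OF c0(2)] b1 by simp
  have fl2: "filterlim ?g2 (rnhds ?W (snd d (f p))) (rnhds ?V (snd c p))"
    using creg_filterlim[OF reg e2] Cc(5)[OF c(2)] b2 by simp
  have e12: "eventually (\<lambda>u. ?g2 (?g1 u) \<in> ?W) (rnhds ?V (snd ?c p))"
    by (rule eventually_compose_filterlim[OF e2 fl1])
  have r: "creg b ?V (\<lambda>u. ?g3 (?g2 (?g1 u))) (snd ?c p)"
    by (rule creg_compose[where W="?W" and f="\<lambda>u. ?g2 (?g1 u)" and g="?g3"])
       (use subs e12 r12 r3 b1 b2 in \<open>auto simp: Cc0(5)[OF c0(2)]\<close>)
  have "eventually (\<lambda>w. w \<in> snd d ` (fst d \<inter> fst ?d)) (rnhds ?W (snd d (f p)))"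
    using Cd(4)[OF d0(1)] d d0 by (intro eventually_rnhds_openin) (auto simp: Cinf_on_def)
  then have "eventually (\<lambda>u. ?g2 u \<in> snd d ` (fst d \<inter> fst ?d)) (rnhds ?V (snd c p))"
    by (rule eventually_compose_filterlim[OF _ fl2])
  then have "eventually (\<lambda>u. f (inv_into (fst c) (snd c) u) \<in> fst ?d) (rnhds ?V (snd c p))"
    using ev unfolding eventually_mnhds_chart[OF M c]
  proof eventually_elim
    case (elim u)
    then show ?case using Cd(2) by (auto simp: chart_rep_def inj_on_def)
  qed
  then have dom: "eventually (\<lambda>x. f x \<in> fst ?d) (mnhds M p)"
    unfolding eventually_mnhds_chart[OF M c] .
  have "eventually (\<lambda>u. ?g3 (?g2 (?g1 u)) = mrep M N f p u) (rnhds ?V (snd ?c p))"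
    using e1 ev[unfolded eventually_mnhds]
    by eventually_elim (auto simp: chart_rep_def Cc Cc0 Cd)
  then have "creg b ?V (mrep M N f p) (snd ?c p)"
    using creg_cong[OF _ _ r] Cc0(5)[OF c0(2)] by blast
  then show ?thesis using p dom by (simp add: mreg_def)
qed

lemma msmooth_mreg:
  fixes M :: "('a, 'e::euclidean_space) mfd" and N :: "('b, 'f::euclidean_space) mfd"
  assumes M: "pmfd M" and N: "pmfd N" and f: "msmooth M N S f" and p: "p \<in> S"
    and ev: "eventually (\<lambda>x. x \<in> S) (mnhds M p)"
  shows "mreg b M N f p"
proof -
  obtain W h where W: "p \<in> W" "msmooth_open M N W h" "\<forall>x\<in>S \<inter> W. h x = f x"
    using f p unfolding msmooth_def by blast
  then obtain c d W' where cd: "c \<in> matlas M" "d \<in> matlas N" "openin (mtopology M) W'" "p \<in> W'"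
      "W' \<subseteq> W \<inter> fst c" "h ` W' \<subseteq> fst d" "Cinf_on (mmodel M) (snd c ` W') (chart_rep c d h)"
    unfolding msmooth_open_def by meson
  have ev': "eventually (\<lambda>x. x \<in> W') (mnhds M p)"
    by (rule eventually_mnhds_openin[OF M cd(3,4)])
  have "mreg b M N h p"
  proof (rule chart_mreg[OF M N cd(1) _ cd(2)])
    show "eventually (\<lambda>x. h x \<in> fst d) (mnhds M p)"
      using ev' by eventually_elim (use cd in auto)
    show "creg b (mmodel M) (chart_rep c d h) (snd c p)"
      by (rule Cinf_on_creg[OF cd(7)]) (use cd in auto)
  qed (use cd in auto)
  moreover have "eventually (\<lambda>x. h x = f x) (mnhds M p)"
    using ev ev' by eventually_elim (use W cd in auto)
  ultimately show ?thesis by (rule mreg_cong[OF _ pmfd_wmfd[OF M]])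
qed

lemma msmooth_mreg_carrier:
  fixes M :: "('a, 'e::euclidean_space) mfd" and N :: "('b, 'f::euclidean_space) mfd"
  assumes "pmfd M" "pmfd N" "msmooth M N (mcarrier M) f" "p \<in> mcarrier M"
  shows "mreg b M N f p"
  by (rule msmooth_mreg[OF assms eventually_mnhds_carrier[OF pmfd_wmfd[OF assms(1)] assms(4)]])

lemma msmoothI:
  fixes M :: "('a, 'e::euclidean_space) mfd" and N :: "('b, 'f::euclidean_space) mfd"
  assumes M: "pmfd M" and N: "pmfd N" and A: "openin (mtopology M) A"
    and reg: "\<And>p. p \<in> A \<Longrightarrow> mreg True M N f p"
  shows "msmooth M N A f"
proof -
  have AM: "A \<subseteq> mcarrier M" using A by (simp add: openin_iff_mnhds[OF M])
  have "\<exists>c\<in>matlas M. \<exists>d\<in>matlas N. \<exists>W. openin (mtopology M) W \<and> p \<in> W \<and> W \<subseteq> A \<inter> fst c \<and>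
    f ` W \<subseteq> fst d \<and> Cinf_on (mmodel M) (snd c ` W) (chart_rep c d f)" if p: "p \<in> A" for p
  proof -
    let ?c = "mpref M p" and ?d = "mpref N (f p)" and ?V = "mmodel M"
    note D = mregD[OF reg[OF p]]
    have c: "?c \<in> matlas M" "p \<in> fst ?c" and d: "?d \<in> matlas N"
      using D M N unfolding pmfd_def by auto
    note C = pmfdD[OF M c(1)]
    obtain S where S: "openin (top_of_set ?V) S" "snd ?c p \<in> S" "\<forall>k. Ck_on ?V k S (mrep M N f p)"
      using D(4) by (auto simp: creg_def)
    have "eventually (\<lambda>u. u \<in> S \<and> u \<in> snd ?c ` fst ?c \<and> f (mpar M p u) \<in> fst ?d \<and> mpar M p u \<in> A)
      (rnhds ?V (snd ?c p))"
      using eventually_chart_nhds[OF M c S(1,2)] D(3)[unfolded eventually_mnhds]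
        eventually_mnhds_openin[OF M A p, unfolded eventually_mnhds]
      by eventually_elim blast
    then obtain S' where S'0: "openin (top_of_set ?V) S'" "snd ?c p \<in> S'"
      "\<forall>u\<in>S'. u \<in> S \<and> u \<in> snd ?c ` fst ?c \<and> f (mpar M p u) \<in> fst ?d \<and> mpar M p u \<in> A"
      unfolding eventually_rnhds[OF C(5)[OF c(2)]] by (elim exE conjE) (rule that)
    note S' = S'0(1,2) S'0(3)[rule_format]
    let ?W = "mpar M p ` S'"
    have key: "snd ?c (mpar M p u) = u" "mpar M p u \<in> fst ?c" if "u \<in> S'" for u
      using S'(3)[OF that] by (simp_all add: f_inv_into_f inv_into_into)
    have img: "snd ?c ` ?W = S'" using key(1) by (force simp: image_image)
    have Wc: "?W \<subseteq> fst ?c" using key(2) by auto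
    have "openin (mtopology M) ?W"
      unfolding openin_iff_mnhds[OF M]
    proof (intro conjI ballI)
      show "?W \<subseteq> mcarrier M" using Wc C(1) by blast
      fix q assume q: "q \<in> ?W"
      then have qc: "q \<in> fst ?c" "snd ?c q \<in> S'" using key by auto
      show "eventually (\<lambda>x. x \<in> ?W) (mnhds M q)"
        unfolding eventually_mnhds_chart[OF M c(1) qc(1)]
        using eventually_rnhds_openin[OF S'(1) qc(2)] by eventually_elim blast
    qed
    moreover have "p \<in> ?W" using imageI[OF S'(2), of "mpar M p"] C(6)[OF c(2)] by simp
    moreover have "Cinf_on ?V (snd ?c ` ?W) (mrep M N f p)"
    proof -
      have "S' \<subseteq> S" using S'(3) by auto
      then have "Ck_on ?V k S' (mrep M N f p)" for k by (rule Ck_on_subset[OF S(3)[rule_format]])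
      then show ?thesis unfolding img Cinf_on_def using S'(1) by simp
    qed
    moreover have "?W \<subseteq> A \<inter> fst ?c" using Wc S'(3) by auto
    moreover have "f ` ?W \<subseteq> fst ?d" using S'(3) by auto
    ultimately show ?thesis by (intro bexI[OF _ c(1)] bexI[OF _ d] exI[of _ ?W] conjI)
  qed
  note loc = this
  have fA: "f \<in> A \<rightarrow> mcarrier N" using mregD(2)[OF reg] by auto
  then have "msmooth_open M N A f" unfolding msmooth_open_def using A loc by simp
  then show ?thesis unfolding msmooth_def using AM fA by auto
qed

lemma pmfd_linear: "subspace V \<Longrightarrow> pmfd (linear_mfd V)"
proof -
  assume V: "subspace V"
  have "chart_rep (V, id) (V, id) id x = x" if "x \<in> V" for x :: 'a
    using that by (simp add: chart_rep_def)
  then have "Ck_on V k V (chart_rep (V, id) (V, id) id)" for k by (intro Ck_on_cong[OF Ck_on_id]) simp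
  then show ?thesis using V by (auto simp: pmfd_def linear_mfd_def compatible_charts_def Cinf_on_def)
qed

lemma pmfd_prod:
  fixes M :: "('a, 'e::euclidean_space) mfd" and N :: "('b, 'f::euclidean_space) mfd"
  assumes M: "pmfd M" and N: "pmfd N"
  shows "pmfd (prod_mfd M N)"
proof -
  let ?P = "prod_mfd M N"
  have subs: "subspace (mmodel M)" "subspace (mmodel N)" using M N by (auto simp: pmfd_def)
  have comp: "Cinf_on (mmodel M \<times> mmodel N)
      (snd (prod_chart c c') ` (fst (prod_chart c c') \<inter> fst (prod_chart d d')))
      (chart_rep (prod_chart c c') (prod_chart d d') id)"
    if c: "c \<in> matlas M" "d \<in> matlas M" "c' \<in> matlas N" "d' \<in> matlas N" for c d c' d'
  proof -
    note Cc = pmfdD[OF M c(1)] and Cd = pmfdD[OF M c(2)] and Cc' = pmfdD[OF N c(3)] and Cd' = pmfdD[OF N c(4)]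
    let ?S = "snd c ` (fst c \<inter> fst d)" and ?S' = "snd c' ` (fst c' \<inter> fst d')"
    let ?V = "mmodel M \<times> mmodel N"
    have img: "snd (prod_chart c c') ` (fst (prod_chart c c') \<inter> fst (prod_chart d d')) = ?S \<times> ?S'"
      by (simp add: prod_chart_def Times_Int_Times map_prod_surj_on)
    have o1: "openin (top_of_set (mmodel M)) ?S" and o2: "openin (top_of_set (mmodel N)) ?S'"
      using Cc(4)[OF c(2)] Cc'(4)[OF c(4)] by (auto simp: Cinf_on_def)
    have o: "openin (top_of_set ?V) (?S \<times> ?S')" using o1 o2 by (intro openin_Times)
    have V: "subspace ?V" using subs by (rule subspace_Times)
    have "Ck_on ?V k (?S \<times> ?S') (chart_rep (prod_chart c c') (prod_chart d d') id)" for k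
    proof (rule Ck_on_cong[OF Ck_on_Pair])
      show "Ck_on ?V k (?S \<times> ?S') (\<lambda>u. chart_rep c d id (fst u))"
        by (rule Ck_on_compose[OF V o subs(1) _ openin_imp_subset[OF o1], where f=fst])
           (use Cc(4)[OF c(2)] Ck_on_bounded_linear[OF bounded_linear_fst Ck_on_id] in \<open>auto simp: Cinf_on_def simp del: Ck_on.simps id_apply\<close>)
      show "Ck_on ?V k (?S \<times> ?S') (\<lambda>u. chart_rep c' d' id (snd u))"
        by (rule Ck_on_compose[OF V o subs(2) _ openin_imp_subset[OF o2], where f=snd])
           (use Cc'(4)[OF c(4)] Ck_on_bounded_linear[OF bounded_linear_snd Ck_on_id] in \<open>auto simp: Cinf_on_def simp del: Ck_on.simps id_apply\<close>)
      fix u assume "u \<in> ?S \<times> ?S'"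
      then obtain x y where u: "u = (snd c x, snd c' y)" "x \<in> fst c" "y \<in> fst c'" by auto
      have inj: "inj_on (map_prod (snd c) (snd c')) (fst c \<times> fst c')"
        using Cc(2) Cc'(2) by (rule map_prod_inj_on)
      have "inv_into (fst c \<times> fst c') (map_prod (snd c) (snd c')) u = (x, y)"
        using u by (intro inv_into_f_eq[OF inj]) auto
      then show "(chart_rep c d id (fst u), chart_rep c' d' id (snd u)) =
          chart_rep (prod_chart c c') (prod_chart d d') id u"
        using u by (simp add: chart_rep_def prod_chart_def Cc Cc')
    qed
    then show ?thesis unfolding img using o by (simp add: Cinf_on_def)
  qed
  show ?thesis
    unfolding pmfd_def
  proof (intro conjI ballI)
    show "subspace (mmodel ?P)" using subs by (simp add: prod_mfd_def subspace_Times)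
    fix p assume "p \<in> mcarrier ?P"
    then obtain x y where xy: "p = (x, y)" "x \<in> mcarrier M" "y \<in> mcarrier N" by (auto simp: prod_mfd_def)
    then have pr: "mpref M x \<in> matlas M" "mpref N y \<in> matlas N" "x \<in> mdom M x" "y \<in> mdom N y"
      using M N unfolding pmfd_def by blast+
    then show "mpref ?P p \<in> matlas ?P" unfolding prod_mfd_def xy(1) mfd.simps prod.case by blast
    show "p \<in> mdom ?P p" using pr xy by (simp add: prod_mfd_def prod_chart_def)
  next
    fix e assume "e \<in> matlas ?P"
    then obtain c c' where e: "e = prod_chart c c'" "c \<in> matlas M" "c' \<in> matlas N" by (auto simp: prod_mfd_def)
    show "fst e \<subseteq> mcarrier ?P" "inj_on (snd e) (fst e)" "openin (top_of_set (mmodel ?P)) (snd e ` fst e)"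
      using pmfdD(1-3)[OF M e(2)] pmfdD(1-3)[OF N e(3)] e
      by (auto simp: prod_mfd_def prod_chart_def map_prod_surj_on intro!: map_prod_inj_on openin_Times)
    fix e' assume "e' \<in> matlas ?P"
    then obtain d d' where e': "e' = prod_chart d d'" "d \<in> matlas M" "d' \<in> matlas N" by (auto simp: prod_mfd_def)
    show "compatible_charts (mmodel ?P) e e'"
      using comp[of c d c' d'] comp[of d c d' c'] e e'
      by (simp add: compatible_charts_def prod_mfd_def Int_commute)
  qed
qed

lemma diffeo_onD:
  fixes M :: "('a, 'e::euclidean_space) mfd" and N :: "('b, 'f::euclidean_space) mfd"
  assumes "diffeo_on M N A B f" "pmfd M" "pmfd N"
  shows "p \<in> A \<Longrightarrow> eventually (\<lambda>x. x \<in> A) (mnhds M p) \<Longrightarrow> mreg b M N f p"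
    "q \<in> B \<Longrightarrow> eventually (\<lambda>x. x \<in> B) (mnhds N q) \<Longrightarrow> mreg b N M (inv_into A f) q"
    "bij_betw f A B"
proof -
  have D: "bij_betw f A B" "msmooth M N A f" "msmooth N M B (inv_into A f)"
    using assms(1) by (auto simp: diffeo_on_def)
  show "p \<in> A \<Longrightarrow> eventually (\<lambda>x. x \<in> A) (mnhds M p) \<Longrightarrow> mreg b M N f p"
    by (rule msmooth_mreg[OF assms(2,3) D(2)])
  show "q \<in> B \<Longrightarrow> eventually (\<lambda>x. x \<in> B) (mnhds N q) \<Longrightarrow> mreg b N M (inv_into A f) q"
    by (rule msmooth_mreg[OF assms(3,2) D(3)])
  show "bij_betw f A B" by (rule D)
qed

lemma mreg_dim_le:
  fixes M :: "('a, 'e::euclidean_space) mfd" and N :: "('b, 'f::euclidean_space) mfd"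
  assumes f: "mreg b M N f p" and g: "mreg b' N M g (f p)" and W: "wmfd M" "wmfd N"
    and gf: "eventually (\<lambda>x. g (f x) = x) (mnhds M p)"
  shows "dim (mmodel M) \<le> dim (mmodel N)"
proof -
  note D = mregD[OF f]
  have eq: "mdiff N M g (f p) (mdiff M N f p v) = v" if "v \<in> mmodel M" for v
  proof -
    have "eventually (\<lambda>x. x = g (f x)) (mnhds M p)" using gf by eventually_elim simp
    from mdiff_cong[OF mreg_id[OF W(1) D(1)] W(1) this that] mdiff_compose[OF f g W that] mdiff_id[OF W(1) D(1) that]
    show ?thesis by simp
  qed
  have "inj_on (mdiff M N f p) (mmodel M)" by (rule inj_on_inverseI[of _ "mdiff N M g (f p)"]) (rule eq)
  moreover have "span (mmodel M) = mmodel M" using wmfdD(1)[OF W(1)] by (simp add: span_eq_iff)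
  ultimately have "dim (mmodel M) = dim (mdiff M N f p ` mmodel M)"
    using dim_image_eq[OF mdiff_linear[OF f], of "mmodel M"] by metis
  also have "\<dots> \<le> dim (mmodel N)" using mdiff_in_model[OF f W] by (intro dim_subset) auto
  finally show ?thesis .
qed

section \<open>Differentiability of inverses on subspaces\<close>

lemma inverse_differentiable_subspace:
  fixes \<kappa> :: "'e::euclidean_space \<Rightarrow> 'f::euclidean_space"
  assumes W: "subspace W" and V: "subspace V" and dims: "dim W = dim V"
    and S: "openin (top_of_set W) S" and cont: "continuous_on S \<kappa>" and im: "\<kappa> ` S \<subseteq> V"
    and inv: "\<And>w. w \<in> S \<Longrightarrow> g (\<kappa> w) = w" and z: "z \<in> S"
    and der: "(\<kappa> has_derivative D) (at z within W)" and surj: "D ` W = V"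
  shows "g differentiable (at (\<kappa> z) within V)"
    and "eventually (\<lambda>v. v \<in> \<kappa> ` S) (rnhds V (\<kappa> z))"
proof -
  obtain T T' where T: "linear T" "linear T'" "T ` V = W" "T' ` W = V"
     "\<And>x. x \<in> V \<Longrightarrow> T' (T x) = x" "\<And>x. x \<in> W \<Longrightarrow> T (T' x) = x"
    using isometries_subspaces[OF V W dims[symmetric]] by metis
  have bT: "bounded_linear T" using T(1) linear_conv_bounded_linear by blast
  have bD: "bounded_linear D" using der by (rule has_derivative_bounded_linear)
  obtain B where B: "B \<subseteq> W" "pairwise orthogonal B" "\<And>x. x \<in> B \<Longrightarrow> norm x = 1" "independent B" "span B = W"
    using orthonormal_basis_subspace[OF W] by metis
  define P where "P x = (\<Sum>b\<in>B. (x \<bullet> b) *\<^sub>R b)" for x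
  have bP: "bounded_linear P" unfolding P_def
    by (intro bounded_linear_sum bounded_linear_scaleR_const bounded_linear_inner_left)
  interpret P: bounded_linear P by (rule bP)
  interpret T: bounded_linear T by (rule bT)
  interpret D: bounded_linear D by (rule bD)
  have PW: "P x \<in> W" for x unfolding P_def using B W by (intro subspace_sum subspace_scale) auto
  have Pid: "P x = x" if "x \<in> W" for x
    unfolding P_def using orthonormal_basis_expand[of B x] B that independent_imp_finite by auto
  have SW: "S \<subseteq> W" using S by (rule openin_imp_subset)
  obtain O' where O': "open O'" "S = W \<inter> O'" using S by (auto simp: openin_open)
  define K where "K x = T (\<kappa> (P x)) + (x - P x)" for x
  define G where "G y = g (T' (P y)) + (y - P y)" for y
  have opn: "open (P -` O')" using O'(1) by (intro open_vimage P.continuous_on continuous_on_id)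
  have PS: "P x \<in> S" if "x \<in> P -` O'" for x using that PW O' by auto
  have zO: "z \<in> P -` O'" using z SW Pid O' by auto
  have contK: "continuous_on (P -` O') K"
    unfolding K_def
    by (intro continuous_intros T.continuous_on P.continuous_on continuous_on_compose2[OF cont]) (use PS in auto)
  have GK: "G (K x) = x" if x: "x \<in> P -` O'" for x
  proof -
    have "\<kappa> (P x) \<in> V" using im PS[OF x] by blast
    then have TW: "T (\<kappa> (P x)) \<in> W" using T(3) by blast
    have "P (K x) = T (\<kappa> (P x))" unfolding K_def by (simp add: P.add P.diff Pid TW PW)
    then show ?thesis unfolding G_def using \<open>\<kappa> (P x) \<in> V\<close> inv[OF PS[OF x]] T(5) by (simp add: K_def)
  qed
  define K' where "K' v = T (D (P v)) + (v - P v)" for v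
  have "((\<lambda>x. \<kappa> (P x)) has_derivative (\<lambda>v. D (P v))) (at z within UNIV)"
  proof (rule has_derivative_compose_rnhds[where f=P and g=\<kappa> and W=W])
    show "(\<kappa> has_derivative D) (at (P z) within W)" using der z SW Pid by auto
  qed (auto intro: PW bounded_linear_imp_has_derivative bP always_eventually)
  then have derK: "(K has_derivative K') (at z)"
    unfolding K_def K'_def
    by (intro has_derivative_add has_derivative_diff has_derivative_ident
      bounded_linear.has_derivative[OF bT] bounded_linear_imp_has_derivative[OF bP]) simp
  have linD: "linear D" by (rule D.linear)
  have injD: "x = 0" if "x \<in> W" "D x = 0" for x
  proof -
    have "span (D ` B) = V" using linear_span_image[OF linD, of B] B(5) surj by simp
    have fB: "finite B" using B(4) independent_imp_finite by blast
    have "card B = dim V" using dim_unique[of B W "card B"] B dims by (auto simp: span_superset)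
    moreover have "card (D ` B) \<le> card B" using fB by (rule card_image_le)
    ultimately have ind: "independent (D ` B)"
      using \<open>span (D ` B) = V\<close> fB by (intro card_le_dim_spanning[of _ V]) (auto intro: span_base)
    then have "card (D ` B) = dim V"
      using basis_card_eq_dim[of "D ` B" V] \<open>span (D ` B) = V\<close> by (auto intro: span_base)
    then have "inj_on D B" using \<open>card B = dim V\<close> fB by (intro eq_card_imp_inj_on) auto
    then have "inj_on D W" using linear_inj_on_span_iff_independent_image[OF linD, of B] ind B(4,5) by auto
    then show ?thesis using that W D.zero by (metis inj_onD subspace_0)
  qed
  have "inj K'"
  proof -
    have lin: "linear K'" using derK has_derivative_linear by blast
    have "x = 0" if "K' x = 0" for x
    proof -
      have "D (P x) \<in> V" using surj PW by blast
      then have TW: "T (D (P x)) \<in> W" using T(3) by blast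
      have "P (K' x) = T (D (P x))" unfolding K'_def by (simp add: P.add P.diff Pid TW PW)
      then have "T (D (P x)) = 0" using that by simp
      then have "D (P x) = 0" using T(5)[OF \<open>D (P x) \<in> V\<close>] linear_0[OF T(2)] by metis
      then have "P x = 0" using injD PW by blast
      then show ?thesis using that \<open>T (D (P x)) = 0\<close> by (simp add: K'_def)
    qed
    then show ?thesis using lin by (metis linear_injective_0)
  qed
  then obtain G' where G': "linear G'" "\<And>x. K' (G' x) = x"
    using linear_injective_isomorphism[of K'] derK has_derivative_linear by metis
  have Kz: "K z = T (\<kappa> z)" using z SW Pid by (auto simp: K_def)
  have \<kappa>V: "\<kappa> z \<in> V" using im z by auto
  have "(G has_derivative G') (at (K z))"
    by (rule has_derivative_inverse_strong[OF opn zO contK GK derK]) (use G' in auto)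
  then have "(G has_derivative G') (at (T (\<kappa> z)) within UNIV)" using Kz by simp
  then have "((\<lambda>v. G (T v)) has_derivative (\<lambda>v. G' (T v))) (at (\<kappa> z) within V)"
    by (rule has_derivative_compose_rnhds[where f=T and g=G and W=UNIV, rotated])
       (use \<kappa>V in \<open>auto intro: bounded_linear_imp_has_derivative bT\<close>)
  moreover have "G (T v) = g v" if "v \<in> V" for v
  proof -
    have "T v \<in> W" using T(3) that by auto
    then show ?thesis using that by (simp add: G_def Pid T(5))
  qed
  ultimately have "(g has_derivative (\<lambda>v. G' (T v))) (at (\<kappa> z) within V)"
    using \<kappa>V by (intro has_derivative_transform[of _ V g "\<lambda>v. G (T v)"]) auto
  then show "g differentiable (at (\<kappa> z) within V)" by (rule differentiableI)
  have "inj_on K (P -` O')" by (rule inj_on_inverseI[of _ G]) (rule GK)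
  then have "open (K ` (P -` O'))" using invariance_of_domain[OF contK opn] by simp
  then have "eventually (\<lambda>y. y \<in> K ` (P -` O')) (nhds (T (\<kappa> z)))"
    using imageI[OF zO, of K] Kz by (intro eventually_nhds_in_open) auto
  moreover have "filterlim T (nhds (T (\<kappa> z))) (rnhds V (\<kappa> z))"
    using filterlim_rnhds[OF linear_continuous_within[OF bT], where W=UNIV and x="\<kappa> z" and V=V] \<kappa>V
    by (simp add: rnhds_def)
  ultimately have "eventually (\<lambda>v. T v \<in> K ` (P -` O')) (rnhds V (\<kappa> z))"
    by (rule eventually_compose_filterlim)
  with eventually_rnhds_in show "eventually (\<lambda>v. v \<in> \<kappa> ` S) (rnhds V (\<kappa> z))"
  proof eventually_elim
    case (elim v)
    then obtain y where y: "y \<in> P -` O'" "T v = K y" by auto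
    have "\<kappa> (P y) \<in> V" using im PS[OF y(1)] by auto
    then have TW: "T (\<kappa> (P y)) \<in> W" "T v \<in> W" using T(3) elim(1) by auto
    have "T v = P (T v)" using Pid TW by simp
    also have "\<dots> = T (\<kappa> (P y))" unfolding y(2) K_def by (simp add: P.add P.diff Pid TW PW)
    finally have "v = \<kappa> (P y)" using T(5) elim(1) \<open>\<kappa> (P y) \<in> V\<close> by metis
    then show ?case using PS[OF y(1)] by auto
  qed
qed

lemma mdiff_partial:
  fixes M :: "('a, 'e::euclidean_space) mfd" and N :: "('b, 'f::euclidean_space) mfd"
    and K :: "('c, 'h::real_normed_vector) mfd"
  assumes f: "mreg b (prod_mfd M N) K f (p, q)" and W: "wmfd M" "wmfd N"
    and v: "v \<in> mmodel M" "w \<in> mmodel N"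
  shows "mdiff (prod_mfd M N) K f (p, q) (v, w) =
    mdiff M K (\<lambda>x. f (x, q)) p v + mdiff N K (\<lambda>y. f (p, y)) q w"
proof -
  let ?P = "prod_mfd M N"
  have pq: "p \<in> mcarrier M" "q \<in> mcarrier N" using mregD(1)[OF f] by (auto simp: prod_mfd_simps)
  note WP = wmfd_prod[OF W]
  have i1: "mreg b M ?P (\<lambda>x. (x, q)) p" and i2: "mreg b N ?P (\<lambda>y. (p, y)) q"
    using pq W by (auto intro: mreg_Pair mreg_id mreg_const)
  have "mdiff M K (\<lambda>x. f (x, q)) p v = mdiff ?P K f (p, q) (mdiff M ?P (\<lambda>x. (x, q)) p v)"
    by (rule mdiff_compose[OF i1 f W(1) WP v(1)])
  also have "mdiff M ?P (\<lambda>x. (x, q)) p v = (v, 0)"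
    using mdiff_Pair[OF mreg_id[OF W(1) pq(1)] mreg_const[OF W pq] W(1) v(1)]
    by (simp add: mdiff_id mdiff_const W pq v)
  finally have 1: "mdiff M K (\<lambda>x. f (x, q)) p v = mdiff ?P K f (p, q) (v, 0)" .
  have "mdiff N K (\<lambda>y. f (p, y)) q w = mdiff ?P K f (p, q) (mdiff N ?P (\<lambda>y. (p, y)) q w)"
    by (rule mdiff_compose[OF i2 f W(2) WP v(2)])
  also have "mdiff N ?P (\<lambda>y. (p, y)) q w = (0, w)"
    using mdiff_Pair[OF mreg_const[OF W(2,1) pq(2,1)] mreg_id[OF W(2) pq(2)] W(2) v(2)]
    by (simp add: mdiff_id mdiff_const W pq v)
  finally have 2: "mdiff N K (\<lambda>y. f (p, y)) q w = mdiff ?P K f (p, q) (0, w)" .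
  show ?thesis
    unfolding 1 2 using linear_add[OF mdiff_linear[OF f], of "(v, 0)" "(0, w)"] by simp
qed

section \<open>Powers of a manifold\<close>

lemma apply_Bcontfun_finite:
  fixes f :: "nat \<Rightarrow> 'e::real_normed_vector"
  shows "apply_bcontfun (Bcontfun (\<lambda>k. if k < n then f k else 0)) = (\<lambda>k. if k < n then f k else 0)"
proof (rule Bcontfun_inverse)
  have "range (\<lambda>k. if k < n then f k else 0) \<subseteq> insert 0 (f ` {..<n})" by auto
  then have "finite (range (\<lambda>k. if k < n then f k else 0))" by (rule finite_subset) simp
  then show "(\<lambda>k. if k < n then f k else 0) \<in> bcontfun"
    by (simp add: bcontfun_def finite_imp_bounded)
qed

lemma bounded_linear_apply_bcontfun:
  "bounded_linear (\<lambda>v :: 'a::topological_space \<Rightarrow>\<^sub>C 'e::real_normed_vector. apply_bcontfun v k)"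
  by (rule bounded_linear_intro[where K=1]) (auto simp: norm_bounded)

lemma subspace_power_model:
  "subspace (mmodel K) \<Longrightarrow> subspace (mmodel (power_mfd n K))"
  unfolding subspace_def by (auto simp: power_mfd_def)

lemma mdiff_sum_power:
  fixes K :: "('a, 'e::euclidean_space) mfd"
  assumes K: "wmfd K" and x: "x \<in> mcarrier (power_mfd n K)"
    and L: "\<And>k. k < n \<Longrightarrow> mreg False K real_mfd L (x k)" and \<delta>: "\<delta> \<in> mmodel (power_mfd n K)"
  shows "mdiff (power_mfd n K) real_mfd (\<lambda>x. \<Sum>k<n. L (x k)) x \<delta> = (\<Sum>k<n. mdiff K real_mfd L (x k) (apply_bcontfun \<delta> k))"
proof -
  let ?PM = "power_mfd n K" and ?F = "\<lambda>x. \<Sum>k<n. L (x k)"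
  let ?pc = "mpref ?PM x" and ?V = "mmodel ?PM"
  let ?b = "snd ?pc x"
  have xk: "x k \<in> mcarrier K" if "k < n" for k using x that by (auto simp: power_mfd_def)
  have pc: "fst ?pc = PiE {..<n} (\<lambda>k. mdom K (x k))"
      "snd ?pc = (\<lambda>y. Bcontfun (\<lambda>k. if k < n then mcoord K (x k) (y k) else 0))"
    by (simp_all add: power_mfd_def power_chart_def)
  have app: "apply_bcontfun (snd ?pc y) k = (if k < n then mcoord K (x k) (y k) else 0)" for y k
    unfolding pc by (simp add: apply_Bcontfun_finite)
  have subV: "subspace ?V" using K by (intro subspace_power_model) (simp add: wmfdD)
  have bV: "?b \<in> ?V" using K xk app by (simp add: power_mfd_def wmfdD)
  have inj: "inj_on (snd ?pc) (fst ?pc)"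
  proof (rule inj_onI)
    fix y z assume yz: "y \<in> fst ?pc" "z \<in> fst ?pc" "snd ?pc y = snd ?pc z"
    have "y k = z k" if "k < n" for k
    proof -
      have "mcoord K (x k) (y k) = mcoord K (x k) (z k)"
        using arg_cong[OF yz(3), of "\<lambda>v. apply_bcontfun v k"] that by (simp only: app) simp
      moreover have "y k \<in> mdom K (x k)" "z k \<in> mdom K (x k)" using yz(1,2) that by (auto simp: pc(1))
      ultimately show ?thesis using wmfdD(4)[OF K xk[OF that]] by (simp add: inj_on_def)
    qed
    then show "y = z" using yz(1,2) unfolding pc(1) by (intro PiE_ext) auto
  qed
  have par: "inv_into (fst ?pc) (snd ?pc) v = (\<lambda>k\<in>{..<n}. mpar K (x k) (apply_bcontfun v k))"
    if v: "v \<in> ?V" "\<And>k. k < n \<Longrightarrow> apply_bcontfun v k \<in> mcoord K (x k) ` mdom K (x k)" for v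
  proof (rule inv_into_f_eq[OF inj])
    show "(\<lambda>k\<in>{..<n}. mpar K (x k) (apply_bcontfun v k)) \<in> fst ?pc"
      unfolding pc(1) using v(2) by (auto intro: inv_into_into)
    show "snd ?pc (\<lambda>k\<in>{..<n}. mpar K (x k) (apply_bcontfun v k)) = v"
    proof (rule bcontfun_eqI)
      fix k show "apply_bcontfun (snd ?pc (\<lambda>k\<in>{..<n}. mpar K (x k) (apply_bcontfun v k))) k = apply_bcontfun v k"
        unfolding app using v by (auto simp: f_inv_into_f power_mfd_def)
    qed
  qed
  have evm: "eventually (\<lambda>v. apply_bcontfun v k \<in> mmodel K) (rnhds ?V ?b)" if "k < n" for k
    using that by (intro eventually_mono[OF eventually_rnhds_in]) (auto simp: power_mfd_def)
  have "eventually (\<lambda>v. apply_bcontfun v k \<in> mcoord K (x k) ` mdom K (x k)) (rnhds ?V ?b)" if k: "k < n" for k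
  proof (rule eventually_compose_filterlim[OF eventually_rnhds_chart[OF K xk[OF k]]])
    have "filterlim (\<lambda>v. apply_bcontfun v k) (rnhds (mmodel K) (apply_bcontfun ?b k)) (rnhds ?V ?b)"
      by (rule filterlim_rnhds[OF _ evm[OF k] bV])
         (rule linear_continuous_within[OF bounded_linear_apply_bcontfun])
    then show "filterlim (\<lambda>v. apply_bcontfun v k) (rnhds (mmodel K) (mcoord K (x k) (x k))) (rnhds ?V ?b)"
      using k by (simp add: app)
  qed
  then have "eventually (\<lambda>v. \<forall>k\<in>{..<n}. apply_bcontfun v k \<in> mcoord K (x k) ` mdom K (x k)) (rnhds ?V ?b)"
    by (intro eventually_ball_finite) auto
  then have "eventually (\<lambda>v. (\<Sum>k<n. mrep K real_mfd L (x k) (apply_bcontfun v k)) =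
      chart_rep ?pc (mpref real_mfd (?F x)) ?F v) (rnhds ?V ?b)"
    using eventually_rnhds_in
  proof eventually_elim
    case (elim v)
    have "inv_into (fst ?pc) (snd ?pc) v = (\<lambda>k\<in>{..<n}. mpar K (x k) (apply_bcontfun v k))"
      by (rule par) (use elim in auto)
    then show ?case by (simp add: chart_rep_def linear_mfd_def)
  qed
  moreover have "((\<lambda>v. \<Sum>k<n. mrep K real_mfd L (x k) (apply_bcontfun v k)) has_derivative
      (\<lambda>v. \<Sum>k<n. mdiff K real_mfd L (x k) (apply_bcontfun v k))) (at ?b within ?V)"
  proof (rule has_derivative_sum)
    fix k assume "k \<in> {..<n}"
    then have k: "k < n" by simp
    show "((\<lambda>v. mrep K real_mfd L (x k) (apply_bcontfun v k)) has_derivative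
      (\<lambda>v. mdiff K real_mfd L (x k) (apply_bcontfun v k))) (at ?b within ?V)"
    proof (rule has_derivative_compose_rnhds[where f="\<lambda>v. apply_bcontfun v k" and g="mrep K real_mfd L (x k)"
          and f'="\<lambda>v. apply_bcontfun v k"])
      show "((\<lambda>v. apply_bcontfun v k) has_derivative (\<lambda>v. apply_bcontfun v k)) (at ?b within ?V)"
        by (rule bounded_linear_imp_has_derivative[OF bounded_linear_apply_bcontfun])
      show "(mrep K real_mfd L (x k) has_derivative mdiff K real_mfd L (x k))
          (at (apply_bcontfun ?b k) within mmodel K)"
        using mreg_has_derivative[OF L[OF k]] k by (simp add: app)
    qed (use evm k bV in auto)
  qed
  ultimately have D: "(chart_rep ?pc (mpref real_mfd (?F x)) ?F has_derivative
      (\<lambda>v. \<Sum>k<n. mdiff K real_mfd L (x k) (apply_bcontfun v k))) (at ?b within ?V)"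
    by (rule has_derivative_rnhds_cong[OF bV])
  then have "chart_rep ?pc (mpref real_mfd (?F x)) ?F differentiable (at ?b within ?V)"
    by (rule differentiableI)
  then have "(chart_rep ?pc (mpref real_mfd (?F x)) ?F has_derivative
      mdiff ?PM real_mfd ?F x) (at ?b within ?V)"
    unfolding mdiff_def frechet_derivative_works .
  from has_derivative_unique_subspace[OF this D subV bV \<delta>] show ?thesis .
qed

section \<open>Trajectories and the section of motion\<close>

locale regular_dldps =
  fixes S :: "('a, 'e::euclidean_space, 'b, 'f::euclidean_space) dldps"
  assumes wE: "wmfd (dE S)" and wM: "wmfd (dM S)"
    and L_reg: "\<And>p. p \<in> mcarrier (C1 S) \<Longrightarrow> mreg False (C1 S) real_mfd (dL S) p"
    and phi_reg: "\<And>e. e \<in> mcarrier (dE S) \<Longrightarrow> mreg False (dE S) (dM S) (dphi S) e"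
    and Dist_subspace: "\<And>p. p \<in> mcarrier (C1 S) \<Longrightarrow> subspace (dDist S p)"
    and Dist_model: "\<And>p \<delta>. p \<in> mcarrier (C1 S) \<Longrightarrow> \<delta> \<in> dDist S p \<Longrightarrow> fst \<delta> \<in> mmodel (dE S) \<and> snd \<delta> = 0"
    and P_zero: "\<And>p q. (p, q) \<in> C2 S \<Longrightarrow> dP S p q 0 = 0"
    and P_model: "\<And>p q \<delta>. (p, q) \<in> C2 S \<Longrightarrow> \<delta> \<in> dDist S q \<Longrightarrow> dP S p q \<delta> \<in> mmodel (dE S)"
    and P_vertical: "\<And>p q \<delta>. (p, q) \<in> C2 S \<Longrightarrow> \<delta> \<in> dDist S q \<Longrightarrow>
       mdiff (dE S) (dM S) (dphi S) (fst p) (dP S p q \<delta>) = 0"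
begin

lemma wC1: "wmfd (C1 S)"
  unfolding C1_def by (rule wmfd_prod[OF wE wM])

abbreviation DL1 :: "'a \<times> 'b \<Rightarrow> 'e \<Rightarrow> real" where
  "DL1 p \<equiv> mdiff (dE S) real_mfd (\<lambda>e. dL S (e, snd p)) (fst p)"

abbreviation DL2 :: "'a \<times> 'b \<Rightarrow> 'f \<Rightarrow> real" where
  "DL2 p \<equiv> mdiff (dM S) real_mfd (\<lambda>m. dL S (fst p, m)) (snd p)"

abbreviation Dphi :: "'a \<Rightarrow> 'e \<Rightarrow> 'f" where
  "Dphi \<equiv> mdiff (dE S) (dM S) (dphi S)"

lemma DL_split:
  assumes "p \<in> mcarrier (C1 S)" "v \<in> mmodel (dE S)" "w \<in> mmodel (dM S)"
  shows "mdiff (C1 S) real_mfd (dL S) p (v, w) = DL1 p v + DL2 p w"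
  using mdiff_partial[OF _ wE wM assms(2,3), of False real_mfd "dL S" "fst p" "snd p"] L_reg[OF assms(1)]
  by (simp add: C1_def)

lemma DL1_linear:
  assumes "p \<in> mcarrier (C1 S)"
  shows "linear (DL1 p)" "linear (DL2 p)"
proof -
  have p: "fst p \<in> mcarrier (dE S)" "snd p \<in> mcarrier (dM S)" using assms by (auto simp: C1_def prod_mfd_simps)
  have "mreg False (dE S) (C1 S) (\<lambda>e. (e, snd p)) (fst p)" "mreg False (dM S) (C1 S) (\<lambda>m. (fst p, m)) (snd p)"
    unfolding C1_def using p wE wM by (auto intro: mreg_Pair mreg_id mreg_const)
  then have r: "mreg False (dE S) real_mfd (\<lambda>e. dL S (e, snd p)) (fst p)"
      "mreg False (dM S) real_mfd (\<lambda>m. dL S (fst p, m)) (snd p)"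
    using L_reg[OF assms] wE wM wC1
    by (auto intro: mreg_compose[where f="\<lambda>e. (e, snd p)"] mreg_compose[where f="\<lambda>m. (fst p, m)"])
  show "linear (DL1 p)" "linear (DL2 p)" by (rule mdiff_linear[OF r(1)], rule mdiff_linear[OF r(2)])
qed

lemma motion_section_alt:
  "motion_section S p q \<delta> = DL1 q (fst \<delta>) + DL2 p (Dphi (fst q) (fst \<delta>)) + DL1 p (dP S p q \<delta>)"
  by (simp add: motion_section_def)

lemma motion_section_zero:
  assumes "(p, q) \<in> C2 S"
  shows "motion_section S p q 0 = 0"
proof -
  have pq: "p \<in> mcarrier (C1 S)" "q \<in> mcarrier (C1 S)" using assms by (auto simp: C2_def)
  then have "fst q \<in> mcarrier (dE S)" by (auto simp: C1_def prod_mfd_simps)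
  then have "Dphi (fst q) 0 = 0" by (rule mdiff_0[OF phi_reg])
  then show ?thesis
    using DL1_linear[OF pq(1)] DL1_linear[OF pq(2)] P_zero[OF assms] by (simp add: motion_section_alt linear_0)
qed

definition varA :: "(nat \<Rightarrow> 'e \<times> 'f) \<Rightarrow> nat \<Rightarrow> 'e" where
  "varA \<eta> k = (if k = 0 then 0 else fst (\<eta> k))"

definition varB :: "nat \<Rightarrow> (nat \<Rightarrow> 'a \<times> 'b) \<Rightarrow> (nat \<Rightarrow> 'e \<times> 'f) \<Rightarrow> nat \<Rightarrow> 'e" where
  "varB n x \<eta> k = (if k < n then dP S (x k) (x (Suc k)) (\<eta> (Suc k)) else 0)"

lemma nh_variation_Suc:
  assumes "n \<ge> 1"
  shows "nh_variation S (Suc n) x \<delta> \<longleftrightarrow> \<delta> \<in> mmodel (power_mfd (Suc n) (C1 S)) \<and>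
    (\<forall>k<n. snd (\<delta> k) = Dphi (fst (x (Suc k))) (fst (\<delta> (Suc k)))) \<and> snd (\<delta> n) = 0 \<and>
    (\<exists>\<eta>. (\<forall>k\<in>{1..n}. \<eta> k \<in> dDist S (x k)) \<and> (\<forall>k\<le>n. fst (\<delta> k) = varA \<eta> k + varB n x \<eta> k))"
proof -
  have 1: "(\<forall>k\<in>{1..n}. Q k) \<longleftrightarrow> (\<forall>k<n. Q (Suc k))" for Q :: "nat \<Rightarrow> bool"
    by (metis Suc_le_eq atLeastAtMost_iff Suc_le_mono le_add1 plus_1_eq_Suc Suc_pred' less_le_trans zero_less_one)
  have 2: "(fst (\<delta> n) = fst (\<eta> n) \<and>
        (\<forall>k\<in>{1..n-1}. fst (\<delta> k) = fst (\<eta> k) + dP S (x k) (x (k+1)) (\<eta> (k+1))) \<and>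
        fst (\<delta> 0) = dP S (x 0) (x 1) (\<eta> 1)) \<longleftrightarrow> (\<forall>k\<le>n. fst (\<delta> k) = varA \<eta> k + varB n x \<eta> k)" (is "?l \<longleftrightarrow> ?r") for \<eta>
  proof
    assume ?l
    show ?r
    proof (intro allI impI)
      fix k assume "k \<le> n"
      then consider "k = 0" | "k = n" | "k \<in> {1..n-1}" "k < n" by fastforce
      then show "fst (\<delta> k) = varA \<eta> k + varB n x \<eta> k"
        using \<open>?l\<close> assms by cases (auto simp: varA_def varB_def)
    qed
  next
    assume r: ?r
    show ?l
    proof (intro conjI ballI)
      show "fst (\<delta> n) = fst (\<eta> n)" using r assms by (simp add: varA_def varB_def)
      show "fst (\<delta> 0) = dP S (x 0) (x 1) (\<eta> 1)" using r assms by (simp add: varA_def varB_def)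
      fix k assume "k \<in> {1..n-1}"
      then show "fst (\<delta> k) = fst (\<eta> k) + dP S (x k) (x (k+1)) (\<eta> (k+1))"
        using r by (auto simp: varA_def varB_def)
    qed
  qed
  show ?thesis
    unfolding nh_variation_def using 1[of "\<lambda>k. snd (\<delta> (k - 1)) = Dphi (fst (x k)) (fst (\<delta> k))"] 2
    by (simp add: numeral_2_eq_2)
qed

lemma discrete_path_Suc:
  assumes "discrete_path S (Suc n) x"
  shows "n \<ge> 1" "x \<in> mcarrier (power_mfd (Suc n) (C1 S))" "\<And>k. k \<le> n \<Longrightarrow> x k \<in> mcarrier (C1 S)"
    "\<And>k. k < n \<Longrightarrow> (x k, x (Suc k)) \<in> C2 S"
proof -
  show "n \<ge> 1" and xN: "x \<in> mcarrier (power_mfd (Suc n) (C1 S))" using assms by (auto simp: discrete_path_def)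
  show c: "x k \<in> mcarrier (C1 S)" if "k \<le> n" for k
    using PiE_mem[of x "{..<Suc n}" "\<lambda>_. mcarrier (C1 S)" k] xN that by (simp add: power_mfd_def)
  fix k assume "k < n"
  moreover have "\<forall>k\<in>{1..n}. dphi S (fst (x k)) = snd (x (k-1))" using assms by (simp add: discrete_path_def)
  ultimately have "dphi S (fst (x (Suc k))) = snd (x k)" by (auto dest: bspec[of _ _ "Suc k"])
  then show "(x k, x (Suc k)) \<in> C2 S"
    using c[of k] c[of "Suc k"] \<open>k < n\<close> unfolding C2_def by simp
qed

lemma variation_parts:
  assumes path: "discrete_path S (Suc n) x" and \<eta>: "\<forall>k\<in>{1..n}. \<eta> k \<in> dDist S (x k)"
  shows "k \<le> n \<Longrightarrow> varA \<eta> k \<in> mmodel (dE S)" "k \<le> n \<Longrightarrow> varB n x \<eta> k \<in> mmodel (dE S)"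
    "k \<le> n \<Longrightarrow> Dphi (fst (x k)) (varB n x \<eta> k) = 0"
proof -
  note path' = discrete_path_Suc[OF path]
  have E0: "0 \<in> mmodel (dE S)" using wE by (simp add: wmfdD subspace_0)
  show "k \<le> n \<Longrightarrow> varA \<eta> k \<in> mmodel (dE S)"
    using \<eta> Dist_model[OF path'(3)[of k], of "\<eta> k"] E0 by (auto simp: varA_def)
  show "k \<le> n \<Longrightarrow> varB n x \<eta> k \<in> mmodel (dE S)"
    using P_model[OF path'(4)[of k]] \<eta> E0 by (auto simp: varB_def)
  assume "k \<le> n"
  show "Dphi (fst (x k)) (varB n x \<eta> k) = 0"
  proof (cases "k < n")
    case True
    then show ?thesis using P_vertical[OF path'(4)[OF True]] \<eta> by (auto simp: varB_def)
  next
    case False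
    have "fst (x k) \<in> mcarrier (dE S)" using path'(3)[OF \<open>k \<le> n\<close>] by (auto simp: C1_def prod_mfd_simps)
    then show ?thesis using False mdiff_0[OF phi_reg] by (simp add: varB_def)
  qed
qed

lemma action_variation:
  assumes path: "discrete_path S (Suc n) x" and \<eta>: "\<forall>k\<in>{1..n}. \<eta> k \<in> dDist S (x k)"
    and \<delta>: "\<delta> \<in> mmodel (power_mfd (Suc n) (C1 S))"
    and s: "\<forall>k<n. snd (\<delta> k) = Dphi (fst (x (Suc k))) (fst (\<delta> (Suc k)))" "snd (\<delta> n) = 0"
    and f: "\<forall>k\<le>n. fst (\<delta> k) = varA \<eta> k + varB n x \<eta> k"
  shows "mdiff (power_mfd (Suc n) (C1 S)) real_mfd (discrete_action S (Suc n)) x \<delta> =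
    (\<Sum>k<n. motion_section S (x k) (x (Suc k)) (\<eta> (Suc k)))"
proof -
  note path' = discrete_path_Suc[OF path] and parts = variation_parts[OF path \<eta>]
  have dk: "fst (\<delta> k) \<in> mmodel (dE S)" "snd (\<delta> k) \<in> mmodel (dM S)" if "k \<le> n" for k
  proof -
    have "apply_bcontfun \<delta> k \<in> mmodel (C1 S)" using \<delta> that by (auto simp: power_mfd_def less_Suc_eq_le)
    then show "fst (\<delta> k) \<in> mmodel (dE S)" "snd (\<delta> k) \<in> mmodel (dM S)" by (auto simp: C1_def prod_mfd_simps)
  qed
  have xE: "fst (x k) \<in> mcarrier (dE S)" if "k \<le> n" for k
    using path'(3)[OF that] by (auto simp: C1_def prod_mfd_simps)
  have "mdiff (power_mfd (Suc n) (C1 S)) real_mfd (discrete_action S (Suc n)) x \<delta> =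
      (\<Sum>k<Suc n. mdiff (C1 S) real_mfd (dL S) (x k) (\<delta> k))"
  proof -
    have "discrete_action S (Suc n) = (\<lambda>x. \<Sum>k<Suc n. dL S (x k))" by (rule ext) (simp only: discrete_action_def)
    moreover have "mdiff (power_mfd (Suc n) (C1 S)) real_mfd (\<lambda>x. \<Sum>k<Suc n. dL S (x k)) x \<delta> =
      (\<Sum>k<Suc n. mdiff (C1 S) real_mfd (dL S) (x k) (\<delta> k))"
      by (rule mdiff_sum_power[OF wC1 path'(2) L_reg[OF path'(3)] \<delta>]) simp
    ultimately show ?thesis by simp
  qed
  also have "\<dots> = (\<Sum>k<Suc n. DL1 (x k) (varA \<eta> k) + DL1 (x k) (varB n x \<eta> k) + DL2 (x k) (snd (\<delta> k)))"
  proof (rule sum.cong)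
    fix k assume "k \<in> {..<Suc n}"
    then have k: "k \<le> n" by simp
    have "mdiff (C1 S) real_mfd (dL S) (x k) (\<delta> k) = DL1 (x k) (fst (\<delta> k)) + DL2 (x k) (snd (\<delta> k))"
      using DL_split[OF path'(3)[OF k] dk[OF k]] by simp
    then show "mdiff (C1 S) real_mfd (dL S) (x k) (\<delta> k) =
        DL1 (x k) (varA \<eta> k) + DL1 (x k) (varB n x \<eta> k) + DL2 (x k) (snd (\<delta> k))"
      using f k linear_add[OF DL1_linear(1)[OF path'(3)[OF k]]] by simp
  qed simp
  also have "\<dots> = (\<Sum>k<Suc n. DL1 (x k) (varA \<eta> k)) + (\<Sum>k<Suc n. DL1 (x k) (varB n x \<eta> k)) +
      (\<Sum>k<Suc n. DL2 (x k) (snd (\<delta> k)))"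
    by (simp only: sum.distrib)
  also have "(\<Sum>k<Suc n. DL1 (x k) (varA \<eta> k)) = (\<Sum>k<n. DL1 (x (Suc k)) (fst (\<eta> (Suc k))))"
    using linear_0[OF DL1_linear(1)[OF path'(3)[of 0]]]
    by (simp only: sum.lessThan_Suc_shift) (simp add: varA_def)
  also have "(\<Sum>k<Suc n. DL1 (x k) (varB n x \<eta> k)) = (\<Sum>k<n. DL1 (x k) (dP S (x k) (x (Suc k)) (\<eta> (Suc k))))"
    using linear_0[OF DL1_linear(1)[OF path'(3)[of n]]] by (simp add: varB_def)
  also have "(\<Sum>k<Suc n. DL2 (x k) (snd (\<delta> k))) =
      (\<Sum>k<n. DL2 (x k) (Dphi (fst (x (Suc k))) (fst (\<eta> (Suc k)))))"
  proof -
    have "snd (\<delta> k) = Dphi (fst (x (Suc k))) (fst (\<eta> (Suc k)))" if k: "k < n" for k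
    proof -
      have "Suc k \<le> n" using k by simp
      have "snd (\<delta> k) = Dphi (fst (x (Suc k))) (varA \<eta> (Suc k) + varB n x \<eta> (Suc k))"
        using s(1) f k by simp
      also have "\<dots> = Dphi (fst (x (Suc k))) (varA \<eta> (Suc k)) + Dphi (fst (x (Suc k))) (varB n x \<eta> (Suc k))"
        by (rule linear_add[OF mdiff_linear[OF phi_reg[OF xE[OF \<open>Suc k \<le> n\<close>]]]])
      finally show ?thesis using parts(3)[OF \<open>Suc k \<le> n\<close>] by (simp add: varA_def)
    qed
    then show ?thesis using s(2) linear_0[OF DL1_linear(2)[OF path'(3)[of n]]] by simp
  qed
  finally show ?thesis by (simp add: motion_section_alt sum.distrib)
qed

theorem trajectory_iff_motion:
  assumes path: "discrete_path S N x"
  shows "trajectory S N x \<longleftrightarrow> satisfies_motion S N x"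
proof -
  obtain n where N: "N = Suc n" using path by (cases N) (auto simp: discrete_path_def)
  note path_n = path[unfolded N]
  note path' = discrete_path_Suc[OF path_n]
  have "(\<forall>\<delta>. nh_variation S (Suc n) x \<delta> \<longrightarrow>
          mdiff (power_mfd (Suc n) (C1 S)) real_mfd (discrete_action S (Suc n)) x \<delta> = 0) \<longleftrightarrow>
        (\<forall>k\<in>{1..n}. \<forall>\<delta>\<in>dDist S (x k). motion_section S (x (k-1)) (x k) \<delta> = 0)" (is "?T \<longleftrightarrow> ?M")
  proof
    assume M: ?M
    show ?T
    proof (intro allI impI)
      fix \<delta> assume "nh_variation S (Suc n) x \<delta>"
      then obtain \<eta> where *: "\<delta> \<in> mmodel (power_mfd (Suc n) (C1 S))"
        "\<forall>k<n. snd (\<delta> k) = Dphi (fst (x (Suc k))) (fst (\<delta> (Suc k)))" "snd (\<delta> n) = 0"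
        "\<forall>k\<in>{1..n}. \<eta> k \<in> dDist S (x k)" "\<forall>k\<le>n. fst (\<delta> k) = varA \<eta> k + varB n x \<eta> k"
        unfolding nh_variation_Suc[OF path'(1)] by blast
      have "motion_section S (x k) (x (Suc k)) (\<eta> (Suc k)) = 0" if "k < n" for k
      proof -
        have "Suc k \<in> {1..n}" using that by simp
        then show ?thesis using M *(4) by (metis diff_Suc_1)
      qed
      then show "mdiff (power_mfd (Suc n) (C1 S)) real_mfd (discrete_action S (Suc n)) x \<delta> = 0"
        using action_variation[OF path_n *(4,1,2,3,5)] by simp
    qed
  next
    assume T: ?T
    show ?M
    proof (intro ballI)
      fix k0 \<zeta> assume k0: "k0 \<in> {1..n}" and \<zeta>: "\<zeta> \<in> dDist S (x k0)"
      define \<eta> where "\<eta> k = (if k = k0 then \<zeta> else 0)" for k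
      have \<eta>: "\<forall>k\<in>{1..n}. \<eta> k \<in> dDist S (x k)"
        using \<zeta> Dist_subspace[OF path'(3)] by (auto simp: \<eta>_def subspace_0)
      note parts = variation_parts[OF path_n \<eta>]
      define e where "e k = varA \<eta> k + varB n x \<eta> k" for k
      have eE: "e k \<in> mmodel (dE S)" if "k \<le> n" for k
        unfolding e_def using parts[OF that] wE by (intro subspace_add) (auto simp: wmfdD)
      define d where "d k = (e k, if k < n then Dphi (fst (x (Suc k))) (e (Suc k)) else 0)" for k
      define \<delta> where "\<delta> = Bcontfun (\<lambda>k. if k < Suc n then d k else 0)"
      have app: "apply_bcontfun \<delta> k = (if k < Suc n then d k else 0)" for k
        unfolding \<delta>_def by (simp add: apply_Bcontfun_finite)
      have dC: "d k \<in> mmodel (C1 S)" if "k \<le> n" for k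
      proof -
        have "Dphi (fst (x (Suc k))) (e (Suc k)) \<in> mmodel (dM S)" if "k < n"
        proof -
          have k: "Suc k \<le> n" using that by simp
          then have "fst (x (Suc k)) \<in> mcarrier (dE S)"
            using path'(3)[OF k] by (auto simp: C1_def prod_mfd_simps)
          then show ?thesis by (rule mdiff_in_model[OF phi_reg wE wM eE[OF k]])
        qed
        moreover have "0 \<in> mmodel (dM S)" using wM by (simp add: wmfdD subspace_0)
        ultimately show ?thesis using eE[OF that] by (simp add: d_def C1_def prod_mfd_simps)
      qed
      have \<delta>: "\<delta> \<in> mmodel (power_mfd (Suc n) (C1 S))"
        using dC by (auto simp: power_mfd_def app less_Suc_eq_le)
      have s: "\<forall>k<n. snd (\<delta> k) = Dphi (fst (x (Suc k))) (fst (\<delta> (Suc k)))" "snd (\<delta> n) = 0"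
        and f: "\<forall>k\<le>n. fst (\<delta> k) = varA \<eta> k + varB n x \<eta> k"
        by (auto simp: app d_def e_def)
      have "nh_variation S (Suc n) x \<delta>"
        unfolding nh_variation_Suc[OF path'(1)] using \<delta> s f \<eta> by blast
      then have "0 = (\<Sum>k<n. motion_section S (x k) (x (Suc k)) (\<eta> (Suc k)))"
        using T action_variation[OF path_n \<eta> \<delta> s f] by simp
      also have "\<dots> = (\<Sum>k<n. if k = k0 - 1 then motion_section S (x (k0-1)) (x k0) \<zeta> else 0)"
        using k0 path'(4) by (intro sum.cong) (auto simp: \<eta>_def motion_section_zero)
      also have "\<dots> = motion_section S (x (k0-1)) (x k0) \<zeta>"
      proof -
        have "k0 - 1 < n" using k0 by auto
        then show ?thesis by simp
      qed
      finally show "motion_section S (x (k0-1)) (x k0) \<zeta> = 0" by simp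
    qed
  qed
  then show ?thesis
    unfolding trajectory_def satisfies_motion_def N using path_n by auto
qed

end

section \<open>Group actions and local trivializations\<close>

lemma mreg_compose2:
  fixes K :: "('a, 'e::euclidean_space) mfd" and M :: "('b, 'f::euclidean_space) mfd"
    and N :: "('c, 'h::euclidean_space) mfd" and P :: "('d, 'i::euclidean_space) mfd"
  assumes "mreg b (prod_mfd M N) P h (f p, g p)" "mreg b K M f p" "mreg b K N g p"
    "wmfd K" "wmfd M" "wmfd N"
  shows "mreg b K P (\<lambda>x. h (f x, g x)) p"
  by (rule mreg_compose[where f="\<lambda>x. (f x, g x)" and g=h and N="prod_mfd M N"])
     (use assms in \<open>simp_all add: mreg_Pair wmfd_prod\<close>)

lemma mreg_eventually_in:
  assumes "mreg b M N f p" "wmfd M" "pmfd N" "openin (mtopology N) U" "f p \<in> U"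
  shows "eventually (\<lambda>x. f x \<in> U) (mnhds M p)"
  by (rule mreg_eventually[OF assms(1,2) pmfd_wmfd[OF assms(3)] eventually_mnhds_openin[OF assms(3-5)]])

lemma chart_dom_openin:
  assumes "pmfd M" "c \<in> matlas M"
  shows "openin (mtopology M) (fst c)"
  unfolding openin_mtopology[OF assms(1)]
proof (intro conjI ballI)
  fix d assume "d \<in> matlas M"
  from pmfdD(4)[OF assms(1) this assms(2)] show "openin (top_of_set (mmodel M)) (snd d ` (fst c \<inter> fst d))"
    by (simp add: Cinf_on_def Int_commute)
qed (use pmfdD(1)[OF assms] in auto)

lemma linear_mfd_simps [simp]:
  "mcarrier (linear_mfd V) = V" "mmodel (linear_mfd V) = V" "mpref (linear_mfd V) p = (V, id)"
  "matlas (linear_mfd V) = {(V, id)}"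
  by (simp_all add: linear_mfd_def)

lemma eventually_linear_mfd:
  assumes "v \<in> V"
  shows "eventually P (mnhds (linear_mfd V) v) \<longleftrightarrow> eventually P (rnhds V v)"
proof -
  have "eventually (\<lambda>u. P (inv_into V id u) \<longleftrightarrow> P u) (rnhds V v)"
    using eventually_rnhds_in by eventually_elim (simp add: inv_into_f_f[of id, simplified])
  then show ?thesis unfolding eventually_mnhds by (auto elim: eventually_elim2)
qed

lemma mreg_chart:
  fixes M :: "('a, 'e::euclidean_space) mfd"
  assumes M: "pmfd M" and c: "c \<in> matlas M" "p \<in> fst c"
  shows "mreg b M (linear_mfd (mmodel M)) (snd c) p"
proof (rule chart_mreg[OF M pmfd_linear c])
  let ?V = "mmodel M"
  show "subspace ?V" using M by (simp add: pmfd_def)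
  show "(?V, id) \<in> matlas (linear_mfd ?V)" by simp
  show "snd c p \<in> fst (?V, id)" using pmfdD(5)[OF M c] by simp
  have "eventually (\<lambda>x. x \<in> fst c) (mnhds M p)"
    by (rule eventually_mnhds_openin[OF M chart_dom_openin[OF M c(1)] c(2)])
  then show "eventually (\<lambda>x. snd c x \<in> fst (?V, id)) (mnhds M p)"
    by eventually_elim (simp add: pmfdD(5)[OF M c(1)])
  have "eventually (\<lambda>u. u \<in> snd c ` fst c) (rnhds ?V (snd c p))"
    using pmfdD(3)[OF M c(1)] c(2) by (intro eventually_rnhds_openin) auto
  then have "eventually (\<lambda>u. u = chart_rep c (?V, id) (snd c) u) (rnhds ?V (snd c p))"
    by eventually_elim (simp add: chart_rep_def f_inv_into_f)
  then show "creg b ?V (chart_rep c (?V, id) (snd c)) (snd c p)"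
    by (rule creg_cong[OF pmfdD(5)[OF M c] _ creg_id[OF pmfdD(5)[OF M c]]])
qed

lemma mreg_chart_inv:
  fixes M :: "('a, 'e::euclidean_space) mfd" and T :: "'f::euclidean_space \<Rightarrow> 'e"
  assumes M: "pmfd M" and c: "c \<in> matlas M" and V: "subspace V" "v \<in> V"
    and T: "bounded_linear T" "T ` V \<subseteq> mmodel M" and Tv: "T v \<in> snd c ` fst c"
  shows "mreg b (linear_mfd V) M (\<lambda>u. inv_into (fst c) (snd c) (T u)) v"
proof (rule chart_mreg[OF pmfd_linear[OF V(1)] M])
  show "(V, id) \<in> matlas (linear_mfd V)" "v \<in> fst (V, id)" using V by auto
  show "c \<in> matlas M" by (rule c)
  show "inv_into (fst c) (snd c) (T v) \<in> fst c" using Tv by (rule inv_into_into)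
  have "filterlim T (rnhds (mmodel M) (T v)) (rnhds V v)"
    by (rule filterlim_rnhds[OF linear_continuous_within[OF T(1)] _ V(2)])
       (rule eventually_mono[OF eventually_rnhds_in], use T(2) in auto)
  then have ev: "eventually (\<lambda>u. T u \<in> snd c ` fst c) (rnhds V v)"
    using eventually_rnhds_openin[OF pmfdD(3)[OF M c] Tv] by (rule eventually_compose_filterlim[rotated])
  then show "eventually (\<lambda>u. inv_into (fst c) (snd c) (T u) \<in> fst c) (mnhds (linear_mfd V) v)"
    unfolding eventually_linear_mfd[OF V(2)] by eventually_elim (rule inv_into_into)
  have "eventually (\<lambda>u. T u = chart_rep (V, id) c (\<lambda>u. inv_into (fst c) (snd c) (T u)) u) (rnhds V v)"
    using ev eventually_rnhds_in
    by eventually_elim (simp add: chart_rep_def f_inv_into_f inv_into_f_f[of id, simplified])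
  then have "creg b V (chart_rep (V, id) c (\<lambda>u. inv_into (fst c) (snd c) (T u))) v"
    by (rule creg_cong[OF V(2) _ creg_bounded_linear[OF T(1) creg_id[OF V(2)]]])
  then show "creg b (mmodel (linear_mfd V)) (chart_rep (V, id) c (\<lambda>u. inv_into (fst c) (snd c) (T u)))
      (snd (V, id) v)" by simp
qed

lemma mreg_linear_map:
  fixes T :: "'e::euclidean_space \<Rightarrow> 'f::euclidean_space"
  assumes "subspace V" "subspace W" "bounded_linear T" "T ` V \<subseteq> W" "v \<in> V"
  shows "mreg b (linear_mfd V) (linear_mfd W) T v"
proof -
  have "mreg b (linear_mfd V) (linear_mfd W) (\<lambda>u. inv_into (fst (W, id)) (snd (W, id)) (T u)) v"
    using mreg_chart_inv[OF pmfd_linear[OF assms(2)], where c="(W, id)" and V=V and v=v and T=T and b=b] assms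
    by (auto simp: image_subset_iff)
  moreover have "eventually (\<lambda>u. inv_into (fst (W, id)) (snd (W, id)) (T u) = T u) (mnhds (linear_mfd V) v)"
    unfolding eventually_linear_mfd[OF assms(5)] using eventually_rnhds_in
    by eventually_elim (use assms(4) in \<open>auto simp: inv_into_f_f[of id, simplified]\<close>)
  ultimately show ?thesis
    by (rule mreg_cong[where f="\<lambda>u. inv_into (fst (W, id)) (snd (W, id)) (T u)", OF _ pmfd_wmfd[OF pmfd_linear[OF assms(1)]]])
qed

definition local_triv ::
    "('t, 'e::euclidean_space) mfd \<Rightarrow> ('p, 'f::euclidean_space) mfd \<Rightarrow> ('q, 'h::euclidean_space) mfd \<Rightarrow>
     ('t \<Rightarrow> 'p) \<Rightarrow> 'p set \<Rightarrow> ('t \<Rightarrow> 'q) \<Rightarrow> ('p \<times> 'q \<Rightarrow> 't) \<Rightarrow> bool" where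
  "local_triv T P K p U \<sigma> \<tau> \<longleftrightarrow> openin (mtopology P) U \<and>
     (\<forall>x\<in>mcarrier T. p x \<in> U \<longrightarrow> \<sigma> x \<in> mcarrier K \<and> (\<forall>b. mreg b T K \<sigma> x) \<and> \<tau> (p x, \<sigma> x) = x) \<and>
     (\<forall>u\<in>U. \<forall>k\<in>mcarrier K. \<tau> (u, k) \<in> mcarrier T \<and> p (\<tau> (u, k)) = u \<and> \<sigma> (\<tau> (u, k)) = k \<and>
        (\<forall>b. mreg b (prod_mfd P K) T \<tau> (u, k)))"

lemma local_trivD:
  assumes "local_triv T P K p U \<sigma> \<tau>"
  shows "openin (mtopology P) U"
    "x \<in> mcarrier T \<Longrightarrow> p x \<in> U \<Longrightarrow> \<sigma> x \<in> mcarrier K"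
    "x \<in> mcarrier T \<Longrightarrow> p x \<in> U \<Longrightarrow> mreg b T K \<sigma> x"
    "x \<in> mcarrier T \<Longrightarrow> p x \<in> U \<Longrightarrow> \<tau> (p x, \<sigma> x) = x"
    "u \<in> U \<Longrightarrow> k \<in> mcarrier K \<Longrightarrow> \<tau> (u, k) \<in> mcarrier T \<and> p (\<tau> (u, k)) = u \<and> \<sigma> (\<tau> (u, k)) = k"
    "u \<in> U \<Longrightarrow> k \<in> mcarrier K \<Longrightarrow> mreg b (prod_mfd P K) T \<tau> (u, k)"
  using assms by (simp_all add: local_triv_def)

lemma diffeo_on_local_triv:
  assumes T: "pmfd T" and P: "pmfd P" and K: "pmfd K" and U: "openin (mtopology P) U"
    and p: "\<And>x. x \<in> mcarrier T \<Longrightarrow> mreg True T P p x"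
    and D: "diffeo_on T (prod_mfd P K) {x \<in> mcarrier T. p x \<in> U} (U \<times> mcarrier K) \<Psi>"
    and \<Psi>: "\<And>x. x \<in> mcarrier T \<Longrightarrow> p x \<in> U \<Longrightarrow> fst (\<Psi> x) = p x"
  shows "local_triv T P K p U (\<lambda>x. snd (\<Psi> x)) (inv_into {x \<in> mcarrier T. p x \<in> U} \<Psi>)"
proof -
  let ?A = "{x \<in> mcarrier T. p x \<in> U}" and ?PK = "prod_mfd P K"
  note w = pmfd_wmfd[OF T] pmfd_wmfd[OF P] pmfd_wmfd[OF K]
  note wPK = wmfd_prod[OF w(2,3)]
  note dD = diffeo_onD[OF D T pmfd_prod[OF P K]]
  have UP: "U \<subseteq> mcarrier P" using U openin_iff_mnhds[OF P] by blast
  have evA: "eventually (\<lambda>x. x \<in> ?A) (mnhds T x)" if "x \<in> ?A" for x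
  proof -
    have "eventually (\<lambda>x. p x \<in> U) (mnhds T x)"
      by (rule mreg_eventually_in[OF p w(1) P U]) (use that in auto)
    moreover have "eventually (\<lambda>x. x \<in> mcarrier T) (mnhds T x)"
      by (rule eventually_mnhds_carrier[OF w(1)]) (use that in auto)
    ultimately show ?thesis by eventually_elim simp
  qed
  have evUK: "eventually (\<lambda>z. z \<in> U \<times> mcarrier K) (mnhds ?PK (u, k))" if "u \<in> U" "k \<in> mcarrier K" for u k
  proof -
    have c: "(u, k) \<in> mcarrier ?PK" using that UP by (auto simp: prod_mfd_simps)
    have "eventually (\<lambda>z. fst z \<in> U) (mnhds ?PK (u, k))"
      by (rule mreg_eventually_in[OF mreg_fst[OF w(2,3) c, of True] wPK P U]) (simp add: that)
    with eventually_mnhds_carrier[OF wPK c] show ?thesis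
      by eventually_elim (auto simp: prod_mfd_simps)
  qed
  let ?\<tau> = "inv_into ?A \<Psi>"
  have bij: "bij_betw \<Psi> ?A (U \<times> mcarrier K)" by (rule dD(3))
  show ?thesis
    unfolding local_triv_def
  proof (intro conjI ballI impI allI U)
    fix x b assume x: "x \<in> mcarrier T" "p x \<in> U"
    have \<Psi>x: "\<Psi> x \<in> U \<times> mcarrier K" using bij_betw_apply[OF bij, of x] x by simp
    then show "snd (\<Psi> x) \<in> mcarrier K" by auto
    have A: "x \<in> ?A" using x by simp
    have r: "mreg b T ?PK \<Psi> x" by (rule dD(1)[OF A evA[OF A]])
    show "mreg b T K (\<lambda>x. snd (\<Psi> x)) x"
      by (rule mreg_compose[where f="\<Psi>" and g=snd, OF r mreg_snd[OF w(2,3) mregD(2)[OF r]] w(1) wPK])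
    have "(p x, snd (\<Psi> x)) = \<Psi> x" using \<Psi>[OF x] by (metis prod.collapse)
    then show "?\<tau> (p x, snd (\<Psi> x)) = x" using bij_betw_inv_into_left[OF bij] x by simp
  next
    fix u k b assume uk: "u \<in> U" "k \<in> mcarrier K"
    have A: "?\<tau> (u, k) \<in> ?A" using bij_betw_apply[OF bij_betw_inv_into[OF bij]] uk by blast
    have inv: "\<Psi> (?\<tau> (u, k)) = (u, k)" using bij_betw_inv_into_right[OF bij] uk by blast
    show "?\<tau> (u, k) \<in> mcarrier T" "p (?\<tau> (u, k)) = u" "snd (\<Psi> (?\<tau> (u, k))) = k"
      using A \<Psi>[of "?\<tau> (u, k)"] inv by simp_all
    show "mreg b ?PK T ?\<tau> (u, k)" using uk by (intro dD(2) evUK) auto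
  qed
qed

lemma local_triv_dim:
  assumes L: "local_triv T P K p U \<sigma> \<tau>" and T: "pmfd T" and P: "pmfd P" and K: "pmfd K"
    and p: "mreg True T P p x" and x: "p x \<in> U"
  shows "dim (mmodel T) = dim (mmodel P) + dim (mmodel K)"
proof -
  let ?PK = "prod_mfd P K"
  note w = pmfd_wmfd[OF T] pmfd_wmfd[OF P] pmfd_wmfd[OF K]
  note wPK = wmfd_prod[OF w(2,3)]
  note D = local_trivD[OF L]
  have xT: "x \<in> mcarrier T" by (rule mregD(1)[OF p])
  have 1: "mreg True T ?PK (\<lambda>x. (p x, \<sigma> x)) x" by (intro mreg_Pair p D(3) xT x)
  have 2: "mreg True ?PK T \<tau> (p x, \<sigma> x)" by (intro D(6) x D(2) xT)
  have 3: "mreg True T ?PK (\<lambda>x. (p x, \<sigma> x)) (\<tau> (p x, \<sigma> x))" using 1 D(4)[OF xT x] by simp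
  have "eventually (\<lambda>x. p x \<in> U) (mnhds T x)" by (rule mreg_eventually_in[OF p w(1) P D(1) x])
  with eventually_mnhds_carrier[OF w(1) xT]
  have "eventually (\<lambda>x. \<tau> (p x, \<sigma> x) = x) (mnhds T x)" by eventually_elim (rule D(4))
  then have "dim (mmodel T) \<le> dim (mmodel ?PK)" by (rule mreg_dim_le[OF 1 2 w(1) wPK])
  moreover have "eventually (\<lambda>z. fst z \<in> U) (mnhds ?PK (p x, \<sigma> x))"
    by (rule mreg_eventually_in[OF mreg_fst[OF w(2,3) mregD(1)[OF 2], of True] wPK P D(1)]) (simp add: x)
  with eventually_mnhds_carrier[OF wPK mregD(1)[OF 2]]
  have "eventually (\<lambda>z. (p (\<tau> z), \<sigma> (\<tau> z)) = z) (mnhds ?PK (p x, \<sigma> x))"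
    by eventually_elim (auto simp: prod_mfd_simps D(5))
  then have "dim (mmodel ?PK) \<le> dim (mmodel T)" by (rule mreg_dim_le[OF 2 3 wPK w(1)])
  ultimately show ?thesis
    using dim_Times[OF wmfdD(1)[OF w(2)] wmfdD(1)[OF w(3)]] by (simp add: prod_mfd_simps)
qed

locale set_action = group G for G (structure) +
  fixes X :: "'x set" and act :: "'g \<Rightarrow> 'x \<Rightarrow> 'x"
  assumes act_closed: "g \<in> carrier G \<Longrightarrow> x \<in> X \<Longrightarrow> act g x \<in> X"
    and act_one: "x \<in> X \<Longrightarrow> act \<one> x = x"
    and act_mult: "g \<in> carrier G \<Longrightarrow> h \<in> carrier G \<Longrightarrow> x \<in> X \<Longrightarrow> act (g \<otimes> h) x = act g (act h x)"
begin

lemma act_inv: "g \<in> carrier G \<Longrightarrow> x \<in> X \<Longrightarrow> act (inv g) (act g x) = x"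
  by (metis act_mult act_one inv_closed l_inv)

lemma act_inv': "g \<in> carrier G \<Longrightarrow> x \<in> X \<Longrightarrow> act g (act (inv g) x) = x"
  by (metis act_mult act_one inv_closed r_inv)

lemma orbit_act: "g \<in> carrier G \<Longrightarrow> x \<in> X \<Longrightarrow> orbit G act (act g x) = orbit G act x"
proof -
  assume g: "g \<in> carrier G" "x \<in> X"
  have "\<exists>k. act h (act g x) = act k x \<and> k \<in> carrier G" if "h \<in> carrier G" for h
    using that g act_mult by (metis m_closed)
  moreover have "\<exists>k. act h x = act k (act g x) \<and> k \<in> carrier G" if h: "h \<in> carrier G" for h
  proof -
    have "act (h \<otimes> inv g) (act g x) = act h x" using h g act_mult[of h "inv g" "act g x"] act_inv act_closed by simp
    then show ?thesis using h g by (metis inv_closed m_closed)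
  qed
  ultimately show ?thesis unfolding orbit_def by blast
qed

lemma in_orbit: "x \<in> X \<Longrightarrow> x \<in> orbit G act x"
  unfolding orbit_def using act_one[of x] one_closed by (metis (mono_tags, lifting) mem_Collect_eq)

lemma orbit_eqD: "orbit G act x = orbit G act y \<Longrightarrow> y \<in> X \<Longrightarrow> \<exists>g\<in>carrier G. y = act g x"
  using in_orbit[of y] unfolding orbit_def by blast

lemma orbit_in_orbits: "x \<in> X \<Longrightarrow> orbit G act x \<in> orbits G X act"
  unfolding orbits_def by blast

lemma orbitsE: "r \<in> orbits G X act \<Longrightarrow> (\<And>x. x \<in> X \<Longrightarrow> r = orbit G act x \<Longrightarrow> P) \<Longrightarrow> P"
  unfolding orbits_def by blast

end

lemma smooth_left_action_set_action:
  assumes "smooth_left_action G MG X act" "group G" "mcarrier MG = carrier G"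
  shows "set_action G (mcarrier X) act"
proof -
  interpret group G by fact
  have c: "(\<lambda>(g, x). act g x) \<in> carrier G \<times> mcarrier X \<rightarrow> mcarrier X"
    using assms unfolding smooth_left_action_def msmooth_def by auto
  show ?thesis
  proof
    fix g x assume "g \<in> carrier G" "x \<in> mcarrier X"
    then show "act g x \<in> mcarrier X" using funcset_mem[OF c, of "(g, x)"] by simp
  qed (use assms(1) in \<open>simp_all add: smooth_left_action_def\<close>)
qed

locale bundle_action = group G for G :: "'g monoid" (structure) +
  fixes MG :: "('g, 'k::euclidean_space) mfd" and E :: "('a, 'e::euclidean_space) mfd"
    and M :: "('b, 'f::euclidean_space) mfd" and F :: "('c, 'h::euclidean_space) mfd"
    and phi :: "'a \<Rightarrow> 'b" and actE :: "'g \<Rightarrow> 'a \<Rightarrow> 'a" and actM :: "'g \<Rightarrow> 'b \<Rightarrow> 'b" and actF :: "'c \<Rightarrow> 'g \<Rightarrow> 'c"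
  assumes lie: "lie_group G MG" and fb: "fiber_bundle E M F phi"
    and acts: "acts_on_bundle G MG E M F phi actE actM actF"
begin

abbreviation B where "B \<equiv> quot_mfd G MG M actM"
abbreviation X where "X \<equiv> prod_mfd E MG"
abbreviation cact where "cact \<equiv> conj_act G actE"
abbreviation Q where "Q \<equiv> conjugate_bundle G MG E actE"
abbreviation piM where "piM \<equiv> orbit G actM"
abbreviation piQ where "piQ \<equiv> orbit G cact"
abbreviation W where "W \<equiv> prod_mfd B (prod_mfd F MG)"

lemma pmfds: "pmfd MG" "pmfd E" "pmfd M" "pmfd F" "pmfd B" "pmfd X" "pmfd W"
proof -
  show "pmfd MG" "pmfd E" "pmfd M" "pmfd F" "pmfd B"
    using lie fb acts by (auto simp: lie_group_def fiber_bundle_def acts_on_bundle_def principal_bundle_def is_manifold_pmfd)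
  then show "pmfd X" "pmfd W" by (auto intro: pmfd_prod)
qed

lemmas wmfds = pmfds[THEN pmfd_wmfd]

lemma MG_carrier [simp]: "mcarrier MG = carrier G"
  using lie by (simp add: lie_group_def)

lemma B_carrier: "mcarrier B = orbits G (mcarrier M) actM"
  by (simp add: quot_mfd_def)

lemma smooth_actions: "smooth_left_action G MG E actE" "smooth_left_action G MG M actM"
    "smooth_right_action G MG F actF"
  using acts by (auto simp: acts_on_bundle_def)

sublocale aE: set_action G "mcarrier E" actE
  by (rule smooth_left_action_set_action[OF smooth_actions(1)]) (simp_all add: is_group)

sublocale aM: set_action G "mcarrier M" actM
  by (rule smooth_left_action_set_action[OF smooth_actions(2)]) (simp_all add: is_group)

lemma inv_cancel:
  "g \<in> carrier G \<Longrightarrow> h \<in> carrier G \<Longrightarrow> inv g \<otimes> (g \<otimes> h) = h"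
  "g \<in> carrier G \<Longrightarrow> h \<in> carrier G \<Longrightarrow> g \<otimes> (inv g \<otimes> h) = h"
  by (simp_all add: m_assoc[symmetric])

sublocale aX: set_action G "mcarrier X" cact
proof
  fix g x assume g: "g \<in> carrier G" "x \<in> mcarrier X"
  then obtain e w where x: "x = (e, w)" "e \<in> mcarrier E" "w \<in> carrier G" by (auto simp: prod_mfd_simps)
  show "cact g x \<in> mcarrier X" using g x by (simp add: conj_act_def prod_mfd_simps aE.act_closed)
next
  fix x assume "x \<in> mcarrier X"
  then show "cact \<one> x = x" by (auto simp: conj_act_def prod_mfd_simps aE.act_one)
next
  fix g h x assume g: "g \<in> carrier G" "h \<in> carrier G" "x \<in> mcarrier X"
  then obtain e w where x: "x = (e, w)" "e \<in> mcarrier E" "w \<in> carrier G" by (auto simp: prod_mfd_simps)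
  show "cact (g \<otimes> h) x = cact g (cact h x)"
    using g x by (simp add: conj_act_def aE.act_mult m_assoc inv_mult_group)
qed

lemma phi_closed: "e \<in> mcarrier E \<Longrightarrow> phi e \<in> mcarrier M"
  using fb by (auto simp: fiber_bundle_def msmooth_def)

lemma acts_conj: "free_action G (mcarrier M) actM" "principal_bundle G MG M actM"
    "\<forall>m\<in>mcarrier M. \<exists>U \<Phi>. openin (mtopology M) U \<and> m \<in> U \<and>
        (\<forall>g\<in>carrier G. \<forall>u\<in>U. actM g u \<in> U) \<and>
        diffeo_on E (prod_mfd M F) {e \<in> mcarrier E. phi e \<in> U} (U \<times> mcarrier F) \<Phi> \<and>
        (\<forall>e\<in>mcarrier E. phi e \<in> U \<longrightarrow> fst (\<Phi> e) = phi e \<and>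
           (\<forall>g\<in>carrier G. \<Phi> (actE g e) = (actM g (phi e), actF (snd (\<Phi> e)) (inv g))))"
  using acts unfolding acts_on_bundle_def by blast+

lemma phi_act: "g \<in> carrier G \<Longrightarrow> e \<in> mcarrier E \<Longrightarrow> phi (actE g e) = actM g (phi e)"
  using acts by (simp add: acts_on_bundle_def)

lemma freeM: "g \<in> carrier G \<Longrightarrow> m \<in> mcarrier M \<Longrightarrow> actM g m = m \<Longrightarrow> g = \<one>"
  using acts_conj(1) unfolding free_action_def by blast

lemma freeM': "g \<in> carrier G \<Longrightarrow> h \<in> carrier G \<Longrightarrow> m \<in> mcarrier M \<Longrightarrow> actM g m = actM h m \<Longrightarrow> g = h"
proof -
  assume g: "g \<in> carrier G" "h \<in> carrier G" "m \<in> mcarrier M" and eq: "actM g m = actM h m"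
  have "actM (inv h \<otimes> g) m = m" using g eq by (simp add: aM.act_mult aM.act_inv)
  then have "inv h \<otimes> g = \<one>" using g by (intro freeM) auto
  then show "g = h" using g by (metis inv_cancel(2) r_one)
qed

lemma actF_props:
  "f \<in> mcarrier F \<Longrightarrow> g \<in> carrier G \<Longrightarrow> actF f g \<in> mcarrier F"
  "f \<in> mcarrier F \<Longrightarrow> actF f \<one> = f"
  "f \<in> mcarrier F \<Longrightarrow> g \<in> carrier G \<Longrightarrow> h \<in> carrier G \<Longrightarrow> actF (actF f g) h = actF f (g \<otimes> h)"
proof -
  have "(\<lambda>(x, g). actF x g) \<in> mcarrier F \<times> carrier G \<rightarrow> mcarrier F"
    using smooth_actions(3) unfolding smooth_right_action_def msmooth_def by blast
  from funcset_mem[OF this, of "(f, g)"]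
  show "f \<in> mcarrier F \<Longrightarrow> g \<in> carrier G \<Longrightarrow> actF f g \<in> mcarrier F" by simp
qed (use smooth_actions(3) in \<open>simp_all add: smooth_right_action_def\<close>)

lemma regs:
  "e \<in> mcarrier E \<Longrightarrow> mreg b E M phi e"
  "m \<in> mcarrier M \<Longrightarrow> mreg b M B piM m"
  "p \<in> mcarrier (prod_mfd MG MG) \<Longrightarrow> mreg b (prod_mfd MG MG) MG (\<lambda>(g, h). g \<otimes> h) p"
  "g \<in> carrier G \<Longrightarrow> mreg b MG MG (\<lambda>g. inv g) g"
  "q \<in> mcarrier (prod_mfd MG E) \<Longrightarrow> mreg b (prod_mfd MG E) E (\<lambda>(g, x). actE g x) q"
  "r \<in> mcarrier (prod_mfd MG M) \<Longrightarrow> mreg b (prod_mfd MG M) M (\<lambda>(g, x). actM g x) r"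
  "s \<in> mcarrier (prod_mfd F MG) \<Longrightarrow> mreg b (prod_mfd F MG) F (\<lambda>(x, g). actF x g) s"
proof -
  show "e \<in> mcarrier E \<Longrightarrow> mreg b E M phi e"
    by (rule msmooth_mreg_carrier[OF pmfds(2,3)]) (use fb in \<open>auto simp: fiber_bundle_def\<close>)
  show "m \<in> mcarrier M \<Longrightarrow> mreg b M B piM m"
    by (rule msmooth_mreg_carrier[OF pmfds(3,5)]) (use acts_conj(2) in \<open>auto simp: principal_bundle_def\<close>)
  show "p \<in> mcarrier (prod_mfd MG MG) \<Longrightarrow> mreg b (prod_mfd MG MG) MG (\<lambda>(g, h). g \<otimes> h) p"
    by (rule msmooth_mreg_carrier[OF pmfd_prod[OF pmfds(1,1)] pmfds(1)])
      (use lie in \<open>simp_all add: lie_group_def prod_mfd_simps\<close>)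
  show "g \<in> carrier G \<Longrightarrow> mreg b MG MG (\<lambda>g. inv g) g"
    by (rule msmooth_mreg_carrier[OF pmfds(1,1)]) (use lie in \<open>simp_all add: lie_group_def\<close>)
  show "q \<in> mcarrier (prod_mfd MG E) \<Longrightarrow> mreg b (prod_mfd MG E) E (\<lambda>(g, x). actE g x) q"
    by (rule msmooth_mreg_carrier[OF pmfd_prod[OF pmfds(1,2)] pmfds(2)])
      (use smooth_actions(1) in \<open>simp_all add: smooth_left_action_def prod_mfd_simps\<close>)
  show "r \<in> mcarrier (prod_mfd MG M) \<Longrightarrow> mreg b (prod_mfd MG M) M (\<lambda>(g, x). actM g x) r"
    by (rule msmooth_mreg_carrier[OF pmfd_prod[OF pmfds(1,3)] pmfds(3)])
      (use smooth_actions(2) in \<open>simp_all add: smooth_left_action_def prod_mfd_simps\<close>)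
  show "s \<in> mcarrier (prod_mfd F MG) \<Longrightarrow> mreg b (prod_mfd F MG) F (\<lambda>(x, g). actF x g) s"
    by (rule msmooth_mreg_carrier[OF pmfd_prod[OF pmfds(4,1)] pmfds(4)])
      (use smooth_actions(3) in \<open>simp_all add: smooth_right_action_def prod_mfd_simps\<close>)
qed

lemma mreg_phi: "mreg b K E f p \<Longrightarrow> wmfd K \<Longrightarrow> mreg b K M (\<lambda>x. phi (f x)) p"
  by (rule mreg_compose[where f=f and g=phi and N=E, OF _ regs(1) _ wmfds(2)]) (auto dest: mregD(2))

lemma mreg_piM: "mreg b K M f p \<Longrightarrow> wmfd K \<Longrightarrow> mreg b K B (\<lambda>x. piM (f x)) p"
  by (rule mreg_compose[where f=f and g=piM and N=M, OF _ regs(2) _ wmfds(3)]) (auto dest: mregD(2))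

lemma mreg_inv: "mreg b K MG f p \<Longrightarrow> wmfd K \<Longrightarrow> mreg b K MG (\<lambda>x. inv (f x)) p"
  by (rule mreg_compose[where f=f and g="\<lambda>g. inv g" and N=MG, OF _ regs(4) _ wmfds(1)])
    (use mregD(2)[of b K MG f p] in auto)

lemma mreg_mult:
  fixes K :: "('z, 'y::euclidean_space) mfd"
  shows "mreg b K MG f p \<Longrightarrow> mreg b K MG h p \<Longrightarrow> wmfd K \<Longrightarrow> mreg b K MG (\<lambda>x. f x \<otimes> h x) p"
  using mreg_compose2[OF regs(3), of f p h b K] wmfds mregD(2)[of b K MG f p] mregD(2)[of b K MG h p]
  by (simp add: prod_mfd_simps)

lemma mreg_actE:
  fixes K :: "('z, 'y::euclidean_space) mfd"
  shows "mreg b K MG f p \<Longrightarrow> mreg b K E h p \<Longrightarrow> wmfd K \<Longrightarrow> mreg b K E (\<lambda>x. actE (f x) (h x)) p"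
  using mreg_compose2[OF regs(5), of f p h b K] wmfds mregD(2)[of b K MG f p] mregD(2)[of b K E h p]
  by (simp add: prod_mfd_simps)

lemma mreg_actM:
  fixes K :: "('z, 'y::euclidean_space) mfd"
  shows "mreg b K MG f p \<Longrightarrow> mreg b K M h p \<Longrightarrow> wmfd K \<Longrightarrow> mreg b K M (\<lambda>x. actM (f x) (h x)) p"
  using mreg_compose2[OF regs(6), of f p h b K] wmfds mregD(2)[of b K MG f p] mregD(2)[of b K M h p]
  by (simp add: prod_mfd_simps)

lemma mreg_actF:
  fixes K :: "('z, 'y::euclidean_space) mfd"
  shows "mreg b K F f p \<Longrightarrow> mreg b K MG h p \<Longrightarrow> wmfd K \<Longrightarrow> mreg b K F (\<lambda>x. actF (f x) (h x)) p"
  using mreg_compose2[OF regs(7), of f p h b K] wmfds mregD(2)[of b K F f p] mregD(2)[of b K MG h p]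
  by (simp add: prod_mfd_simps)

lemma principal_triv:
  assumes m0: "m0 \<in> mcarrier M"
  obtains V \<sigma> \<tau> where "local_triv M B MG piM V \<sigma> \<tau>" "piM m0 \<in> V"
    "\<And>m g. m \<in> mcarrier M \<Longrightarrow> piM m \<in> V \<Longrightarrow> g \<in> carrier G \<Longrightarrow> \<sigma> (actM g m) = g \<otimes> \<sigma> m"
proof -
  have "piM m0 \<in> orbits G (mcarrier M) actM" using m0 by (rule aM.orbit_in_orbits)
  from bspec[OF conjunct2[OF conjunct2[OF conjunct2[OF conjunct2[OF conjunct2[OF conjunct2[OF
      acts_conj(2)[unfolded principal_bundle_def]]]]]]] this]
  obtain V \<Psi> where V: "openin (mtopology B) V" "piM m0 \<in> V"
     and D: "diffeo_on M (prod_mfd B MG) {x \<in> mcarrier M. piM x \<in> V} (V \<times> carrier G) \<Psi>"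
     and \<Psi>: "\<And>x. x \<in> mcarrier M \<Longrightarrow> piM x \<in> V \<Longrightarrow> fst (\<Psi> x) = piM x"
       "\<And>x g. x \<in> mcarrier M \<Longrightarrow> piM x \<in> V \<Longrightarrow> g \<in> carrier G \<Longrightarrow> snd (\<Psi> (actM g x)) = g \<otimes> snd (\<Psi> x)"
    by (elim exE conjE) simp
  show thesis
    by (rule that[OF diffeo_on_local_triv[OF pmfds(3,5,1) V(1) regs(2) D[folded MG_carrier] \<Psi>(1)] V(2) \<Psi>(2)])
qed

lemma bundle_triv:
  assumes m0: "m0 \<in> mcarrier M"
  obtains U \<xi> \<epsilon> where "local_triv E M F phi U \<xi> \<epsilon>" "m0 \<in> U"
    "\<And>g u. g \<in> carrier G \<Longrightarrow> u \<in> U \<Longrightarrow> actM g u \<in> U"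
    "\<And>e g. e \<in> mcarrier E \<Longrightarrow> phi e \<in> U \<Longrightarrow> g \<in> carrier G \<Longrightarrow> \<xi> (actE g e) = actF (\<xi> e) (inv g)"
proof -
  obtain U \<Phi> where U: "openin (mtopology M) U" "m0 \<in> U"
      "\<And>g u. g \<in> carrier G \<Longrightarrow> u \<in> U \<Longrightarrow> actM g u \<in> U"
     and D: "diffeo_on E (prod_mfd M F) {e \<in> mcarrier E. phi e \<in> U} (U \<times> mcarrier F) \<Phi>"
     and \<Phi>: "\<And>e. e \<in> mcarrier E \<Longrightarrow> phi e \<in> U \<Longrightarrow> fst (\<Phi> e) = phi e"
       "\<And>e g. e \<in> mcarrier E \<Longrightarrow> phi e \<in> U \<Longrightarrow> g \<in> carrier G \<Longrightarrow>
          \<Phi> (actE g e) = (actM g (phi e), actF (snd (\<Phi> e)) (inv g))"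
    using acts_conj(3)[rule_format, OF m0] by (elim exE conjE) simp
  show thesis
    by (rule that[OF diffeo_on_local_triv[OF pmfds(2,3,4) U(1) regs(1) D \<Phi>(1)] U(2,3)]) (simp_all add: \<Phi>(2))
qed

end

section \<open>The conjugate bundle\<close>

lemma quot_model_props:
  fixes K :: "('x, 'e::euclidean_space) mfd" and MG :: "('g, 'k::euclidean_space) mfd"
  assumes "subspace (mmodel K)"
  shows "subspace (quot_model MG K)" "quot_model MG K \<subseteq> mmodel K"
    "dim (quot_model MG K) = dim (mmodel K) - dim (mmodel MG)"
proof -
  have "\<exists>V. subspace V \<and> V \<subseteq> mmodel K \<and> dim V = dim (mmodel K) - dim (mmodel MG)"
  proof -
    obtain V where "subspace V" "V \<subseteq> span (mmodel K)" "dim V = dim (mmodel K) - dim (mmodel MG)"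
      using choose_subspace_of_subspace[of "dim (mmodel K) - dim (mmodel MG)" "mmodel K"] by auto
    moreover have "span (mmodel K) = mmodel K" using assms by (rule span_eq_iff[THEN iffD2])
    ultimately show ?thesis by auto
  qed
  from someI_ex[OF this] show "subspace (quot_model MG K)" "quot_model MG K \<subseteq> mmodel K"
    "dim (quot_model MG K) = dim (mmodel K) - dim (mmodel MG)"
    unfolding quot_model_def by auto
qed

context bundle_action
begin

lemma Q_simps: "mcarrier Q = orbits G (mcarrier X) cact" "mmodel Q = quot_model MG X"
  by (simp_all add: conjugate_bundle_def quot_mfd_def)

lemma X_cases:
  assumes "x \<in> mcarrier X"
  obtains e w where "x = (e, w)" "e \<in> mcarrier E" "w \<in> carrier G"
  using assms by (cases x) (auto simp: prod_mfd_simps)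

text \<open>
  Over trivializations \<open>\<sigma>\<close> of \<open>M \<rightarrow> M/G\<close> and \<open>\<xi>\<close> of \<open>E \<rightarrow> M\<close>, the invariants of \<open>(e, w)\<close> are
  \<open>\<pi>(\<phi>(e))\<close> and the components of \<open>h\<^sup>-\<^sup>1 \<cdot> (e, w)\<close> in the fiber and in \<open>G\<close>, where \<open>h = \<sigma>(\<phi>(e))\<close>.
\<close>

lemma Q_triv:
  assumes x0: "x0 \<in> mcarrier X"
  obtains A f where "openin (mtopology X) A" "x0 \<in> A"
    "\<And>g x. g \<in> carrier G \<Longrightarrow> x \<in> A \<Longrightarrow> cact g x \<in> A"
    "\<And>g x. g \<in> carrier G \<Longrightarrow> x \<in> A \<Longrightarrow> f (cact g x) = f x"
    "\<And>x b. x \<in> A \<Longrightarrow> mreg b X W f x"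
    "\<And>x y. x \<in> A \<Longrightarrow> y \<in> A \<Longrightarrow> f x = f y \<Longrightarrow> piQ x = piQ y"
    "\<And>x. x \<in> A \<Longrightarrow> \<exists>s. (\<forall>b. mreg b W X s (f x)) \<and> s (f x) = x \<and>
       eventually (\<lambda>z. s z \<in> A \<and> f (s z) = z) (mnhds W (f x))"
proof -
  have m0: "phi (fst x0) \<in> mcarrier M" using x0 by (elim X_cases) (simp add: phi_closed)
  obtain V \<sigma> \<tau> where LT: "local_triv M B MG piM V \<sigma> \<tau>" "piM (phi (fst x0)) \<in> V"
    "\<And>m g. m \<in> mcarrier M \<Longrightarrow> piM m \<in> V \<Longrightarrow> g \<in> carrier G \<Longrightarrow> \<sigma> (actM g m) = g \<otimes> \<sigma> m"
    by (rule principal_triv[OF m0]) (rule that; assumption)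
  note V = local_trivD(1)[OF LT(1)] LT(2)
  note \<sigma> = local_trivD(2,3)[OF LT(1), unfolded MG_carrier] LT(3)
  note \<tau> = local_trivD(4-6)[OF LT(1), unfolded MG_carrier]
  obtain U \<xi> \<epsilon> where LU: "local_triv E M F phi U \<xi> \<epsilon>" "phi (fst x0) \<in> U"
      "\<And>g u. g \<in> carrier G \<Longrightarrow> u \<in> U \<Longrightarrow> actM g u \<in> U"
      "\<And>e g. e \<in> mcarrier E \<Longrightarrow> phi e \<in> U \<Longrightarrow> g \<in> carrier G \<Longrightarrow> \<xi> (actE g e) = actF (\<xi> e) (inv g)"
    by (rule bundle_triv[OF m0]) (rule that; assumption)
  note U = local_trivD(1)[OF LU(1)] LU(2,3)
  note \<xi> = local_trivD(2,3)[OF LU(1)] LU(4) and \<epsilon> = local_trivD(4-6)[OF LU(1)]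
  define A where "A = {x \<in> mcarrier X. phi (fst x) \<in> U \<and> piM (phi (fst x)) \<in> V}"
  define f where "f x = (piM (phi (fst x)), (actF (\<xi> (fst x)) (\<sigma> (phi (fst x))),
      inv (\<sigma> (phi (fst x))) \<otimes> snd x \<otimes> \<sigma> (phi (fst x))))" for x
  have Acases: "P" if "x \<in> A" "\<And>e w. x = (e, w) \<Longrightarrow> e \<in> mcarrier E \<Longrightarrow> w \<in> carrier G \<Longrightarrow> phi e \<in> U \<Longrightarrow>
      phi e \<in> mcarrier M \<Longrightarrow> piM (phi e) \<in> V \<Longrightarrow> \<sigma> (phi e) \<in> carrier G \<Longrightarrow> \<xi> e \<in> mcarrier F \<Longrightarrow> P" for x P
    using that unfolding A_def by (auto simp: prod_mfd_simps phi_closed \<sigma>(1) \<xi>(1))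
  have Xfst: "mreg b X E fst x" and Xsnd: "mreg b X MG snd x" if "x \<in> A" for x b
    using that wmfds by (auto simp: A_def intro: mreg_fst mreg_snd)
  have Xphi: "mreg b X M (\<lambda>x. phi (fst x)) x" if "x \<in> A" for x b
    by (rule mreg_phi[OF Xfst[OF that] wmfds(6)])
  have XpiM: "mreg b X B (\<lambda>x. piM (phi (fst x))) x" if "x \<in> A" for x b
    by (rule mreg_piM[OF Xphi[OF that] wmfds(6)])
  have Xsig: "mreg b X MG (\<lambda>x. \<sigma> (phi (fst x))) x" if x: "x \<in> A" for x b
  proof (rule mreg_compose[where f="\<lambda>x. phi (fst x)" and g=\<sigma>, OF Xphi[OF x] _ wmfds(6,3)])
    show "mreg b M MG \<sigma> (phi (fst x))" using x by (elim Acases) (simp add: \<sigma>(2))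
  qed
  have Xxi: "mreg b X F (\<lambda>x. \<xi> (fst x)) x" if x: "x \<in> A" for x b
  proof (rule mreg_compose[where f=fst and g=\<xi>, OF Xfst[OF x] _ wmfds(6,2)])
    show "mreg b E F \<xi> (fst x)" using x by (elim Acases) (simp add: \<xi>(2))
  qed
  have freg: "mreg b X W f x" if x: "x \<in> A" for x b
    unfolding f_def
    by (intro mreg_Pair mreg_actF mreg_mult mreg_inv XpiM Xxi Xsig Xsnd x wmfds)
  have inv1: "cact g x \<in> A" "f (cact g x) = f x" if g: "g \<in> carrier G" and x: "x \<in> A" for g x
  proof -
    obtain e w where e: "x = (e, w)" "e \<in> mcarrier E" "w \<in> carrier G" "phi e \<in> U"
      "phi e \<in> mcarrier M" "piM (phi e) \<in> V" "\<sigma> (phi e) \<in> carrier G" "\<xi> e \<in> mcarrier F"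
      using x by (rule Acases)
    have "piM (actM g (phi e)) = piM (phi e)" using g e by (simp add: aM.orbit_act)
    then show "cact g x \<in> A"
      using g e U(3) by (simp add: A_def conj_act_def prod_mfd_simps aE.act_closed phi_act)
    have "inv (g \<otimes> \<sigma> (phi e)) \<otimes> (g \<otimes> w \<otimes> inv g) \<otimes> (g \<otimes> \<sigma> (phi e)) = inv (\<sigma> (phi e)) \<otimes> w \<otimes> \<sigma> (phi e)"
      using g e by (simp add: m_assoc inv_mult_group inv_cancel)
    moreover have "actF (actF (\<xi> e) (inv g)) (g \<otimes> \<sigma> (phi e)) = actF (\<xi> e) (\<sigma> (phi e))"
      using g e by (simp add: actF_props inv_cancel)
    ultimately show "f (cact g x) = f x"
      using g e by (simp add: f_def conj_act_def phi_act aM.orbit_act \<sigma>(3) \<xi>(3))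
  qed
  have inj: "piQ x = piQ y" if x: "x \<in> A" and y: "y \<in> A" and eq: "f x = f y" for x y
  proof -
    obtain e w where e: "x = (e, w)" "e \<in> mcarrier E" "w \<in> carrier G" "phi e \<in> U"
      "phi e \<in> mcarrier M" "piM (phi e) \<in> V" "\<sigma> (phi e) \<in> carrier G" "\<xi> e \<in> mcarrier F"
      using x by (rule Acases)
    obtain e' w' where e': "y = (e', w')" "e' \<in> mcarrier E" "w' \<in> carrier G" "phi e' \<in> U"
      "phi e' \<in> mcarrier M" "piM (phi e') \<in> V" "\<sigma> (phi e') \<in> carrier G" "\<xi> e' \<in> mcarrier F"
      using y by (rule Acases)
    let ?h = "\<sigma> (phi e)" and ?h' = "\<sigma> (phi e')"
    define k where "k = ?h' \<otimes> inv ?h"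
    have k: "k \<in> carrier G" using e e' by (simp add: k_def)
    have kh: "k \<otimes> ?h = ?h'" using e e' by (simp add: k_def m_assoc)
    have ik: "inv k = ?h \<otimes> inv ?h'" using e e' by (simp add: k_def inv_mult_group)
    have eqs: "piM (phi e) = piM (phi e')" "actF (\<xi> e) ?h = actF (\<xi> e') ?h'"
        "inv ?h \<otimes> w \<otimes> ?h = inv ?h' \<otimes> w' \<otimes> ?h'"
      using eq by (simp_all add: f_def e e')
    have "actM k (phi e) = \<tau> (piM (actM k (phi e)), \<sigma> (actM k (phi e)))"
      using k e by (intro \<tau>(1)[symmetric]) (simp_all add: aM.act_closed aM.orbit_act)
    also have "\<dots> = \<tau> (piM (phi e'), ?h')" using k e eqs by (simp add: aM.orbit_act \<sigma>(3) kh)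
    also have "\<dots> = phi e'" using e' by (intro \<tau>(1))
    finally have m: "actM k (phi e) = phi e'" .
    have "actF (actF (\<xi> e) ?h) (inv ?h') = actF (actF (\<xi> e') ?h') (inv ?h')" using eqs by simp
    then have x: "\<xi> (actE k e) = \<xi> e'" using e e' k by (simp add: actF_props \<xi>(3) ik)
    have "actE k e = \<epsilon> (phi (actE k e), \<xi> (actE k e))"
      using k e e' m by (intro \<epsilon>(1)[symmetric]) (simp_all add: aE.act_closed phi_act)
    also have "\<dots> = e'" using k e e' m x by (simp add: phi_act \<epsilon>(1))
    finally have E: "actE k e = e'" .
    have "w' = ?h' \<otimes> (inv ?h' \<otimes> w' \<otimes> ?h') \<otimes> inv ?h'" using e' by (simp add: m_assoc inv_cancel)
    also have "\<dots> = k \<otimes> w \<otimes> inv k" unfolding eqs(3)[symmetric] ik using e e' by (simp add: m_assoc k_def)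
    finally have "y = cact k x" using E by (simp add: e e' conj_act_def)
    moreover have "x \<in> mcarrier X" using that(1) by (simp add: A_def)
    ultimately show ?thesis using aX.orbit_act[OF k] by simp
  qed
  have VB: "V \<subseteq> mcarrier B" using V(1) openin_iff_mnhds[OF pmfds(5)] by auto
  have sec: "\<exists>s. (\<forall>b. mreg b W X s (f x)) \<and> s (f x) = x \<and>
       eventually (\<lambda>z. s z \<in> A \<and> f (s z) = z) (mnhds W (f x))" if x: "x \<in> A" for x
  proof -
    obtain e w where e: "x = (e, w)" "e \<in> mcarrier E" "w \<in> carrier G" "phi e \<in> U"
      "phi e \<in> mcarrier M" "piM (phi e) \<in> V" "\<sigma> (phi e) \<in> carrier G" "\<xi> e \<in> mcarrier F"
      using x by (rule Acases)
    define g where "g = \<sigma> (phi e)"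
    have g: "g \<in> carrier G" using e by (simp add: g_def)
    have fx: "f x = (piM (phi e), (actF (\<xi> e) g, inv g \<otimes> w \<otimes> g))" by (simp add: f_def e g_def)
    have fW: "f x \<in> mcarrier W" using freg[OF x] by (rule mregD(2))
    define t where "t z = \<tau> (fst z, g)" for z :: "'b set \<times> 'c \<times> 'g"
    define s where "s z = (\<epsilon> (t z, actF (fst (snd z)) (inv g)), g \<otimes> snd (snd z) \<otimes> inv g)" for z
    have tfx: "t (f x) = phi e" unfolding t_def fx fst_conv g_def using e by (intro \<tau>(1))
    have wFG: "wmfd (prod_mfd F MG)" "wmfd (prod_mfd B MG)" "wmfd (prod_mfd M F)" by (intro wmfd_prod wmfds)+
    have 1: "mreg b W B fst (f x)" for b by (rule mreg_fst[OF wmfds(5) wFG(1) fW])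
    have 2: "mreg b W (prod_mfd F MG) snd (f x)" for b by (rule mreg_snd[OF wmfds(5) wFG(1) fW])
    have 3: "mreg b W F (\<lambda>z. fst (snd z)) (f x)" for b
      by (rule mreg_compose[where f=snd and g=fst, OF 2 mreg_fst[OF wmfds(4,1) mregD(2)[OF 2[of True]]] wmfds(7) wFG(1)])
    have 4: "mreg b W MG (\<lambda>z. snd (snd z)) (f x)" for b
      by (rule mreg_compose[where f=snd and g=snd, OF 2 mreg_snd[OF wmfds(4,1) mregD(2)[OF 2[of True]]] wmfds(7) wFG(1)])
    have cst: "mreg b W MG (\<lambda>_. h) (f x)" if "h \<in> carrier G" for h b
      using that fW by (intro mreg_const wmfds) simp_all
    have t: "mreg b W M t (f x)" for b
      unfolding t_def
      by (rule mreg_compose[where f="\<lambda>z. (fst z, g)" and g=\<tau>, OF mreg_Pair[OF 1 cst[OF g]] \<tau>(3)[OF _ g] wmfds(7) wFG(2)])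
         (simp add: fx e(6))
    have a: "mreg b W F (\<lambda>z. actF (fst (snd z)) (inv g)) (f x)" for b
      using g by (intro mreg_actF 3 cst wmfds) simp
    have afx: "actF (fst (snd (f x))) (inv g) = \<xi> e" unfolding fx using e g by (simp add: actF_props)
    have ee: "mreg b W E (\<lambda>z. \<epsilon> (t z, actF (fst (snd z)) (inv g))) (f x)" for b
      by (rule mreg_compose[where f="\<lambda>z. (t z, actF (fst (snd z)) (inv g))" and g=\<epsilon>, OF mreg_Pair[OF t a] \<epsilon>(3) wmfds(7) wFG(3)])
         (simp_all add: tfx afx e(2-8))
    have sreg: "mreg b W X s (f x)" for b
      unfolding s_def using g by (intro mreg_Pair ee mreg_mult cst 4 wmfds) simp_all
    have sfx: "s (f x) = x"
    proof -
      have "snd (snd (f x)) = inv g \<otimes> w \<otimes> g" by (simp add: fx)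
      then show ?thesis
        unfolding s_def tfx afx using e(2-8) g by (simp add: e(1) \<epsilon>(1) m_assoc inv_cancel)
    qed
    have "eventually (\<lambda>z. fst z \<in> V) (mnhds W (f x))"
      by (rule mreg_eventually_in[OF 1[of True] wmfds(7) pmfds(5) V(1)]) (simp add: fx e(6))
    moreover have "eventually (\<lambda>z. t z \<in> U) (mnhds W (f x))"
      by (rule mreg_eventually_in[OF t[of True] wmfds(7) pmfds(3) U(1)]) (simp add: tfx e(2-8))
    moreover have "eventually (\<lambda>z. z \<in> mcarrier W) (mnhds W (f x))"
      by (rule eventually_mnhds_carrier[OF wmfds(7) fW])
    ultimately have "eventually (\<lambda>z. s z \<in> A \<and> f (s z) = z) (mnhds W (f x))"
    proof eventually_elim
      case (elim z)
      obtain v p q where z: "z = (v, (p, q))" by (metis prod.collapse)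
      have zc: "v \<in> V" "p \<in> mcarrier F" "q \<in> carrier G" "\<tau> (v, g) \<in> U"
        using elim by (auto simp: z prod_mfd_simps t_def)
      have T: "\<tau> (v, g) \<in> mcarrier M" "piM (\<tau> (v, g)) = v" "\<sigma> (\<tau> (v, g)) = g" using \<tau>(2)[OF zc(1) g] by auto
      have pF: "actF p (inv g) \<in> mcarrier F" using zc g by (simp add: actF_props)
      have EE: "\<epsilon> (\<tau> (v, g), actF p (inv g)) \<in> mcarrier E" "phi (\<epsilon> (\<tau> (v, g), actF p (inv g))) = \<tau> (v, g)"
          "\<xi> (\<epsilon> (\<tau> (v, g), actF p (inv g))) = actF p (inv g)"
        using \<epsilon>(2)[OF zc(4) pF] by auto
      have sz: "s z = (\<epsilon> (\<tau> (v, g), actF p (inv g)), g \<otimes> q \<otimes> inv g)" by (simp add: s_def z t_def)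
      have "s z \<in> A" unfolding sz A_def using EE T zc g by (simp add: prod_mfd_simps)
      moreover have "f (s z) = (v, (actF (actF p (inv g)) g, inv g \<otimes> (g \<otimes> q \<otimes> inv g) \<otimes> g))"
        unfolding sz by (simp only: f_def fst_conv snd_conv EE T)
      then have "f (s z) = z" unfolding z using zc g by (simp add: actF_props m_assoc inv_cancel)
      ultimately show ?case by simp
    qed
    then show ?thesis using sreg sfx by (intro exI[of _ s]) simp
  qed
  have Aopen: "openin (mtopology X) A"
    unfolding openin_iff_mnhds[OF pmfds(6)]
  proof (intro conjI ballI)
    show "A \<subseteq> mcarrier X" by (auto simp: A_def)
    fix x assume x: "x \<in> A"
    have "eventually (\<lambda>x. phi (fst x) \<in> U) (mnhds X x)"
      by (rule mreg_eventually_in[OF Xphi[OF x, of True] wmfds(6) pmfds(3) U(1)]) (use x in \<open>simp add: A_def\<close>)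
    moreover have "eventually (\<lambda>x. piM (phi (fst x)) \<in> V) (mnhds X x)"
      by (rule mreg_eventually_in[OF XpiM[OF x, of True] wmfds(6) pmfds(5) V(1)]) (use x in \<open>simp add: A_def\<close>)
    moreover have "eventually (\<lambda>x. x \<in> mcarrier X) (mnhds X x)"
      by (rule eventually_mnhds_carrier[OF wmfds(6)]) (use x in \<open>simp add: A_def\<close>)
    ultimately show "eventually (\<lambda>x. x \<in> A) (mnhds X x)"
      by eventually_elim (simp add: A_def)
  qed
  have x0A: "x0 \<in> A" using x0 U(2) V(2) by (simp add: A_def)
  show thesis by (rule that[OF Aopen x0A inv1 freg inj sec])
qed

lemma dim_triv:
  assumes x0: "x0 \<in> mcarrier X"
  shows "dim (mmodel W) = dim (quot_model MG X)"
proof -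
  obtain e w where e: "e \<in> mcarrier E" using x0 by (elim X_cases)
  have m0: "phi e \<in> mcarrier M" using e by (rule phi_closed)
  have subs: "subspace (mmodel MG)" "subspace (mmodel E)" "subspace (mmodel F)" "subspace (mmodel B)"
    using wmfds by (simp_all add: wmfdD)
  obtain V \<sigma> \<tau> where V: "local_triv M B MG piM V \<sigma> \<tau>" "piM (phi e) \<in> V"
    by (rule principal_triv[OF m0]) (rule that; assumption)
  obtain U \<xi> \<epsilon> where U: "local_triv E M F phi U \<xi> \<epsilon>" "phi e \<in> U"
    by (rule bundle_triv[OF m0]) (rule that; assumption)
  have "dim (mmodel M) = dim (mmodel B) + dim (mmodel MG)"
    by (rule local_triv_dim[OF V(1) pmfds(3,5,1) regs(2)[OF m0] V(2)])
  moreover have "dim (mmodel E) = dim (mmodel M) + dim (mmodel F)"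
    by (rule local_triv_dim[OF U(1) pmfds(2,3,4) regs(1)[OF e] U(2)])
  moreover have "dim (mmodel X) = dim (mmodel E) + dim (mmodel MG)"
    using dim_Times[OF subs(2,1)] by (simp add: prod_mfd_simps)
  moreover have "dim (mmodel W) = dim (mmodel B) + (dim (mmodel F) + dim (mmodel MG))"
    using dim_Times[OF subs(4) subspace_Times[OF subs(3,1)]] dim_Times[OF subs(3,1)] by (simp add: prod_mfd_simps)
  ultimately show ?thesis using quot_model_props(3)[of X MG] wmfds(6) by (simp add: wmfdD)
qed


lemma quot_chart_exists:
  assumes x0: "x0 \<in> mcarrier X"
  shows "\<exists>c. c \<in> quot_atlas G MG X cact \<and> piQ x0 \<in> fst c"
proof -
  obtain A f where A: "openin (mtopology X) A" "x0 \<in> A"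
    "\<And>g x. g \<in> carrier G \<Longrightarrow> x \<in> A \<Longrightarrow> cact g x \<in> A"
    and f: "\<And>g x. g \<in> carrier G \<Longrightarrow> x \<in> A \<Longrightarrow> f (cact g x) = f x"
      "\<And>x b. x \<in> A \<Longrightarrow> mreg b X W f x"
      "\<And>x y. x \<in> A \<Longrightarrow> y \<in> A \<Longrightarrow> f x = f y \<Longrightarrow> piQ x = piQ y"
      "\<And>x. x \<in> A \<Longrightarrow> \<exists>s. (\<forall>b. mreg b W X s (f x)) \<and> s (f x) = x \<and>
         eventually (\<lambda>z. s z \<in> A \<and> f (s z) = z) (mnhds W (f x))"
    by (rule Q_triv[OF x0]) (rule that; assumption)
  let ?c = "mpref W (f x0)" and ?V = "quot_model MG X"
  let ?N = "linear_mfd ?V"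
  have z0: "f x0 \<in> mcarrier W" by (rule mregD(2)[OF f(2)[OF A(2)]])
  have c: "?c \<in> matlas W" by (rule pmfd_pref[OF pmfds(7) z0])
  have x0c: "f x0 \<in> fst ?c" using wmfds(7) z0 by (rule wmfdD(2))
  note C = pmfdD[OF pmfds(7) c]
  have subW: "subspace (mmodel W)" and subX: "subspace (mmodel X)" using wmfds by (simp_all only: wmfdD(1))
  note V = quot_model_props[OF subX, of MG]
  have pN: "pmfd ?N" by (rule pmfd_linear[OF V(1)])
  have wN: "wmfd ?N" by (rule pmfd_wmfd[OF pN])
  obtain T T' where T: "linear T" "linear T'" "T ` mmodel W = ?V" "T' ` ?V = mmodel W"
     "\<And>x. x \<in> mmodel W \<Longrightarrow> T' (T x) = x" "\<And>x. x \<in> ?V \<Longrightarrow> T (T' x) = x"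
    using isometries_subspaces[OF subW V(1) dim_triv[OF x0]] by metis
  have bT: "bounded_linear T" "bounded_linear T'" using T(1,2) linear_conv_bounded_linear by auto
  define A' where "A' = {x \<in> A. f x \<in> fst ?c}"
  define \<psi> where "\<psi> r = T (snd ?c (f (SOME x. x \<in> A' \<and> piQ x = r)))" for r
  have AX: "A \<subseteq> mcarrier X" using A(1) openin_iff_mnhds[OF pmfds(6)] by auto
  have A'X: "x \<in> mcarrier X" and A'A: "x \<in> A" if "x \<in> A'" for x using that AX by (auto simp: A'_def)
  have \<psi>: "\<psi> (piQ x) = T (snd ?c (f x))" if x: "x \<in> A'" for x
  proof -
    define y where "y = (SOME y. y \<in> A' \<and> piQ y = piQ x)"
    have y: "y \<in> A' \<and> piQ y = piQ x" unfolding y_def by (rule someI[of _ x]) (simp add: x)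
    then obtain g where "g \<in> carrier G" "y = cact g x" using aX.orbit_eqD[of x y] A'X by auto
    then have "f y = f x" using f(1) A'A[OF x] by simp
    then show ?thesis unfolding \<psi>_def y_def[symmetric] by simp
  qed
  have inv: "x \<in> A'" if x: "x \<in> mcarrier X" "piQ x \<in> piQ ` A'" for x
  proof -
    obtain y where y: "y \<in> A'" "piQ x = piQ y" using x by auto
    then obtain g where "g \<in> carrier G" "x = cact g y" using aX.orbit_eqD[of y x] x by metis
    then show ?thesis using y(1) A(3) f(1) by (simp add: A'_def)
  qed
  have A'open: "openin (mtopology X) A'"
    unfolding openin_iff_mnhds[OF pmfds(6)]
  proof (intro conjI ballI)
    show "A' \<subseteq> mcarrier X" using A'X by auto
    fix x assume x: "x \<in> A'"
    have "eventually (\<lambda>x. f x \<in> fst ?c) (mnhds X x)"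
      by (rule mreg_eventually_in[OF f(2)[OF A'A[OF x], of True] wmfds(6) pmfds(7) chart_dom_openin[OF pmfds(7) c]])
         (use x in \<open>simp add: A'_def\<close>)
    with eventually_mnhds_openin[OF pmfds(6) A(1) A'A[OF x]]
    show "eventually (\<lambda>x. x \<in> A') (mnhds X x)" by eventually_elim (simp add: A'_def)
  qed
  let ?h = "\<lambda>x. \<psi> (piQ x)"
  have Vh: "T (snd ?c (f x)) \<in> ?V" if "x \<in> A'" for x
    using that C(5)[of "f x"] T(3) by (auto simp: A'_def)
  have hreg: "mreg b X ?N ?h x" if x: "x \<in> A'" for x b
  proof -
    have fc: "f x \<in> fst ?c" using x by (simp add: A'_def)
    have "mreg b X (linear_mfd (mmodel W)) (\<lambda>x. snd ?c (f x)) x"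
      by (rule mreg_compose[where f=f and g="snd ?c", OF f(2)[OF A'A[OF x]] mreg_chart[OF pmfds(7) c fc] wmfds(6,7)])
    moreover have "mreg b (linear_mfd (mmodel W)) ?N T (snd ?c (f x))"
      by (rule mreg_linear_map[OF subW V(1) bT(1)]) (use T(3) C(5)[OF fc] in auto)
    ultimately have "mreg b X ?N (\<lambda>x. T (snd ?c (f x))) x"
      by (rule mreg_compose[where f="\<lambda>x. snd ?c (f x)" and g=T, OF _ _ wmfds(6) pmfd_wmfd[OF pmfd_linear[OF subW]]])
    moreover have "eventually (\<lambda>x. T (snd ?c (f x)) = ?h x) (mnhds X x)"
      using eventually_mnhds_openin[OF pmfds(6) A'open x] by eventually_elim (simp add: \<psi>)
    ultimately show ?thesis by (rule mreg_cong[where f="\<lambda>x. T (snd ?c (f x))", OF _ wmfds(6)])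
  qed
  have sec: "\<exists>q. mreg True ?N X q (?h x) \<and> q (?h x) = x \<and>
      eventually (\<lambda>u. q u \<in> A' \<and> ?h (q u) = u) (mnhds ?N (?h x))" if x: "x \<in> A'" for x
  proof -
    have fc: "f x \<in> fst ?c" using x by (simp add: A'_def)
    have hx: "?h x = T (snd ?c (f x))" by (rule \<psi>[OF x])
    have hV: "?h x \<in> ?V" unfolding hx by (rule Vh[OF x])
    obtain s where s: "\<forall>b. mreg b W X s (f x)" "s (f x) = x"
       "eventually (\<lambda>z. s z \<in> A \<and> f (s z) = z) (mnhds W (f x))"
      using f(4)[OF A'A[OF x]] by auto
    define k where "k u = inv_into (fst ?c) (snd ?c) (T' u)" for u
    have T'h: "T' (?h x) = snd ?c (f x)" unfolding hx by (rule T(5)[OF C(5)[OF fc]])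
    have kh: "k (?h x) = f x" unfolding k_def T'h by (rule C(6)[OF fc])
    have kreg: "mreg True ?N W k (?h x)"
      unfolding k_def
      by (rule mreg_chart_inv[OF pmfds(7) c V(1) hV bT(2)]) (use T(4) fc in \<open>auto simp: T'h\<close>)
    have sreg: "mreg True W X s (k (?h x))" using s(1) kh by simp
    have "eventually (\<lambda>u. s (k u) \<in> A \<and> f (s (k u)) = k u) (mnhds ?N (?h x))"
      by (rule mreg_eventually[OF kreg wN wmfds(7)]) (use s(3) kh in simp)
    moreover have "eventually (\<lambda>u. k u \<in> fst ?c) (mnhds ?N (?h x))"
      by (rule mreg_eventually_in[OF kreg wN pmfds(7) chart_dom_openin[OF pmfds(7) c]]) (simp only: kh fc)
    moreover have "eventually (\<lambda>u. T' u \<in> snd ?c ` fst ?c) (mnhds ?N (?h x))"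
      unfolding eventually_linear_mfd[OF hV]
    proof (rule eventually_compose_filterlim[OF eventually_rnhds_openin[OF C(3) imageI[OF fc]]])
      have "filterlim T' (rnhds (mmodel W) (T' (?h x))) (rnhds ?V (?h x))"
        by (rule filterlim_rnhds[OF linear_continuous_within[OF bT(2)] _ hV])
           (rule eventually_mono[OF eventually_rnhds_in], use T(4) in auto)
      then show "filterlim T' (rnhds (mmodel W) (snd ?c (f x))) (rnhds ?V (?h x))" by (simp only: T'h)
    qed
    moreover have "eventually (\<lambda>u. u \<in> ?V) (mnhds ?N (?h x))"
      using eventually_mnhds_carrier[OF wN, of "?h x"] hV by simp
    ultimately have "eventually (\<lambda>u. s (k u) \<in> A' \<and> ?h (s (k u)) = u) (mnhds ?N (?h x))"
    proof eventually_elim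
      case (elim u)
      then have sA: "s (k u) \<in> A'" by (simp add: A'_def)
      have "?h (s (k u)) = T (snd ?c (k u))" using \<psi>[OF sA] elim by simp
      also have "\<dots> = T (T' u)" unfolding k_def using elim by (simp only: f_inv_into_f)
      also have "\<dots> = u" using elim by (simp only: T(6))
      finally show ?case using sA by simp
    qed
    moreover have "mreg True ?N X (\<lambda>u. s (k u)) (?h x)"
      by (rule mreg_compose[where f=k and g=s, OF kreg sreg wN wmfds(7)])
    ultimately show ?thesis using s(2) kh by (intro exI[of _ "\<lambda>u. s (k u)"]) simp
  qed
  have "(piQ ` A', \<psi>) \<in> quot_atlas G MG X cact"
  proof -
    have pre: "{x \<in> mcarrier X. piQ x \<in> piQ ` A'} = A'" using inv A'X by auto
    have "openin (top_of_set ?V) (\<psi> ` piQ ` A')"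
      unfolding openin_iff_rnhds
    proof (intro conjI ballI)
      show "\<psi> ` piQ ` A' \<subseteq> ?V" using \<psi> Vh by auto
      fix u assume "u \<in> \<psi> ` piQ ` A'"
      then obtain x where x: "x \<in> A'" "u = ?h x" by auto
      obtain q where "eventually (\<lambda>u. q u \<in> A' \<and> ?h (q u) = u) (mnhds ?N u)" using sec[OF x(1)] x(2) by auto
      moreover have "u \<in> ?V" using x \<psi> Vh by auto
      ultimately have "eventually (\<lambda>u. q u \<in> A' \<and> ?h (q u) = u) (rnhds ?V u)" by (simp only: eventually_linear_mfd)
      then show "eventually (\<lambda>u. u \<in> \<psi> ` piQ ` A') (rnhds ?V u)"
        by eventually_elim (metis imageI)
    qed
    moreover have "inj_on \<psi> (piQ ` A')"
    proof (rule inj_onI)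
      fix r r' assume "r \<in> piQ ` A'" "r' \<in> piQ ` A'" "\<psi> r = \<psi> r'"
      then obtain x y where xy: "x \<in> A'" "y \<in> A'" "r = piQ x" "r' = piQ y" "T (snd ?c (f x)) = T (snd ?c (f y))"
        using \<psi> by auto
      then have fc: "f x \<in> fst ?c" "f y \<in> fst ?c" by (simp_all add: A'_def)
      have "snd ?c (f x) = snd ?c (f y)" using xy(5) T(5)[OF C(5)[OF fc(1)]] T(5)[OF C(5)[OF fc(2)]] by metis
      then have "f x = f y" using C(2) fc by (simp add: inj_on_def)
      then show "r = r'" using f(3)[OF A'A[OF xy(1)] A'A[OF xy(2)]] xy by simp
    qed
    moreover have "msmooth X ?N A' ?h"
      by (rule msmoothI[OF pmfds(6) pN A'open hreg])
    moreover have "mdiff X ?N ?h x ` mmodel X = ?V" if x: "x \<in> A'" for x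
    proof
      show "mdiff X ?N ?h x ` mmodel X \<subseteq> ?V"
        using mdiff_in_model[OF hreg[OF x, of True] wmfds(6) wN] by auto
      obtain q where q: "mreg True ?N X q (?h x)" "q (?h x) = x"
        "eventually (\<lambda>u. q u \<in> A' \<and> ?h (q u) = u) (mnhds ?N (?h x))" using sec[OF x] by auto
      have hV: "?h x \<in> mcarrier ?N" by (rule mregD(2)[OF hreg[OF x, of True]])
      show "?V \<subseteq> mdiff X ?N ?h x ` mmodel X"
      proof
        fix v assume "v \<in> ?V"
        then have v: "v \<in> mmodel ?N" by simp
        have hq: "mreg True X ?N ?h (q (?h x))" using hreg[OF x] q(2) by simp
        have ev: "eventually (\<lambda>u. u = ?h (q u)) (mnhds ?N (?h x))" using q(3) by eventually_elim simp
        have "v = mdiff ?N ?N (\<lambda>u. u) (?h x) v" using mdiff_id[OF wN hV v] by simp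
        also have "\<dots> = mdiff ?N ?N (\<lambda>u. ?h (q u)) (?h x) v"
          by (rule mdiff_cong[OF mreg_id[OF wN hV, of True] wN ev v, symmetric])
        also have "\<dots> = mdiff X ?N ?h x (mdiff ?N X q (?h x) v)"
          using mdiff_compose[where f=q and g="?h", OF q(1) hq wN wmfds(6) v] q(2) by simp
        finally show "v \<in> mdiff X ?N ?h x ` mmodel X"
          using mdiff_in_model[OF q(1) wN wmfds(6) v] by (rule image_eqI)
      qed
    qed
    moreover have "piQ ` A' \<subseteq> orbits G (mcarrier X) cact" using A'X aX.orbit_in_orbits by auto
    ultimately show ?thesis
      unfolding quot_atlas_def Let_def mem_Collect_eq prod.case pre
      using A'open by (intro conjI ballI)
  qed
  moreover have "piQ x0 \<in> piQ ` A'" using A(2) x0c by (simp add: A'_def)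
  ultimately show ?thesis by (intro exI[of _ "(piQ ` A', \<psi>)"]) simp
qed

lemma Q_pref:
  assumes "r \<in> mcarrier Q"
  shows "mpref Q r \<in> quot_atlas G MG X cact" "r \<in> fst (mpref Q r)"
proof -
  obtain x where "x \<in> mcarrier X" "r = piQ x" using assms unfolding Q_simps by (rule aX.orbitsE)
  then have "\<exists>c. c \<in> quot_atlas G MG X cact \<and> r \<in> fst c" using quot_chart_exists by simp
  from someI_ex[OF this] show "mpref Q r \<in> quot_atlas G MG X cact" "r \<in> fst (mpref Q r)"
    by (simp_all add: conjugate_bundle_def quot_mfd_def)
qed

lemma quot_atlasD:
  assumes "c \<in> quot_atlas G MG X cact"
  shows "fst c \<subseteq> mcarrier Q" "inj_on (snd c) (fst c)" "openin (top_of_set (mmodel Q)) (snd c ` fst c)"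
    "openin (mtopology X) {x \<in> mcarrier X. piQ x \<in> fst c}"
    "msmooth X (linear_mfd (mmodel Q)) {x \<in> mcarrier X. piQ x \<in> fst c} (\<lambda>x. snd c (piQ x))"
    "\<And>x. x \<in> mcarrier X \<Longrightarrow> piQ x \<in> fst c \<Longrightarrow>
       mdiff X (linear_mfd (mmodel Q)) (\<lambda>x. snd c (piQ x)) x ` mmodel X = mmodel Q"
proof -
  obtain U \<psi> where c: "c = (U, \<psi>)" by (cases c)
  note D = assms[unfolded c quot_atlas_def Let_def mem_Collect_eq prod.case]
  note D2 = conjunct2[OF D] and D3 = conjunct2[OF conjunct2[OF D]]
  note D' = conjunct1[OF D2] conjunct1[OF D3] conjunct1[OF conjunct2[OF D3]]
    conjunct1[OF conjunct2[OF conjunct2[OF D3]]] conjunct2[OF conjunct2[OF conjunct2[OF D3]]]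
  show "fst c \<subseteq> mcarrier Q" "inj_on (snd c) (fst c)" "openin (top_of_set (mmodel Q)) (snd c ` fst c)"
    "openin (mtopology X) {x \<in> mcarrier X. piQ x \<in> fst c}"
    "msmooth X (linear_mfd (mmodel Q)) {x \<in> mcarrier X. piQ x \<in> fst c} (\<lambda>x. snd c (piQ x))"
    unfolding c fst_conv snd_conv Q_simps
    by (rule conjunct1[OF D] D'(1) D'(2) D'(3) D'(4))+
  have all: "\<forall>x\<in>{x \<in> mcarrier X. piQ x \<in> U}.
      mdiff X (linear_mfd (quot_model MG X)) (\<lambda>x. \<psi> (piQ x)) x ` mmodel X = quot_model MG X"
    by (rule D'(5))
  fix x assume "x \<in> mcarrier X" "piQ x \<in> fst c"
  then have "x \<in> {x \<in> mcarrier X. piQ x \<in> U}" by (simp add: c)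
  from bspec[OF all this] show "mdiff X (linear_mfd (mmodel Q)) (\<lambda>x. snd c (piQ x)) x ` mmodel X = mmodel Q"
    unfolding c fst_conv snd_conv Q_simps .
qed

lemma wmfd_Q: "wmfd Q"
  unfolding wmfd_def
proof (intro conjI ballI)
  show "subspace (mmodel Q)" unfolding Q_simps
    using quot_model_props(1)[of X MG] wmfds(6) by (simp add: wmfdD)
  fix r assume "r \<in> mcarrier Q"
  note P = Q_pref[OF this]
  show "r \<in> mdom Q r" "mdom Q r \<subseteq> mcarrier Q" "inj_on (mcoord Q r) (mdom Q r)"
    "openin (top_of_set (mmodel Q)) (mcoord Q r ` mdom Q r)"
    using P quot_atlasD[OF P(1)] by simp_all
qed

lemma piQ_in [simp]: "x \<in> mcarrier X \<Longrightarrow> piQ x \<in> mcarrier Q"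
  unfolding Q_simps by (rule aX.orbit_in_orbits)

lemma piQ_reg:
  assumes x: "x \<in> mcarrier X"
  shows "mreg b X Q piQ x" "mdiff X Q piQ x ` mmodel X = mmodel Q"
proof -
  let ?c = "mpref Q (piQ x)" and ?N = "linear_mfd (mmodel Q)"
  note P = Q_pref[OF piQ_in[OF x]]
  note D = quot_atlasD[OF P(1)]
  have pN: "pmfd ?N" using wmfd_Q by (simp add: wmfdD pmfd_linear)
  let ?A = "{x \<in> mcarrier X. piQ x \<in> fst ?c}"
  have xA: "x \<in> ?A" using x P by simp
  have ev: "eventually (\<lambda>x. x \<in> ?A) (mnhds X x)" by (rule eventually_mnhds_openin[OF pmfds(6) D(4) xA])
  have r: "mreg b X ?N (\<lambda>x. snd ?c (piQ x)) x" by (rule msmooth_mreg[OF pmfds(6) pN D(5) xA ev])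
  have rep: "mrep X Q piQ x = mrep X ?N (\<lambda>x. snd ?c (piQ x)) x" by (auto simp: chart_rep_def fun_eq_iff)
  have "eventually (\<lambda>y. piQ y \<in> fst ?c) (mnhds X x)" using ev by eventually_elim simp
  then show "mreg b X Q piQ x" using mregD(4)[OF r] x by (simp add: mreg_def rep)
  show "mdiff X Q piQ x ` mmodel X = mmodel Q"
    using D(6)[OF x P(2)] by (simp add: mdiff_def rep)
qed

lemma Q_section:
  assumes x: "x \<in> mcarrier X"
  shows "\<exists>s. mreg False Q X s (piQ x) \<and> s (piQ x) = x \<and> eventually (\<lambda>r. piQ (s r) = r) (mnhds Q (piQ x))"
proof -
  obtain A f where A: "openin (mtopology X) A" "x \<in> A"
    "\<And>g x. g \<in> carrier G \<Longrightarrow> x \<in> A \<Longrightarrow> cact g x \<in> A"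
    and f: "\<And>g x. g \<in> carrier G \<Longrightarrow> x \<in> A \<Longrightarrow> f (cact g x) = f x"
      "\<And>x b. x \<in> A \<Longrightarrow> mreg b X W f x"
      "\<And>x y. x \<in> A \<Longrightarrow> y \<in> A \<Longrightarrow> f x = f y \<Longrightarrow> piQ x = piQ y"
      "\<And>x. x \<in> A \<Longrightarrow> \<exists>s. (\<forall>b. mreg b W X s (f x)) \<and> s (f x) = x \<and>
         eventually (\<lambda>z. s z \<in> A \<and> f (s z) = z) (mnhds W (f x))"
    by (rule Q_triv[OF x]) (rule that; assumption)
  obtain s where s: "\<forall>b. mreg b W X s (f x)" "s (f x) = x"
     "eventually (\<lambda>z. s z \<in> A \<and> f (s z) = z) (mnhds W (f x))"
    using f(4)[OF A(2)] by auto
  have AX: "A \<subseteq> mcarrier X" using A(1) openin_iff_mnhds[OF pmfds(6)] by auto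
  let ?r = "piQ x" and ?z = "f x"
  let ?c = "mpref Q ?r" and ?d = "mpref W ?z"
  let ?k = "\<lambda>z. piQ (s z)"
  have z: "?z \<in> mcarrier W" by (rule mregD(2)[OF f(2)[OF A(2)]])
  have r: "?r \<in> mcarrier Q" using x by simp
  have fr: "mreg True X W f x" by (rule f(2)[OF A(2)])
  have sr: "mreg True W X s ?z" using s(1) by simp
  have pr: "mreg True X Q piQ (s ?z)" using piQ_reg(1)[OF x] s(2) by simp
  have kr: "mreg True W Q ?k ?z" by (rule mreg_compose[where f=s and g=piQ, OF sr pr wmfds(7,6)])
  have kz: "?k ?z = ?r" using s(2) by simp
  define F where "F r = f (SOME y. y \<in> A \<and> piQ y = r)" for r
  have F: "F (piQ y) = f y" if y: "y \<in> A" for y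
  proof -
    define y' where "y' = (SOME y'. y' \<in> A \<and> piQ y' = piQ y)"
    have y': "y' \<in> A \<and> piQ y' = piQ y" unfolding y'_def by (rule someI[of _ y]) (simp add: y)
    then obtain g where "g \<in> carrier G" "y' = cact g y" using aX.orbit_eqD[of y y'] AX by auto
    then have "f y' = f y" using f(1) y by simp
    then show ?thesis unfolding F_def y'_def[symmetric] .
  qed
  have bz: "snd ?d ?z \<in> mmodel W" using wmfds(7) z by (rule wmfdD(9))
  obtain S1 where S1: "openin (top_of_set (mmodel W)) S1" "snd ?d ?z \<in> S1" "\<forall>k. Ck_on (mmodel W) k S1 (mrep W Q ?k ?z)"
    using mregD(4)[OF kr] by (auto simp: creg_def)
  have "eventually (\<lambda>u. u \<in> S1 \<and> u \<in> snd ?d ` fst ?d \<and>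
      (s (mpar W ?z u) \<in> A \<and> f (s (mpar W ?z u)) = mpar W ?z u) \<and> ?k (mpar W ?z u) \<in> fst ?c)
      (rnhds (mmodel W) (snd ?d ?z))"
    using eventually_rnhds_openin[OF S1(1,2)] eventually_rnhds_chart[OF wmfds(7) z]
      s(3)[unfolded eventually_mnhds] mregD(3)[OF kr, unfolded eventually_mnhds kz]
    by eventually_elim simp
  then obtain S where S: "openin (top_of_set (mmodel W)) S" "snd ?d ?z \<in> S" and S': "\<forall>u\<in>S. u \<in> S1 \<and> u \<in> snd ?d ` fst ?d \<and>
      (s (mpar W ?z u) \<in> A \<and> f (s (mpar W ?z u)) = mpar W ?z u) \<and> ?k (mpar W ?z u) \<in> fst ?c"
    unfolding eventually_rnhds[OF bz] by (elim exE conjE) (rule that)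
  let ?\<kappa> = "mrep W Q ?k ?z"
  let ?g = "\<lambda>v. snd ?d (F (mpar Q ?r v))"
  have \<kappa>: "?\<kappa> u = snd ?c (?k (mpar W ?z u))" for u by (simp add: chart_rep_def s(2))
  have base: "?\<kappa> (snd ?d ?z) = snd ?c ?r" using mrep_base[OF wmfds(7) z, of Q ?k] by (simp add: s(2))
  have Fk: "F (?k (mpar W ?z u)) = mpar W ?z u" if "u \<in> S" for u
    using F S' that by simp
  have par\<kappa>: "mpar Q ?r (?\<kappa> u) = ?k (mpar W ?z u)" if "u \<in> S" for u
    unfolding \<kappa> using S' that by (intro wmfdD(8)[OF wmfd_Q r]) simp
  have ginv: "?g (?\<kappa> u) = u" if u: "u \<in> S" for u
    unfolding par\<kappa>[OF u] Fk[OF u] using S' u by (simp add: f_inv_into_f)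
  have subW: "subspace (mmodel W)" and subQ: "subspace (mmodel Q)" using wmfds(7) wmfd_Q by (simp_all only: wmfdD(1))
  have dims: "dim (mmodel W) = dim (mmodel Q)" unfolding Q_simps by (rule dim_triv[OF x])
  have cont: "continuous_on S ?\<kappa>"
  proof -
    have "S \<subseteq> S1" using S' by auto
    then show ?thesis by (rule continuous_on_subset[OF Ck_on_continuous[OF S1(3)[rule_format, of 0]]])
  qed
  have imV: "?\<kappa> ` S \<subseteq> mmodel Q" using S' wmfdD(6)[OF wmfd_Q r] by (auto simp: \<kappa>)
  note der = mreg_has_derivative[OF kr]
  have surj: "mdiff W Q ?k ?z ` mmodel W = mmodel Q"
  proof
    show "mdiff W Q ?k ?z ` mmodel W \<subseteq> mmodel Q" using mdiff_in_model[OF kr wmfds(7) wmfd_Q] by auto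
    show "mmodel Q \<subseteq> mdiff W Q ?k ?z ` mmodel W"
    proof
      fix v assume "v \<in> mmodel Q"
      then have "v \<in> mdiff X Q piQ x ` mmodel X" by (simp only: piQ_reg(2)[OF x])
      then obtain w where w: "w \<in> mmodel X" "v = mdiff X Q piQ x w" by (elim imageE)
      have "eventually (\<lambda>y. s (f y) \<in> A \<and> f (s (f y)) = f y) (mnhds X x)"
        by (rule mreg_eventually[OF fr wmfds(6,7) s(3)])
      with eventually_mnhds_openin[OF pmfds(6) A(1,2)]
      have ev: "eventually (\<lambda>y. piQ y = ?k (f y)) (mnhds X x)"
        by eventually_elim (rule f(3)[symmetric], auto)
      have "mdiff X Q piQ x w = mdiff X Q (\<lambda>y. ?k (f y)) x w"
        by (rule mdiff_cong[OF piQ_reg(1)[OF x, of True] wmfds(6) ev w(1), symmetric])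
      also have "\<dots> = mdiff W Q ?k ?z (mdiff X W f x w)"
        by (rule mdiff_compose[where f=f and g="?k", OF fr kr wmfds(6,7) w(1)])
      finally show "v \<in> mdiff W Q ?k ?z ` mmodel W"
        using mdiff_in_model[OF fr wmfds(6,7) w(1)] w(2) by auto
    qed
  qed
  have inverse: "?g differentiable (at (?\<kappa> (snd ?d ?z)) within mmodel Q)"
      "eventually (\<lambda>v. v \<in> ?\<kappa> ` S) (rnhds (mmodel Q) (?\<kappa> (snd ?d ?z)))"
    by (rule inverse_differentiable_subspace[where g="?g", OF subW subQ dims S(1) cont imV _ S(2) der surj],
      erule ginv)+
  have near: "eventually (\<lambda>q. \<exists>u\<in>S. q = ?k (mpar W ?z u)) (mnhds Q ?r)"
    unfolding eventually_mnhds using inverse(2)[unfolded base]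
  proof eventually_elim
    case (elim v)
    then obtain u where "u \<in> S" "v = ?\<kappa> u" by auto
    then show ?case using par\<kappa> by auto
  qed
  have Fr: "F ?r = ?z" by (rule F[OF A(2)])
  have Freg: "mreg False Q W F ?r"
    unfolding mreg_def Fr
  proof (intro conjI)
    show "eventually (\<lambda>q. F q \<in> fst ?d) (mnhds Q ?r)"
      using near
    proof eventually_elim
      case (elim q)
      then obtain u where u: "u \<in> S" "q = ?k (mpar W ?z u)" by auto
      then have "u \<in> snd ?d ` fst ?d" using S' by simp
      then show ?case unfolding u(2) Fk[OF u(1)] by (rule inv_into_into)
    qed
    have "mrep Q W F ?r = ?g" by (simp add: chart_rep_def Fr fun_eq_iff)
    then show "creg False (mmodel Q) (chart_rep ?c ?d F) (snd ?c ?r)"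
      using inverse(1)[unfolded base] by (simp add: creg_def Fr)
  qed (use r z in auto)
  have "mreg False Q X (\<lambda>q. s (F q)) ?r"
    by (rule mreg_compose[where f=F and g=s, OF Freg _ wmfd_Q wmfds(7)]) (use s(1) Fr in simp)
  moreover have "eventually (\<lambda>q. piQ (s (F q)) = q) (mnhds Q ?r)"
    using near
  proof eventually_elim
    case (elim q)
    then obtain u where u: "u \<in> S" "q = ?k (mpar W ?z u)" by auto
    then show ?case using Fk[OF u(1)] by simp
  qed
  ultimately show ?thesis using Fr s(2) by (intro exI[of _ "\<lambda>q. s (F q)"]) simp
qed

end

section \<open>Reduction\<close>

lemma is_dldps_regular:
  assumes S: "is_dldps F S"
  shows "regular_dldps S"
proof -
  note D = S[unfolded is_dldps_def]
  have fb: "fiber_bundle (dE S) (dM S) F (dphi S)"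
    and L: "msmooth (C1 S) real_mfd (mcarrier (C1 S)) (dL S)"
    and vs: "vector_subbundle (C1 S) (dDist S)"
    and snd0: "\<forall>x\<in>mcarrier (C1 S). \<forall>\<delta>\<in>dDist S x. snd \<delta> = 0"
    and P: "\<forall>(x0, x1)\<in>C2 S.
        (\<forall>\<delta>\<in>dDist S x1. dP S x0 x1 \<delta> \<in> mmodel (dE S) \<and>
           mdiff (dE S) (dM S) (dphi S) (fst x0) (dP S x0 x1 \<delta>) = 0) \<and>
        (\<forall>\<delta>\<in>dDist S x1. \<forall>\<eta>\<in>dDist S x1. dP S x0 x1 (\<delta> + \<eta>) = dP S x0 x1 \<delta> + dP S x0 x1 \<eta>) \<and>
        (\<forall>\<delta>\<in>dDist S x1. \<forall>t. dP S x0 x1 (t *\<^sub>R \<delta>) = t *\<^sub>R dP S x0 x1 \<delta>)"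
    using D by simp_all
  have pE: "pmfd (dE S)" and pM: "pmfd (dM S)" using fb by (simp_all add: fiber_bundle_def is_manifold_pmfd)
  have pC: "pmfd (C1 S)" unfolding C1_def by (rule pmfd_prod[OF pE pM])
  have Dist: "subspace (dDist S p)" "dDist S p \<subseteq> mmodel (C1 S)" if p: "p \<in> mcarrier (C1 S)" for p
  proof -
    from vs[unfolded vector_subbundle_def, rule_format, OF p]
    obtain Wn n s where W: "p \<in> Wn" "\<forall>i<n. msmooth (C1 S) (tangent_mfd (C1 S)) Wn (\<lambda>q. (q, s i q))"
       "span ((\<lambda>i. s i p) ` {..<n::nat}) = dDist S p" by (elim exE conjE) simp
    show "subspace (dDist S p)" unfolding W(3)[symmetric] by (rule subspace_span)
    have "s i p \<in> mmodel (C1 S)" if "i < n" for i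
    proof -
      have "(\<lambda>q. (q, s i q)) \<in> Wn \<rightarrow> mcarrier (tangent_mfd (C1 S))"
        using W(2) that by (simp add: msmooth_def)
      from funcset_mem[OF this W(1)] show ?thesis by (simp add: tangent_mfd_def)
    qed
    then show "dDist S p \<subseteq> mmodel (C1 S)" unfolding W(3)[symmetric]
      using pC by (intro span_minimal) (auto simp: pmfd_def)
  qed
  show ?thesis
  proof
    show "wmfd (dE S)" "wmfd (dM S)" using pE pM by (simp_all add: pmfd_wmfd)
    show "mreg False (C1 S) real_mfd (dL S) p" if "p \<in> mcarrier (C1 S)" for p
      by (rule msmooth_mreg_carrier[OF pC pmfd_linear[OF subspace_UNIV] L that])
    show "mreg False (dE S) (dM S) (dphi S) e" if "e \<in> mcarrier (dE S)" for e
      by (rule msmooth_mreg_carrier[OF pE pM _ that]) (use fb in \<open>simp add: fiber_bundle_def\<close>)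
    show "subspace (dDist S p)" if "p \<in> mcarrier (C1 S)" for p by (rule Dist(1)[OF that])
    show "fst \<delta> \<in> mmodel (dE S) \<and> snd \<delta> = 0" if "p \<in> mcarrier (C1 S)" "\<delta> \<in> dDist S p" for p \<delta>
      using Dist(2)[OF that(1)] that snd0 by (auto simp: C1_def prod_mfd_simps)
  next
    fix p q assume pq: "(p, q) \<in> C2 S"
    then have "q \<in> mcarrier (C1 S)" by (simp add: C2_def)
    then have z: "0 \<in> dDist S q" by (rule subspace_0[OF Dist(1)])
    note Ppq = bspec[OF P pq, unfolded prod.case]
    have "dP S p q (0 *\<^sub>R 0) = 0 *\<^sub>R dP S p q 0" using Ppq z by blast
    then show "dP S p q 0 = 0" by simp
    fix \<delta> assume "\<delta> \<in> dDist S q"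
    then show "dP S p q \<delta> \<in> mmodel (dE S)" "mdiff (dE S) (dM S) (dphi S) (fst p) (dP S p q \<delta>) = 0"
      using Ppq by simp_all
  qed
qed

locale reduction = bundle_action G MG "dE S" "dM S" F "dphi S" actE actM actF
  for G :: "'g monoid" (structure) and MG :: "('g, 'k::euclidean_space) mfd"
    and F :: "('c, 'h::euclidean_space) mfd"
    and S :: "('a, 'e::euclidean_space, 'b, 'f::euclidean_space) dldps"
    and actE :: "'g \<Rightarrow> 'a \<Rightarrow> 'a" and actM :: "'g \<Rightarrow> 'b \<Rightarrow> 'b" and actF :: "'c \<Rightarrow> 'g \<Rightarrow> 'c" +
  fixes Hor :: "('b \<times> 'b) set"
  assumes sys: "is_dldps F S" and sym: "symmetry_group G MG F actE actM actF S"
    and conn: "discrete_connection G MG (dM S) actM Hor"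
    and dom: "connection_domain G actM Hor = mcarrier (dM S) \<times> mcarrier (dM S)"
begin

abbreviation E where "E \<equiv> dE S"
abbreviation M where "M \<equiv> dM S"
abbreviation phi where "phi \<equiv> dphi S"

sublocale S: regular_dldps S
  by (rule is_dldps_regular[OF sys])

subsection \<open>The discrete connection\<close>

definition hor :: "'b \<Rightarrow> 'b set \<Rightarrow> 'b" where
  "hor m r = snd (inv_into Hor (map_prod id piM) (m, r))"

lemma Hor_props:
  "Hor \<subseteq> mcarrier M \<times> mcarrier M" "inj_on (map_prod id piM) Hor"
  "g \<in> carrier G \<Longrightarrow> (m, n) \<in> Hor \<Longrightarrow> (actM g m, actM g n) \<in> Hor"
  "local_diffeo_on (prod_mfd M M) (prod_mfd M B) Hor (map_prod id piM)"
proof -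
  note D = conn[unfolded discrete_connection_def]
  show "Hor \<subseteq> mcarrier M \<times> mcarrier M" using D by (simp add: embedded_submanifold_def prod_mfd_simps)
  show "inj_on (map_prod id piM) Hor" "local_diffeo_on (prod_mfd M M) (prod_mfd M B) Hor (map_prod id piM)"
    using D by simp_all
  assume g: "g \<in> carrier G" "(m, n) \<in> Hor"
  have "\<forall>g\<in>carrier G. \<forall>x\<in>Hor. diag_act actM actM g x \<in> Hor" using D by simp
  then have "diag_act actM actM g (m, n) \<in> Hor" using g by simp
  then show "(actM g m, actM g n) \<in> Hor" by (simp add: diag_act_def)
qed

lemma hor_inv:
  assumes "m \<in> mcarrier M" "r \<in> mcarrier B"
  shows "(m, hor m r) \<in> Hor" "inv_into Hor (map_prod id piM) (m, r) = (m, hor m r)"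
    "piM (hor m r) = r" "hor m r \<in> mcarrier M"
proof -
  obtain m1 where m1: "m1 \<in> mcarrier M" "r = piM m1" using assms(2) unfolding B_carrier by (rule aM.orbitsE)
  have "(m, m1) \<in> connection_domain G actM Hor" unfolding dom using assms m1 by simp
  then obtain n g where n: "(m, n) \<in> Hor" "g \<in> carrier G" "m1 = actM g n" by (auto simp: connection_domain_def)
  have "n \<in> mcarrier M" using n(1) Hor_props(1) by auto
  then have "map_prod id piM (m, n) = (m, r)" using n m1 by (simp add: aM.orbit_act)
  then have "(m, r) \<in> map_prod id piM ` Hor" using n(1) by (metis imageI)
  then have i: "inv_into Hor (map_prod id piM) (m, r) \<in> Hor"
     "map_prod id piM (inv_into Hor (map_prod id piM) (m, r)) = (m, r)"
    by (simp_all only: inv_into_into f_inv_into_f)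
  then show e: "inv_into Hor (map_prod id piM) (m, r) = (m, hor m r)"
    unfolding hor_def by (cases "inv_into Hor (map_prod id piM) (m, r)") simp
  show h: "(m, hor m r) \<in> Hor" "piM (hor m r) = r" using i unfolding e by simp_all
  show "hor m r \<in> mcarrier M" using h(1) Hor_props(1) by auto
qed

lemma hor_unique:
  assumes "(m, n) \<in> Hor"
  shows "hor m (piM n) = n"
proof -
  have "inv_into Hor (map_prod id piM) (map_prod id piM (m, n)) = (m, n)"
    using Hor_props(2) assms by (rule inv_into_f_f)
  then show ?thesis by (simp add: hor_def)
qed

lemma hor_act:
  assumes "m \<in> mcarrier M" "r \<in> mcarrier B" "g \<in> carrier G"
  shows "hor (actM g m) r = actM g (hor m r)"
proof -
  note h = hor_inv[OF assms(1,2)]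
  have "hor (actM g m) (piM (actM g (hor m r))) = actM g (hor m r)"
    by (rule hor_unique[OF Hor_props(3)[OF assms(3) h(1)]])
  then show ?thesis using h assms by (simp add: aM.orbit_act)
qed

lemma piM_in [simp]: "m \<in> mcarrier M \<Longrightarrow> piM m \<in> mcarrier B"
  unfolding B_carrier by (rule aM.orbit_in_orbits)

lemma hor_reg:
  assumes p: "m \<in> mcarrier M" "r \<in> mcarrier B"
  shows "mreg b (prod_mfd M B) M (\<lambda>p. hor (fst p) (snd p)) (m, r)"
proof -
  let ?f = "map_prod id piM" and ?MB = "prod_mfd M B" and ?MM = "prod_mfd M M"
  note h = hor_inv[OF p]
  have pMB: "pmfd ?MB" and pMM: "pmfd ?MM" by (intro pmfd_prod pmfds)+
  obtain Wn where Wn: "(m, hor m r) \<in> Wn" "openin (mtopology ?MB) (?f ` (Hor \<inter> Wn))"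
      "diffeo_on ?MM ?MB (Hor \<inter> Wn) (?f ` (Hor \<inter> Wn)) ?f"
    using Hor_props(4)[unfolded local_diffeo_on_def, rule_format, OF h(1)] by (elim exE conjE) (rule that)
  have fm: "?f (m, hor m r) = (m, r)" using h by simp
  have "?f (m, hor m r) \<in> ?f ` (Hor \<inter> Wn)" by (rule imageI) (simp add: h(1) Wn(1))
  then have mem: "(m, r) \<in> ?f ` (Hor \<inter> Wn)" unfolding fm .
  have ev: "eventually (\<lambda>x. x \<in> ?f ` (Hor \<inter> Wn)) (mnhds ?MB (m, r))"
    by (rule eventually_mnhds_openin[OF pMB Wn(2) mem])
  have r0: "mreg b ?MB ?MM (inv_into (Hor \<inter> Wn) ?f) (m, r)"
    by (rule diffeo_onD(2)[OF Wn(3) pMM pMB mem ev])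
  have r1: "mreg b ?MB M (\<lambda>x. snd (inv_into (Hor \<inter> Wn) ?f x)) (m, r)"
    by (rule mreg_compose[where f="inv_into (Hor \<inter> Wn) ?f" and g=snd, OF r0 mreg_snd[OF wmfds(3,3) mregD(2)[OF r0]]
      pmfd_wmfd[OF pMB] pmfd_wmfd[OF pMM]])
  have "eventually (\<lambda>x. snd (inv_into (Hor \<inter> Wn) ?f x) = hor (fst x) (snd x)) (mnhds ?MB (m, r))"
    using ev
  proof eventually_elim
    case (elim x)
    then obtain a b where ab: "(a, b) \<in> Hor" "(a, b) \<in> Wn" "x = (a, piM b)" by auto
    have "inv_into (Hor \<inter> Wn) ?f (?f (a, b)) = (a, b)"
      using Hor_props(2) ab by (intro inv_into_f_f inj_on_subset[OF Hor_props(2)]) auto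
    then show ?case using hor_unique[OF ab(1)] ab(3) by simp
  qed
  then show ?thesis by (rule mreg_cong[where f="\<lambda>x. snd (inv_into (Hor \<inter> Wn) ?f x)", OF r1 pmfd_wmfd[OF pMB]])
qed

abbreviation conf :: "'b \<Rightarrow> 'b \<Rightarrow> 'g" where
  "conf \<equiv> connection_form G actM Hor"

lemma conf:
  assumes "m0 \<in> mcarrier M" "m1 \<in> mcarrier M"
  shows "conf m0 m1 \<in> carrier G" "actM (conf m0 m1) (hor m0 (piM m1)) = m1"
    "g \<in> carrier G \<Longrightarrow> actM g (hor m0 (piM m1)) = m1 \<Longrightarrow> conf m0 m1 = g"
proof -
  let ?h = "hor m0 (piM m1)"
  note h = hor_inv[OF assms(1) piM_in[OF assms(2)]]
  have eq: "conf m0 m1 = g" if g: "g \<in> carrier G" "actM g ?h = m1" for g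
    unfolding connection_form_def
  proof (rule the_equality)
    show "g \<in> carrier G \<and> (m0, actM (inv g) m1) \<in> Hor"
      using g h aM.act_inv[OF g(1) h(4)] by simp
    fix k assume k: "k \<in> carrier G \<and> (m0, actM (inv k) m1) \<in> Hor"
    then have "hor m0 (piM (actM (inv k) m1)) = actM (inv k) m1" by (intro hor_unique) simp
    then have "?h = actM (inv k) m1" using k assms by (simp add: aM.orbit_act)
    then have "actM k ?h = m1" using k assms by (simp add: aM.act_inv')
    then show "k = g" using freeM'[of k g ?h] k g h(4) by simp
  qed
  obtain k where "k \<in> carrier G" "m1 = actM k ?h"
    using aM.orbit_eqD[OF h(3) assms(2)] by auto
  with eq show "conf m0 m1 \<in> carrier G" "actM (conf m0 m1) ?h = m1" by auto
  show "g \<in> carrier G \<Longrightarrow> actM g ?h = m1 \<Longrightarrow> conf m0 m1 = g" by (rule eq)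
qed

lemma conf_act:
  assumes m: "m0 \<in> mcarrier M" "m1 \<in> mcarrier M" and g: "g \<in> carrier G"
  shows "conf (actM g m0) (actM g m1) = g \<otimes> conf m0 m1 \<otimes> inv g"
proof (rule conf(3))
  note c = conf[OF m]
  note h = hor_inv[OF m(1) piM_in[OF m(2)]]
  show "g \<otimes> conf m0 m1 \<otimes> inv g \<in> carrier G" using c(1) g by simp
  have "actM (g \<otimes> conf m0 m1 \<otimes> inv g) (actM g (hor m0 (piM m1))) = actM g (actM (conf m0 m1) (hor m0 (piM m1)))"
    using g c(1) h(4) by (simp add: aM.act_mult aM.act_inv aM.act_closed)
  then show "actM (g \<otimes> conf m0 m1 \<otimes> inv g) (hor (actM g m0) (piM (actM g m1))) = actM g m1"
    using c(2) g m by (simp add: aM.orbit_act hor_act)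
qed (use assms in \<open>simp_all add: aM.act_closed\<close>)

lemma mreg_hor:
  fixes K :: "('z, 'y::euclidean_space) mfd"
  assumes "mreg b K M f p" "mreg b K B q p" "wmfd K"
  shows "mreg b K M (\<lambda>x. hor (f x) (q x)) p"
  using mreg_compose2[OF _ assms(1,2,3) wmfds(3,5), of M "\<lambda>p. hor (fst p) (snd p)"]
    hor_reg[OF mregD(2)[OF assms(1)] mregD(2)[OF assms(2)], of b] by simp

lemma mreg_conf:
  fixes K :: "('z, 'y::euclidean_space) mfd"
  assumes f: "mreg b K M f p" and q: "mreg b K M q p" and K: "wmfd K"
  shows "mreg b K MG (\<lambda>x. conf (f x) (q x)) p"
proof -
  have m: "f p \<in> mcarrier M" "q p \<in> mcarrier M" using f q by (auto dest: mregD(2))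
  have qB: "mreg b K B (\<lambda>x. piM (q x)) p" by (rule mreg_piM[OF q K])
  have hr: "mreg b K M (\<lambda>x. hor (f x) (piM (q x))) p" by (rule mreg_hor[OF f qB K])
  obtain V \<sigma> \<tau> where LT: "local_triv M B MG piM V \<sigma> \<tau>" "piM (q p) \<in> V"
    "\<And>m g. m \<in> mcarrier M \<Longrightarrow> piM m \<in> V \<Longrightarrow> g \<in> carrier G \<Longrightarrow> \<sigma> (actM g m) = g \<otimes> \<sigma> m"
    by (rule principal_triv[OF m(2)]) (rule that; assumption)
  note V = local_trivD(1)[OF LT(1)] LT(2)
  note \<sigma> = local_trivD(2,3)[OF LT(1), unfolded MG_carrier] LT(3)
  note h = hor_inv[OF m(1) piM_in[OF m(2)]]
  have s1: "mreg b K MG (\<lambda>x. \<sigma> (q x)) p"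
    by (rule mreg_compose[where f=q and g=\<sigma>, OF q \<sigma>(2)[OF m(2) V(2)] K wmfds(3)])
  have s2: "mreg b K MG (\<lambda>x. \<sigma> (hor (f x) (piM (q x)))) p"
    by (rule mreg_compose[where f="\<lambda>x. hor (f x) (piM (q x))" and g=\<sigma>, OF hr \<sigma>(2)[OF h(4)] K wmfds(3)])
       (simp add: h V)
  have r: "mreg b K MG (\<lambda>x. \<sigma> (q x) \<otimes> inv (\<sigma> (hor (f x) (piM (q x))))) p"
    by (intro mreg_mult mreg_inv s1 s2 K)
  have "eventually (\<lambda>x. piM (q x) \<in> V) (mnhds K p)"
    by (rule mreg_eventually_in[OF qB K pmfds(5) V])
  moreover have "eventually (\<lambda>x. f x \<in> mcarrier M) (mnhds K p)"
    by (rule mreg_eventually[OF f K wmfds(3) eventually_mnhds_carrier[OF wmfds(3) m(1)]])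
  moreover have "eventually (\<lambda>x. q x \<in> mcarrier M) (mnhds K p)"
    by (rule mreg_eventually[OF q K wmfds(3) eventually_mnhds_carrier[OF wmfds(3) m(2)]])
  ultimately have "eventually (\<lambda>x. \<sigma> (q x) \<otimes> inv (\<sigma> (hor (f x) (piM (q x)))) = conf (f x) (q x)) (mnhds K p)"
  proof eventually_elim
    case (elim x)
    note c = conf[OF elim(2,3)]
    note h = hor_inv[OF elim(2) piM_in[OF elim(3)]]
    have "\<sigma> (q x) = \<sigma> (actM (conf (f x) (q x)) (hor (f x) (piM (q x))))" using c(2) by simp
    also have "\<dots> = conf (f x) (q x) \<otimes> \<sigma> (hor (f x) (piM (q x)))"
      using c(1) h elim by (intro \<sigma>(3)) simp_all
    finally show ?case using \<sigma>(1)[OF h(4)] h(3) elim(1) c(1) by (simp add: m_assoc)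
  qed
  then show ?thesis by (rule mreg_cong[where f="\<lambda>x. \<sigma> (q x) \<otimes> inv (\<sigma> (hor (f x) (piM (q x))))", OF r K])
qed


subsection \<open>The map \<open>\<Upsilon>\<close> and its local sections\<close>

abbreviation C where "C \<equiv> C1 S"
abbreviation QB where "QB \<equiv> prod_mfd Q B"
abbreviation ups where "ups \<equiv> Upsilon G actE actM Hor phi"
abbreviation dact where "dact \<equiv> diag_act actE actM"

lemma ups_simp: "ups x = (piQ (fst x, conf (phi (fst x)) (snd x)), piM (snd x))"
  by (simp add: Upsilon_def split: prod.split)

lemma wQB: "wmfd QB" and wC: "wmfd C"
  by (rule wmfd_prod[OF wmfd_Q wmfds(5)]) (rule S.wC1)

lemma C_carrier: "x \<in> mcarrier C \<longleftrightarrow> fst x \<in> mcarrier E \<and> snd x \<in> mcarrier M"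
  by (cases x) (simp add: C1_def prod_mfd_simps)

lemma C_model: "v \<in> mmodel C \<longleftrightarrow> fst v \<in> mmodel E \<and> snd v \<in> mmodel M"
  by (cases v) (simp add: C1_def prod_mfd_simps)

lemma X_in: "e \<in> mcarrier E \<Longrightarrow> w \<in> carrier G \<Longrightarrow> (e, w) \<in> mcarrier X"
  by (simp add: prod_mfd_simps)

lemma C_fst: "x \<in> mcarrier C \<Longrightarrow> mreg b C E fst x" and C_snd: "x \<in> mcarrier C \<Longrightarrow> mreg b C M snd x"
  unfolding C1_def by (rule mreg_fst mreg_snd, rule wmfds, rule wmfds, assumption)+

lemma ups_reg:
  assumes x: "x \<in> mcarrier C"
  shows "mreg b C Q (\<lambda>x. fst (ups x)) x" "mreg b C QB ups x"
proof -
  have cr: "mreg b C MG (\<lambda>x. conf (phi (fst x)) (snd x)) x"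
    by (intro mreg_conf mreg_phi C_fst C_snd x wC)
  have "mreg b C X (\<lambda>x. (fst x, conf (phi (fst x)) (snd x))) x"
    by (intro mreg_Pair C_fst x cr)
  then have 1: "mreg b C Q (\<lambda>x. piQ (fst x, conf (phi (fst x)) (snd x))) x"
    by (rule mreg_compose[where g=piQ and f="\<lambda>x. (fst x, conf (phi (fst x)) (snd x))", OF _ piQ_reg(1) wC wmfds(6)])
       (use x in \<open>simp add: C_carrier X_in conf phi_closed\<close>)
  then show "mreg b C Q (\<lambda>x. fst (ups x)) x" by (simp add: ups_simp)
  have "mreg b C QB (\<lambda>x. (piQ (fst x, conf (phi (fst x)) (snd x)), piM (snd x))) x"
    by (intro mreg_Pair 1 mreg_piM C_snd x wC)
  then show "mreg b C QB ups x" unfolding ups_simp[abs_def] .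
qed

lemma ups_in: "x \<in> mcarrier C \<Longrightarrow> ups x \<in> mcarrier QB"
  using mregD(2)[OF ups_reg(2)[of x True]] .

lemma dact_in: "g \<in> carrier G \<Longrightarrow> x \<in> mcarrier C \<Longrightarrow> dact g x \<in> mcarrier C"
  by (cases x) (simp add: C_carrier diag_act_def aE.act_closed aM.act_closed)

lemma ups_dact:
  assumes "g \<in> carrier G" "x \<in> mcarrier C"
  shows "ups (dact g x) = ups x"
proof -
  obtain e m where x: "x = (e, m)" "e \<in> mcarrier E" "m \<in> mcarrier M" using assms by (cases x) (simp add: C_carrier)
  let ?w = "conf (phi e) m"
  have w: "?w \<in> carrier G" using x by (simp add: conf phi_closed)
  have "(actE g e, g \<otimes> ?w \<otimes> inv g) = cact g (e, ?w)" by (simp add: conj_act_def)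
  then have "piQ (actE g e, g \<otimes> ?w \<otimes> inv g) = piQ (e, ?w)"
    using aX.orbit_act[OF assms(1) X_in[OF x(2) w]] by simp
  then show ?thesis
    using x assms(1) by (simp add: ups_simp diag_act_def phi_act conf_act phi_closed aM.orbit_act)
qed

lemma ups_eqD:
  assumes x: "x \<in> mcarrier C" and y: "y \<in> mcarrier C" and eq: "ups x = ups y"
  obtains g where "g \<in> carrier G" "y = dact g x"
proof -
  obtain e m where em: "x = (e, m)" "e \<in> mcarrier E" "m \<in> mcarrier M" using x by (cases x) (simp add: C_carrier)
  obtain e' m' where em': "y = (e', m')" "e' \<in> mcarrier E" "m' \<in> mcarrier M" using y by (cases y) (simp add: C_carrier)
  let ?w = "conf (phi e) m" and ?w' = "conf (phi e') m'"
  have w: "?w \<in> carrier G" "?w' \<in> carrier G" using em em' by (simp_all add: conf phi_closed)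
  have eqs: "piQ (e, ?w) = piQ (e', ?w')" "piM m = piM m'" using eq by (simp_all add: ups_simp em em')
  obtain g where g: "g \<in> carrier G" "(e', ?w') = cact g (e, ?w)"
    using aX.orbit_eqD[OF eqs(1) X_in[OF em'(2) w(2)]] by auto
  note c = g(2)[unfolded conj_act_def prod.case prod.inject]
  have e': "e' = actE g e" and w': "?w' = g \<otimes> ?w \<otimes> inv g"
    by (rule conjunct1[OF c], rule conjunct2[OF c])
  have h: "hor (phi e) (piM m) \<in> mcarrier M" using em by (intro hor_inv) (simp_all add: phi_closed)
  have "m' = actM ?w' (hor (phi e') (piM m'))" using em' by (simp add: conf phi_closed)
  also have "hor (phi e') (piM m') = actM g (hor (phi e) (piM m))"
    unfolding e' eqs(2)[symmetric] using em g by (simp add: phi_act hor_act phi_closed)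
  also have "actM ?w' (actM g (hor (phi e) (piM m))) = actM g (actM ?w (hor (phi e) (piM m)))"
    unfolding w' using g w h by (simp add: aM.act_mult aM.act_inv aM.act_closed)
  also have "actM ?w (hor (phi e) (piM m)) = m" using em by (simp add: conf phi_closed)
  finally show thesis using that[OF g(1)] e' by (simp add: em em' diag_act_def)
qed

lemma ups_of:
  assumes "e \<in> mcarrier E" "w \<in> carrier G" "r \<in> mcarrier B"
  shows "ups (e, actM w (hor (phi e) r)) = (piQ (e, w), r)"
    "(e, actM w (hor (phi e) r)) \<in> mcarrier C"
proof -
  note h = hor_inv[OF phi_closed[OF assms(1)] assms(3)]
  have p: "piM (actM w (hor (phi e) r)) = r" using h assms by (simp add: aM.orbit_act)
  have m: "actM w (hor (phi e) r) \<in> mcarrier M" using h assms by (simp add: aM.act_closed)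
  have "conf (phi e) (actM w (hor (phi e) r)) = w"
    by (rule conf(3)[OF phi_closed[OF assms(1)] m assms(2)]) (simp add: p)
  then show "ups (e, actM w (hor (phi e) r)) = (piQ (e, w), r)" by (simp add: ups_simp p)
  show "(e, actM w (hor (phi e) r)) \<in> mcarrier C" using assms m by (simp add: C_carrier)
qed

lemma ups_surj:
  assumes "y \<in> mcarrier QB"
  obtains x where "x \<in> mcarrier C" "y = ups x"
proof -
  obtain v r where y: "y = (v, r)" "v \<in> mcarrier Q" "r \<in> mcarrier B" using assms by (cases y) (simp add: prod_mfd_simps)
  obtain p where p: "p \<in> mcarrier X" "v = piQ p" using y(2) unfolding Q_simps by (rule aX.orbitsE)
  obtain e w where ew: "p = (e, w)" "e \<in> mcarrier E" "w \<in> carrier G" using p(1) by (rule X_cases)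
  show thesis using that[of "(e, actM w (hor (phi e) r))"] ups_of[OF ew(2,3) y(3)] y p ew by simp
qed

lemma ups_section:
  assumes x: "x \<in> mcarrier C"
  shows "\<exists>t. mreg False QB C t (ups x) \<and> t (ups x) = x \<and>
     eventually (\<lambda>y. t y \<in> mcarrier C \<and> ups (t y) = y) (mnhds QB (ups x))"
proof -
  obtain e0 m0 where em: "x = (e0, m0)" "e0 \<in> mcarrier E" "m0 \<in> mcarrier M" using x by (cases x) (simp add: C_carrier)
  let ?w0 = "conf (phi e0) m0"
  note c0 = conf[OF phi_closed[OF em(2)] em(3)]
  obtain s where s: "mreg False Q X s (piQ (e0, ?w0))" "s (piQ (e0, ?w0)) = (e0, ?w0)"
      "eventually (\<lambda>r. piQ (s r) = r) (mnhds Q (piQ (e0, ?w0)))"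
    using Q_section[OF X_in[OF em(2) c0(1)]] by auto
  have ux: "ups x = (piQ (e0, ?w0), piM m0)" by (simp add: ups_simp em)
  define t where "t y = (fst (s (fst y)), actM (snd (s (fst y))) (hor (phi (fst (s (fst y)))) (snd y)))" for y
  have uQB: "ups x \<in> mcarrier QB" by (rule ups_in[OF x])
  have f1: "mreg b QB Q fst (ups x)" for b by (rule mreg_fst[OF wmfd_Q wmfds(5) uQB])
  have f2: "mreg b QB B snd (ups x)" for b by (rule mreg_snd[OF wmfd_Q wmfds(5) uQB])
  have sX: "mreg False QB X (\<lambda>y. s (fst y)) (ups x)"
    by (rule mreg_compose[where f=fst and g=s, OF f1 _ wQB wmfd_Q]) (use s(1) in \<open>simp add: ux\<close>)
  have sE: "mreg False QB E (\<lambda>y. fst (s (fst y))) (ups x)"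
    by (rule mreg_compose[where f="\<lambda>y. s (fst y)" and g=fst, OF sX mreg_fst[OF wmfds(2,1) mregD(2)[OF sX]] wQB wmfds(6)])
  have sG: "mreg False QB MG (\<lambda>y. snd (s (fst y))) (ups x)"
    by (rule mreg_compose[where f="\<lambda>y. s (fst y)" and g=snd, OF sX mreg_snd[OF wmfds(2,1) mregD(2)[OF sX]] wQB wmfds(6)])
  have tr: "mreg False QB C t (ups x)"
    unfolding t_def C1_def by (intro mreg_Pair sE mreg_actM sG mreg_hor mreg_phi f2 wQB)
  have tx: "t (ups x) = x" unfolding t_def ux using c0(2) by (simp add: s(2) em)
  have "eventually (\<lambda>y. s (fst y) \<in> mcarrier X) (mnhds QB (ups x))"
    by (rule mreg_eventually[OF sX wQB wmfds(6) eventually_mnhds_carrier[OF wmfds(6) mregD(2)[OF sX]]])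
  moreover have "eventually (\<lambda>y. piQ (s (fst y)) = fst y) (mnhds QB (ups x))"
    by (rule mreg_eventually[OF f1[of True] wQB wmfd_Q]) (use s(3) in \<open>simp add: ux\<close>)
  moreover have "eventually (\<lambda>y. y \<in> mcarrier QB) (mnhds QB (ups x))"
    by (rule eventually_mnhds_carrier[OF wQB uQB])
  ultimately have "eventually (\<lambda>y. t y \<in> mcarrier C \<and> ups (t y) = y) (mnhds QB (ups x))"
  proof eventually_elim
    case (elim y)
    obtain e w where ew: "s (fst y) = (e, w)" "e \<in> mcarrier E" "w \<in> carrier G" using elim(1) by (rule X_cases)
    have r: "snd y \<in> mcarrier B" using elim(3) by (cases y) (simp add: prod_mfd_simps)
    have "t y = (e, actM w (hor (phi e) (snd y)))" by (simp add: t_def ew)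
    moreover have "(piQ (e, w), snd y) = y" using elim(2) by (simp add: ew)
    ultimately show ?case using ups_of[OF ew(2,3) r] by simp
  qed
  with tr tx show ?thesis by (intro exI[of _ t] conjI)
qed

text \<open>
  A vertical vector \<open>(\<delta>\<epsilon>, 0)\<close> is determined by its image under \<open>d\<Upsilon>\<close>, since near \<open>x\<close> the \<open>E\<close>-component
  of a point of \<open>C'(E)\<close> is a differentiable function of its image under \<open>\<Upsilon>\<close> and its \<open>M\<close>-component.
\<close>

lemma dups_inj:
  assumes x: "x \<in> mcarrier C" and v: "v \<in> mmodel C" "v' \<in> mmodel C"
    and eq: "mdiff C QB ups x v = mdiff C QB ups x v'" and s: "snd v = snd v'"
  shows "v = v'"
proof -
  obtain e0 m0 where em: "x = (e0, m0)" "e0 \<in> mcarrier E" "m0 \<in> mcarrier M" using x by (cases x) (simp add: C_carrier)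
  obtain t where t: "mreg False QB C t (ups x)" "t (ups x) = x"
     "eventually (\<lambda>y. t y \<in> mcarrier C \<and> ups (t y) = y) (mnhds QB (ups x))"
    using ups_section[OF x] by auto
  obtain V \<sigma> \<tau> where LT: "local_triv M B MG piM V \<sigma> \<tau>" "piM m0 \<in> V"
    "\<And>m g. m \<in> mcarrier M \<Longrightarrow> piM m \<in> V \<Longrightarrow> g \<in> carrier G \<Longrightarrow> \<sigma> (actM g m) = g \<otimes> \<sigma> m"
    by (rule principal_triv[OF em(3)]) (rule that; assumption)
  note V = local_trivD(1)[OF LT(1)] LT(2)
  note \<sigma> = local_trivD(2,3)[OF LT(1), unfolded MG_carrier] LT(3)
  let ?QBM = "prod_mfd QB M"
  have wQBM: "wmfd ?QBM" by (rule wmfd_prod[OF wQB wmfds(3)])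
  define \<rho> where "\<rho> p = actE (\<sigma> (snd p) \<otimes> inv (\<sigma> (snd (t (fst p))))) (fst (t (fst p)))" for p
  let ?j = "\<lambda>x'. (ups x', snd x')"
  have jr: "mreg False C ?QBM ?j x" by (intro mreg_Pair ups_reg C_snd x)
  have p: "?j x \<in> mcarrier ?QBM" by (rule mregD(2)[OF jr])
  have p1: "mreg False ?QBM QB fst (?j x)" by (rule mreg_fst[OF wQB wmfds(3) p])
  have p2: "mreg False ?QBM M snd (?j x)" by (rule mreg_snd[OF wQB wmfds(3) p])
  have tt: "mreg False ?QBM C (\<lambda>p. t (fst p)) (?j x)"
    by (rule mreg_compose[where f=fst and g=t, OF p1 _ wQBM wQB]) (simp add: t(1))
  have tjx: "t (fst (?j x)) = x" by (simp add: t(2))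
  have tE: "mreg False ?QBM E (\<lambda>p. fst (t (fst p))) (?j x)"
    by (rule mreg_compose[where f="\<lambda>p. t (fst p)" and g=fst, OF tt _ wQBM wC]) (unfold tjx, rule C_fst[OF x])
  have tM: "mreg False ?QBM M (\<lambda>p. snd (t (fst p))) (?j x)"
    by (rule mreg_compose[where f="\<lambda>p. t (fst p)" and g=snd, OF tt _ wQBM wC]) (unfold tjx, rule C_snd[OF x])
  have s1: "mreg False ?QBM MG (\<lambda>p. \<sigma> (snd p)) (?j x)"
    by (rule mreg_compose[where f=snd and g=\<sigma>, OF p2 _ wQBM wmfds(3)]) (simp add: em \<sigma>(2) V)
  have s2: "mreg False ?QBM MG (\<lambda>p. \<sigma> (snd (t (fst p)))) (?j x)"
    by (rule mreg_compose[where f="\<lambda>p. snd (t (fst p))" and g=\<sigma>, OF tM _ wQBM wmfds(3)])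
       (unfold tjx, simp add: em \<sigma>(2) V)
  have \<rho>r: "mreg False ?QBM E \<rho> (?j x)"
    unfolding \<rho>_def by (intro mreg_actE mreg_mult mreg_inv s1 s2 tE wQBM)
  have "eventually (\<lambda>x'. t (ups x') \<in> mcarrier C \<and> ups (t (ups x')) = ups x') (mnhds C x)"
    by (rule mreg_eventually[OF ups_reg(2)[OF x, of True] wC wQB t(3)])
  moreover have "eventually (\<lambda>x'. x' \<in> mcarrier C) (mnhds C x)" by (rule eventually_mnhds_carrier[OF wC x])
  moreover have "eventually (\<lambda>x'. piM (snd x') \<in> V) (mnhds C x)"
    by (rule mreg_eventually_in[OF mreg_piM[OF C_snd[OF x, of True] wC] wC pmfds(5) V(1)]) (simp add: em V)
  ultimately have ev: "eventually (\<lambda>x'. fst x' = \<rho> (?j x')) (mnhds C x)"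
  proof eventually_elim
    case (elim x')
    then obtain g where g: "g \<in> carrier G" "x' = dact g (t (ups x'))"
      using ups_eqD[of "t (ups x')" x'] by metis
    obtain e m where tem: "t (ups x') = (e, m)" by (cases "t (ups x')")
    have em': "e \<in> mcarrier E" "m \<in> mcarrier M" using elim(1) by (simp_all add: tem C_carrier)
    have x': "fst x' = actE g e" "snd x' = actM g m" using g(2) by (simp_all add: tem diag_act_def)
    have mV: "piM m \<in> V" using elim(3) g em' by (simp add: x' aM.orbit_act)
    have "\<sigma> (snd x') \<otimes> inv (\<sigma> m) = g"
      unfolding x' using \<sigma>(1)[OF em'(2) mV] g by (simp add: \<sigma>(3)[OF em'(2) mV] m_assoc)
    then show ?case by (simp add: \<rho>_def tem x'(1))
  qed
  have key: "fst w = mdiff ?QBM E \<rho> (?j x) (mdiff C QB ups x w, snd w)" if w: "w \<in> mmodel C" for w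
  proof -
    have "fst w = mdiff C E fst x w"
      using mdiff_fst[OF wmfds(2,3), of x w] x w by (simp add: C1_def)
    also have "\<dots> = mdiff C E (\<lambda>x'. \<rho> (?j x')) x w"
      by (rule mdiff_cong[OF C_fst[OF x, of True] wC ev w, symmetric])
    also have "\<dots> = mdiff ?QBM E \<rho> (?j x) (mdiff C ?QBM ?j x w)"
      by (rule mdiff_compose[where f="?j" and g=\<rho>, OF jr \<rho>r wC wQBM w])
    also have "mdiff C ?QBM ?j x w = (mdiff C QB ups x w, mdiff C M snd x w)"
      by (rule mdiff_Pair[OF ups_reg(2)[OF x, of True] C_snd[OF x, of True] wC w])
    also have "mdiff C M snd x w = snd w"
      using mdiff_snd[OF wmfds(2,3), of x w] x w by (simp add: C1_def)
    finally show ?thesis .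
  qed
  have "fst v = fst v'" using key[OF v(1)] key[OF v(2)] eq s by simp
  then show ?thesis using s by (rule prod_eqI)
qed


subsection \<open>The reduced system\<close>

abbreviation R where "R \<equiv> reduced_system G MG actE actM Hor S"
abbreviation dups where "dups \<equiv> mdiff C QB ups"
abbreviation upsE where "upsE \<equiv> fst \<circ> ups"
abbreviation Dact where "Dact g \<equiv> mdiff C C (dact g)"

lemma R_simps:
  "dE R = Q" "dM R = B" "dphi R = conjugate_proj G actM phi" "C1 R = QB" "dDd R = ups ` dDd S"
  "dL R y = (THE l. \<exists>x\<in>mcarrier C. ups x = y \<and> l = dL S x)"
  "dDist R y = (\<Union>x\<in>{x \<in> mcarrier C. ups x = y}. dups x ` dDist S x)"
  "dP R y0 y1 \<zeta> = (THE \<xi>. \<exists>x0 x1 \<delta>. (x0, x1) \<in> C2 S \<and> ups x0 = y0 \<and> ups x1 = y1 \<and>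
            \<delta> \<in> dDist S x1 \<and> dups x1 \<delta> = \<zeta> \<and>
            \<xi> = mdiff C Q upsE x0 (dP S x0 x1 \<delta>, S.Dphi (fst x1) (fst \<delta>)))"
  by (simp_all add: reduced_system_def Let_def C1_def)

lemma symD:
  assumes "g \<in> carrier G"
  shows "x \<in> mcarrier C \<Longrightarrow> dL S (dact g x) = dL S x" "x \<in> dDd S \<Longrightarrow> dact g x \<in> dDd S"
    "x \<in> mcarrier C \<Longrightarrow> \<delta> \<in> dDist S x \<Longrightarrow> Dact g x \<delta> \<in> dDist S (dact g x)"
    "(x0, x1) \<in> C2 S \<Longrightarrow> \<delta> \<in> dDist S x1 \<Longrightarrow>
      dP S (dact g x0) (dact g x1) (Dact g x1 \<delta>) = mdiff E E (actE g) (fst x0) (dP S x0 x1 \<delta>)"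
  using sym[unfolded symmetry_group_def] assms unfolding Let_def by (blast, blast, blast, blast)

lemma Dd_C: "x \<in> dDd S \<Longrightarrow> x \<in> mcarrier C"
  using sys by (auto simp: is_dldps_def embedded_submanifold_def)

lemma C2_iff: "(x0, x1) \<in> C2 S \<longleftrightarrow> x0 \<in> mcarrier C \<and> x1 \<in> mcarrier C \<and> phi (fst x1) = snd x0"
  by (simp add: C2_def)

lemma Dist_model: "x \<in> mcarrier C \<Longrightarrow> \<delta> \<in> dDist S x \<Longrightarrow> \<delta> \<in> mmodel C" "x \<in> mcarrier C \<Longrightarrow> \<delta> \<in> dDist S x \<Longrightarrow> snd \<delta> = 0"
  using S.Dist_model[of x \<delta>] wmfds(3) by (auto simp: C_model wmfdD subspace_0)

lemma act_regs:
  assumes g: "g \<in> carrier G"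
  shows "e \<in> mcarrier E \<Longrightarrow> mreg b E E (actE g) e" "m \<in> mcarrier M \<Longrightarrow> mreg b M M (actM g) m"
    "x \<in> mcarrier C \<Longrightarrow> mreg b C C (dact g) x"
proof -
  show "e \<in> mcarrier E \<Longrightarrow> mreg b E E (actE g) e"
    by (rule mreg_actE[OF mreg_const mreg_id]) (use g wmfds in auto)
  show "m \<in> mcarrier M \<Longrightarrow> mreg b M M (actM g) m"
    by (rule mreg_actM[OF mreg_const mreg_id]) (use g wmfds in auto)
  assume x: "x \<in> mcarrier C"
  have c: "mreg b C MG (\<lambda>_. g) x" using g x by (intro mreg_const wC wmfds) simp_all
  have "mreg b C (prod_mfd E M) (\<lambda>x. (actE g (fst x), actM g (snd x))) x"
    by (intro mreg_Pair mreg_actE mreg_actM c C_fst C_snd x wC)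
  moreover have "(\<lambda>x. (actE g (fst x), actM g (snd x))) = dact g" by (simp add: diag_act_def fun_eq_iff)
  ultimately show "mreg b C C (dact g) x" by (simp add: C1_def)
qed

lemma mdiff_C_fst: "x \<in> mcarrier C \<Longrightarrow> v \<in> mmodel C \<Longrightarrow> mdiff C E fst x v = fst v"
  and mdiff_C_snd: "x \<in> mcarrier C \<Longrightarrow> v \<in> mmodel C \<Longrightarrow> mdiff C M snd x v = snd v"
  unfolding C1_def by (rule mdiff_fst[OF wmfds(2,3)] mdiff_snd[OF wmfds(2,3)], assumption, assumption)+

lemma Dact_split:
  assumes g: "g \<in> carrier G" and x: "x \<in> mcarrier C" and v: "v \<in> mmodel C"
  shows "Dact g x v = (mdiff E E (actE g) (fst x) (fst v), mdiff M M (actM g) (snd x) (snd v))"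
proof -
  have fx: "fst x \<in> mcarrier E" "snd x \<in> mcarrier M" using x by (simp_all add: C_carrier)
  have r1: "mreg True C E (\<lambda>x. actE g (fst x)) x" 
    by (rule mreg_compose[where f=fst and g="actE g", OF C_fst[OF x] act_regs(1)[OF g fx(1)] wC wmfds(2)])
  have r2: "mreg True C M (\<lambda>x. actM g (snd x)) x" 
    by (rule mreg_compose[where f=snd and g="actM g", OF C_snd[OF x] act_regs(2)[OF g fx(2)] wC wmfds(3)])
  have eq: "dact g = (\<lambda>x. (actE g (fst x), actM g (snd x)))" by (simp add: diag_act_def fun_eq_iff)
  have CC: "mdiff C C f = mdiff C (prod_mfd E M) f" for f by (simp only: C1_def)
  have "Dact g x v = (mdiff C E (\<lambda>x. actE g (fst x)) x v, mdiff C M (\<lambda>x. actM g (snd x)) x v)"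
    unfolding eq CC by (rule mdiff_Pair[OF r1 r2 wC v])
  also have "mdiff C E (\<lambda>x. actE g (fst x)) x v = mdiff E E (actE g) (fst x) (mdiff C E fst x v)"
    by (rule mdiff_compose[where f=fst and g="actE g", OF C_fst[OF x, of True] act_regs(1)[OF g fx(1), of True] wC wmfds(2) v])
  also have "mdiff C M (\<lambda>x. actM g (snd x)) x v = mdiff M M (actM g) (snd x) (mdiff C M snd x v)"
    by (rule mdiff_compose[where f=snd and g="actM g", OF C_snd[OF x, of True] act_regs(2)[OF g fx(2), of True] wC wmfds(3) v])
  finally show ?thesis using x v by (simp add: mdiff_C_fst mdiff_C_snd)
qed

lemma dups_Dact:
  assumes g: "g \<in> carrier G" and x: "x \<in> mcarrier C" and v: "v \<in> mmodel C"
  shows "dups (dact g x) (Dact g x v) = dups x v"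
    "mdiff C Q upsE (dact g x) (Dact g x v) = mdiff C Q upsE x v"
proof -
  have ev: "eventually (\<lambda>x. x \<in> mcarrier C) (mnhds C x)" by (rule eventually_mnhds_carrier[OF wC x])
  have "eventually (\<lambda>x. ups x = ups (dact g x)) (mnhds C x)"
    using ev by eventually_elim (simp only: ups_dact[OF g])
  then have "mdiff C QB (\<lambda>x. ups (dact g x)) x v = dups x v"
    by (rule mdiff_cong[OF ups_reg(2)[OF x, of True] wC _ v])
  then show "dups (dact g x) (Dact g x v) = dups x v"
    using mdiff_compose[where f="dact g" and g=ups, OF act_regs(3)[OF g x] ups_reg(2)[OF dact_in[OF g x]] wC wC v] by simp
  have "eventually (\<lambda>x. upsE x = upsE (dact g x)) (mnhds C x)"
    using ev by eventually_elim (simp only: ups_dact[OF g] o_apply)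
  then have "mdiff C Q (\<lambda>x. upsE (dact g x)) x v = mdiff C Q upsE x v"
    using ups_reg(1)[OF x, of True] by (intro mdiff_cong[OF _ wC _ v, of True]) (simp_all add: o_def)
  then show "mdiff C Q upsE (dact g x) (Dact g x v) = mdiff C Q upsE x v"
    using mdiff_compose[where f="dact g" and g="\<lambda>x. fst (ups x)", OF act_regs(3)[OF g x]
      ups_reg(1)[OF dact_in[OF g x], of True] wC wC v] by (simp add: o_def)
qed

lemma dact_inv: "g \<in> carrier G \<Longrightarrow> x \<in> mcarrier C \<Longrightarrow> dact (inv g) (dact g x) = x"
   "g \<in> carrier G \<Longrightarrow> x \<in> mcarrier C \<Longrightarrow> dact g (dact (inv g) x) = x"
  by (cases x; simp add: C_carrier diag_act_def aE.act_inv aM.act_inv aE.act_inv' aM.act_inv')+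

lemma Dist_dact:
  assumes g: "g \<in> carrier G" and x: "x \<in> mcarrier C" and d: "\<delta>' \<in> dDist S (dact g x)"
  obtains \<delta> where "\<delta> \<in> dDist S x" "\<delta>' = Dact g x \<delta>"
proof (rule that)
  let ?x = "dact g x"
  have x': "?x \<in> mcarrier C" by (rule dact_in[OF g x])
  have ig: "inv g \<in> carrier G" using g by simp
  have dm: "\<delta>' \<in> mmodel C" by (rule Dist_model(1)[OF x' d])
  show "Dact (inv g) ?x \<delta>' \<in> dDist S x"
    using symD(3)[OF ig x' d] dact_inv(1)[OF g x] by simp
  have ev: "eventually (\<lambda>y. y = dact g (dact (inv g) y)) (mnhds C ?x)"
    using eventually_mnhds_carrier[OF wC x'] by eventually_elim (simp only: dact_inv(2)[OF g])
  have "\<delta>' = mdiff C C (\<lambda>y. y) ?x \<delta>'" using mdiff_id[OF wC x' dm] by simp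
  also have "\<dots> = mdiff C C (\<lambda>y. dact g (dact (inv g) y)) ?x \<delta>'"
    by (rule mdiff_cong[OF mreg_id[OF wC x', of True] wC ev dm, symmetric])
  also have "\<dots> = Dact g (dact (inv g) ?x) (Dact (inv g) ?x \<delta>')"
    by (rule mdiff_compose[where f="dact (inv g)" and g="dact g", OF act_regs(3)[OF ig x', of True]
        act_regs(3)[OF g dact_in[OF ig x'], of True] wC wC dm])
  finally show "\<delta>' = Dact g x (Dact (inv g) ?x \<delta>')" using dact_inv(1)[OF g x] by simp
qed

lemma R_L: "x \<in> mcarrier C \<Longrightarrow> dL R (ups x) = dL S x"
  unfolding R_simps
proof (rule the_equality)
  assume x: "x \<in> mcarrier C"
  then show "\<exists>x'\<in>mcarrier C. ups x' = ups x \<and> dL S x = dL S x'" by blast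
  fix l assume "\<exists>x'\<in>mcarrier C. ups x' = ups x \<and> l = dL S x'"
  then obtain x' where x': "x' \<in> mcarrier C" "ups x = ups x'" "l = dL S x'" by auto
  obtain g where "g \<in> carrier G" "x' = dact g x" using ups_eqD[OF x x'(1,2)] .
  then show "l = dL S x" using symD(1) x x'(3) by simp
qed

lemma R_Dist:
  assumes x: "x \<in> mcarrier C"
  shows "dDist R (ups x) = dups x ` dDist S x"
proof
  show "dups x ` dDist S x \<subseteq> dDist R (ups x)" unfolding R_simps using x by blast
  show "dDist R (ups x) \<subseteq> dups x ` dDist S x"
  proof
    fix \<zeta> assume "\<zeta> \<in> dDist R (ups x)"
    then obtain x' \<delta>' where x': "x' \<in> mcarrier C" "ups x = ups x'" "\<delta>' \<in> dDist S x'" "\<zeta> = dups x' \<delta>'"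
      unfolding R_simps by auto
    obtain g where g: "g \<in> carrier G" "x' = dact g x" using ups_eqD[OF x x'(1,2)] .
    obtain \<delta> where d: "\<delta> \<in> dDist S x" "\<delta>' = Dact g x \<delta>" using Dist_dact[OF g(1) x] x'(3) g(2) by metis
    have "\<zeta> = dups x \<delta>" unfolding x'(4) g(2) d(2) by (rule dups_Dact(1)[OF g(1) x Dist_model(1)[OF x d(1)]])
    then show "\<zeta> \<in> dups x ` dDist S x" using d(1) by simp
  qed
qed

lemma Dphi_act:
  assumes g: "g \<in> carrier G" and e: "e \<in> mcarrier E" and v: "v \<in> mmodel E"
  shows "S.Dphi (actE g e) (mdiff E E (actE g) e v) = mdiff M M (actM g) (phi e) (S.Dphi e v)"
proof -
  note p = phi_closed[OF e]
  have "S.Dphi (actE g e) (mdiff E E (actE g) e v) = mdiff E M (\<lambda>e. phi (actE g e)) e v"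
    by (rule mdiff_compose[where f="actE g" and g=phi, OF act_regs(1)[OF g e, of True]
      regs(1)[OF aE.act_closed[OF g e], of True] wmfds(2,2) v, symmetric])
  also have "\<dots> = mdiff E M (\<lambda>e. actM g (phi e)) e v"
  proof (rule mdiff_cong[OF _ wmfds(2) _ v])
    show "mreg True E M (\<lambda>e. actM g (phi e)) e"
      by (rule mreg_compose[where f=phi and g="actM g", OF regs(1)[OF e] act_regs(2)[OF g p] wmfds(2,3)])
    show "\<forall>\<^sub>F x in mnhds E e. actM g (phi x) = phi (actE g x)"
      using eventually_mnhds_carrier[OF wmfds(2) e] by eventually_elim (simp only: phi_act[OF g])
  qed
  also have "\<dots> = mdiff M M (actM g) (phi e) (S.Dphi e v)"
    by (rule mdiff_compose[where f=phi and g="actM g", OF regs(1)[OF e, of True] act_regs(2)[OF g p, of True] wmfds(2,3) v])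
  finally show ?thesis .
qed

abbreviation lift :: "'a \<times> 'b \<Rightarrow> 'a \<times> 'b \<Rightarrow> 'e \<times> 'f \<Rightarrow> 'e \<times> 'f" where
  "lift x0 x1 \<delta> \<equiv> (dP S x0 x1 \<delta>, S.Dphi (fst x1) (fst \<delta>))"

lemma lift_model:
  assumes "(x0, x1) \<in> C2 S" "\<delta> \<in> dDist S x1"
  shows "lift x0 x1 \<delta> \<in> mmodel C"
proof -
  have x1: "x1 \<in> mcarrier C" using assms by (simp add: C2_iff)
  have "fst x1 \<in> mcarrier E" using x1 by (simp add: C_carrier)
  from mdiff_in_model[OF regs(1)[OF this, of True] wmfds(2,3)] S.Dist_model[OF x1 assms(2)]
  show ?thesis using S.P_model[OF assms] by (simp add: C_model)
qed

lemma R_P: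
  assumes x: "(x0, x1) \<in> C2 S" and \<delta>: "\<delta> \<in> dDist S x1"
  shows "dP R (ups x0) (ups x1) (dups x1 \<delta>) = mdiff C Q upsE x0 (lift x0 x1 \<delta>)"
  unfolding R_simps
proof (rule the_equality)
  have xC: "x0 \<in> mcarrier C" "x1 \<in> mcarrier C" "phi (fst x1) = snd x0" using x by (simp_all add: C2_iff)
  show "\<exists>x0' x1' \<delta>'. (x0', x1') \<in> C2 S \<and> ups x0' = ups x0 \<and> ups x1' = ups x1 \<and>
      \<delta>' \<in> dDist S x1' \<and> dups x1' \<delta>' = dups x1 \<delta> \<and> mdiff C Q upsE x0 (lift x0 x1 \<delta>) = mdiff C Q upsE x0' (lift x0' x1' \<delta>')"
    using x \<delta> by (intro exI[of _ x0] exI[of _ x1] exI[of _ \<delta>]) simp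
  fix \<xi> assume "\<exists>x0' x1' \<delta>'. (x0', x1') \<in> C2 S \<and> ups x0' = ups x0 \<and> ups x1' = ups x1 \<and>
      \<delta>' \<in> dDist S x1' \<and> dups x1' \<delta>' = dups x1 \<delta> \<and> \<xi> = mdiff C Q upsE x0' (lift x0' x1' \<delta>')"
  then obtain x0' x1' \<delta>' where x': "(x0', x1') \<in> C2 S" "ups x0 = ups x0'" "ups x1 = ups x1'"
      "\<delta>' \<in> dDist S x1'" "dups x1' \<delta>' = dups x1 \<delta>" "\<xi> = mdiff C Q upsE x0' (lift x0' x1' \<delta>')"
    by (elim exE conjE) simp
  have xC': "x0' \<in> mcarrier C" "x1' \<in> mcarrier C" "phi (fst x1') = snd x0'" using x'(1) by (simp_all add: C2_iff)
  obtain g where g: "g \<in> carrier G" "x1' = dact g x1" using ups_eqD[OF xC(2) xC'(2) x'(3)] .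
  obtain k where k: "k \<in> carrier G" "x0' = dact k x0" using ups_eqD[OF xC(1) xC'(1) x'(2)] .
  have c: "fst x1 \<in> mcarrier E" "snd x0 \<in> mcarrier M" using xC by (simp_all add: C_carrier)
  have "actM g (snd x0) = actM k (snd x0)"
    using xC'(3) xC(3) phi_act[OF g(1) c(1)] by (cases x1; cases x0) (simp add: g k diag_act_def)
  then have gk: "k = g" using freeM'[OF g(1) k(1) c(2)] by simp
  note dm = Dist_model[OF xC(2) \<delta>]
  have "\<delta>' = Dact g x1 \<delta>"
  proof (rule dups_inj[OF xC'(2)])
    have D: "Dact g x1 \<delta> \<in> dDist S x1'" unfolding g(2) by (rule symD(3)[OF g(1) xC(2) \<delta>])
    show "\<delta>' \<in> mmodel C" "Dact g x1 \<delta> \<in> mmodel C" "snd \<delta>' = snd (Dact g x1 \<delta>)"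
      using Dist_model[OF xC'(2) x'(4)] Dist_model[OF xC'(2) D] by simp_all
    show "dups x1' \<delta>' = dups x1' (Dact g x1 \<delta>)"
      using x'(5) dups_Dact(1)[OF g(1) xC(2) dm(1)] g(2) by simp
  qed
  then have "lift x0' x1' \<delta>' = Dact g x0 (lift x0 x1 \<delta>)"
    using symD(4)[OF g(1) x \<delta>] Dphi_act[OF g(1) c(1), of "fst \<delta>"] dm(1) xC(3)
      Dact_split[OF g(1) xC(1) lift_model[OF x \<delta>]] Dact_split[OF g(1) xC(2) dm(1)]
    by (simp add: g(2) k(2) gk C_model) (simp add: diag_act_def)
  then show "\<xi> = mdiff C Q upsE x0 (lift x0 x1 \<delta>)"
    using x'(6) dups_Dact(2)[OF g(1) xC(1) lift_model[OF x \<delta>]] by (simp add: k(2) gk)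
qed

lemma R_phi:
  assumes "e \<in> mcarrier E" "w \<in> carrier G"
  shows "dphi R (piQ (e, w)) = piM (phi e)"
  unfolding R_simps conjugate_proj_def
proof (rule the_equality)
  show "\<exists>e' w'. (e', w') \<in> piQ (e, w) \<and> piM (phi e) = piM (phi e')"
    using aX.in_orbit[OF X_in[OF assms]] by blast
  fix r assume "\<exists>e' w'. (e', w') \<in> piQ (e, w) \<and> r = piM (phi e')"
  then obtain e' w' where ew: "(e', w') \<in> piQ (e, w)" "r = piM (phi e')" by blast
  from ew(1) obtain g where "g \<in> carrier G" "(e', w') = cact g (e, w)" by (auto simp: orbit_def)
  then have "g \<in> carrier G" "e' = actE g e" by (simp_all add: conj_act_def)
  then show "r = piM (phi e)" using ew(2) assms by (simp add: phi_act aM.orbit_act phi_closed)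
qed

lemma R_phi_ups: "x \<in> mcarrier C \<Longrightarrow> dphi R (fst (ups x)) = piM (phi (fst x))"
  unfolding ups_simp fst_conv by (rule R_phi) (simp_all add: C_carrier conf(1) phi_closed)

lemma R_phi_reg:
  assumes "v \<in> mcarrier Q"
  shows "mreg False Q B (dphi R) v"
proof -
  obtain p where p: "p \<in> mcarrier X" "v = piQ p" using assms unfolding Q_simps by (rule aX.orbitsE)
  obtain s where s: "mreg False Q X s v" "eventually (\<lambda>r. piQ (s r) = r) (mnhds Q v)"
    using Q_section[OF p(1)] p(2) by auto
  have "mreg False Q E (\<lambda>r. fst (s r)) v"
    by (rule mreg_compose[where f=s and g=fst, OF s(1) mreg_fst[OF wmfds(2,1) mregD(2)[OF s(1)]] wmfd_Q wmfds(6)])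
  then have r: "mreg False Q B (\<lambda>r. piM (phi (fst (s r)))) v"
    by (intro mreg_piM mreg_phi wmfd_Q)
  have "eventually (\<lambda>r. s r \<in> mcarrier X) (mnhds Q v)"
    by (rule mreg_eventually[OF s(1) wmfd_Q wmfds(6) eventually_mnhds_carrier[OF wmfds(6) mregD(2)[OF s(1)]]])
  with s(2) have "eventually (\<lambda>r. piM (phi (fst (s r))) = dphi R r) (mnhds Q v)"
  proof eventually_elim
    case (elim r)
    obtain e w where ew: "s r = (e, w)" "e \<in> mcarrier E" "w \<in> carrier G" using elim(2) by (rule X_cases)
    show ?case using R_phi[OF ew(2,3)] elim(1) by (simp add: ew(1))
  qed
  then show ?thesis by (rule mreg_cong[where f="\<lambda>r. piM (phi (fst (s r)))", OF r wmfd_Q])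
qed

lemma R_L_reg:
  assumes x: "x \<in> mcarrier C"
  shows "mreg False QB real_mfd (dL R) (ups x)"
proof -
  obtain t where t: "mreg False QB C t (ups x)" "t (ups x) = x"
     "eventually (\<lambda>y. t y \<in> mcarrier C \<and> ups (t y) = y) (mnhds QB (ups x))"
    using ups_section[OF x] by auto
  have r: "mreg False QB real_mfd (\<lambda>y. dL S (t y)) (ups x)"
    by (rule mreg_compose[where f=t and g="dL S", OF t(1) _ wQB wC]) (simp add: t(2) S.L_reg[OF x])
  have "eventually (\<lambda>y. dL S (t y) = dL R y) (mnhds QB (ups x))"
    using t(3) by eventually_elim (metis R_L)
  then show ?thesis by (rule mreg_cong[where f="\<lambda>y. dL S (t y)", OF r wQB])
qed

lemma upsE_reg: "x \<in> mcarrier C \<Longrightarrow> mreg b C Q upsE x"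
  using ups_reg(1) by (simp add: o_def)

lemma R_Dphi:
  assumes x: "x \<in> mcarrier C" and v: "v \<in> mmodel C"
  shows "mdiff Q B (dphi R) (fst (ups x)) (mdiff C Q upsE x v) = mdiff M B piM (phi (fst x)) (S.Dphi (fst x) (fst v))"
proof -
  have e: "fst x \<in> mcarrier E" using x by (simp add: C_carrier)
  have uQ: "fst (ups x) \<in> mcarrier Q" using mregD(2)[OF upsE_reg[OF x, of True]] by simp
  have "mdiff Q B (dphi R) (upsE x) (mdiff C Q upsE x v) = mdiff C B (\<lambda>x. dphi R (upsE x)) x v"
    by (rule mdiff_compose[where f=upsE and g="dphi R" and b'=False, OF upsE_reg[OF x, of False] _ wC wmfd_Q v, symmetric])
       (simp add: R_phi_reg[OF uQ])
  also have "\<dots> = mdiff C B (\<lambda>x. piM (phi (fst x))) x v"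
  proof (rule mdiff_cong[OF _ wC _ v])
    show "mreg True C B (\<lambda>x. piM (phi (fst x))) x" by (intro mreg_piM mreg_phi C_fst x wC)
    show "\<forall>\<^sub>F x in mnhds C x. piM (phi (fst x)) = dphi R (upsE x)"
      using eventually_mnhds_carrier[OF wC x] by eventually_elim (simp add: R_phi_ups)
  qed
  also have "\<dots> = mdiff M B piM (phi (fst x)) (mdiff C M (\<lambda>x. phi (fst x)) x v)"
    by (rule mdiff_compose[where f="\<lambda>x. phi (fst x)" and g=piM, OF mreg_phi[OF C_fst[OF x] wC, of True]
      regs(2)[OF phi_closed[OF e], of True] wC wmfds(3) v])
  also have "mdiff C M (\<lambda>x. phi (fst x)) x v = S.Dphi (fst x) (mdiff C E fst x v)"
    by (rule mdiff_compose[where f=fst and g=phi, OF C_fst[OF x, of True] regs(1)[OF e, of True] wC wmfds(2) v])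
  finally show ?thesis by (simp only: o_def mdiff_C_fst[OF x v])
qed

lemma dups_split:
  assumes x: "x \<in> mcarrier C" and v: "v \<in> mmodel C"
  shows "dups x v = (mdiff C Q upsE x v, mdiff M B piM (snd x) (snd v))"
proof -
  have m: "snd x \<in> mcarrier M" using x by (simp add: C_carrier)
  have r: "mreg True C B (\<lambda>x. piM (snd x)) x" by (intro mreg_piM C_snd x wC)
  have eq: "ups = (\<lambda>x. (upsE x, piM (snd x)))" by (simp add: ups_simp fun_eq_iff)
  have "mdiff C QB (\<lambda>x. (upsE x, piM (snd x))) x v = (mdiff C Q upsE x v, mdiff C B (\<lambda>x. piM (snd x)) x v)"
    by (rule mdiff_Pair[OF upsE_reg[OF x, of True] r wC v])
  moreover have "mdiff C B (\<lambda>x. piM (snd x)) x v = mdiff M B piM (snd x) (mdiff C M snd x v)"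
    by (rule mdiff_compose[where f=snd and g=piM, OF C_snd[OF x, of True] regs(2)[OF m, of True] wC wmfds(3) v])
  ultimately show ?thesis using x v by (subst eq) (simp add: mdiff_C_snd)
qed

lemma dL_dups:
  assumes x: "x \<in> mcarrier C" and v: "v \<in> mmodel C"
  shows "mdiff QB real_mfd (dL R) (ups x) (dups x v) = mdiff C real_mfd (dL S) x v"
proof -
  have "mdiff QB real_mfd (dL R) (ups x) (dups x v) = mdiff C real_mfd (\<lambda>x. dL R (ups x)) x v"
    by (rule mdiff_compose[where f=ups and g="dL R", OF ups_reg(2)[OF x] R_L_reg[OF x] wC wQB v, symmetric])
  also have "\<dots> = mdiff C real_mfd (dL S) x v"
  proof (rule mdiff_cong[OF S.L_reg[OF x] wC _ v])
    show "\<forall>\<^sub>F x in mnhds C x. dL S x = dL R (ups x)"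
      using eventually_mnhds_carrier[OF wC x] by eventually_elim (simp only: R_L)
  qed
  finally show ?thesis .
qed

lemma C2_R_lift:
  assumes "(y0, y1) \<in> C2 R"
  obtains x0 x1 where "(x0, x1) \<in> C2 S" "y0 = ups x0" "y1 = ups x1"
proof -
  have y: "y0 \<in> mcarrier QB" "y1 \<in> mcarrier QB" "dphi R (fst y1) = snd y0"
    using assms by (simp_all add: C2_def R_simps(4))
  obtain z0 where z0: "z0 \<in> mcarrier C" "y0 = ups z0" using y(1) by (rule ups_surj)
  obtain x1 where x1: "x1 \<in> mcarrier C" "y1 = ups x1" using y(2) by (rule ups_surj)
  have c: "snd z0 \<in> mcarrier M" "fst x1 \<in> mcarrier E" using z0 x1 by (simp_all add: C_carrier)
  have "piM (snd z0) = piM (phi (fst x1))"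
    using y(3) R_phi_ups[OF x1(1)] z0 x1 by (simp add: ups_simp[of z0])
  then obtain g where g: "g \<in> carrier G" "phi (fst x1) = actM g (snd z0)"
    using aM.orbit_eqD[OF _ phi_closed[OF c(2)]] by auto
  have "(dact g z0, x1) \<in> C2 S"
    using g dact_in[OF g(1) z0(1)] x1(1) by (cases z0) (simp add: C2_iff diag_act_def)
  then show thesis using that[of "dact g z0" x1] ups_dact[OF g(1) z0(1)] z0(2) x1(2) by simp
qed

sublocale R: regular_dldps R
proof
  show "wmfd (dE R)" "wmfd (dM R)" unfolding R_simps by (rule wmfd_Q wmfds(5))+
  show "mreg False (C1 R) real_mfd (dL R) p" if p: "p \<in> mcarrier (C1 R)" for p
  proof -
    obtain x where "x \<in> mcarrier C" "p = ups x" using p unfolding R_simps(4) by (rule ups_surj)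
    then show ?thesis unfolding R_simps(4) using R_L_reg by simp
  qed
  show "mreg False (dE R) (dM R) (dphi R) e" if "e \<in> mcarrier (dE R)" for e
    using R_phi_reg that unfolding R_simps(1,2) by simp
  show "subspace (dDist R p)" if p: "p \<in> mcarrier (C1 R)" for p
  proof -
    obtain x where x: "x \<in> mcarrier C" "p = ups x" using p unfolding R_simps(4) by (rule ups_surj)
    show ?thesis unfolding x(2) R_Dist[OF x(1)]
      by (rule linear_subspace_image[OF mdiff_linear[OF ups_reg(2)[OF x(1), of True]] S.Dist_subspace[OF x(1)]])
  qed
  show "fst \<delta> \<in> mmodel (dE R) \<and> snd \<delta> = 0" if p: "p \<in> mcarrier (C1 R)" and d: "\<delta> \<in> dDist R p" for p \<delta>
  proof -
    obtain x where x: "x \<in> mcarrier C" "p = ups x" using p unfolding R_simps(4) by (rule ups_surj)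
    obtain \<delta>' where d': "\<delta>' \<in> dDist S x" "\<delta> = dups x \<delta>'" using d unfolding x(2) R_Dist[OF x(1)] by auto
    note m = Dist_model[OF x(1) d'(1)]
    have "snd x \<in> mcarrier M" using x by (simp add: C_carrier)
    then have "mdiff M B piM (snd x) 0 = 0" by (rule mdiff_0[OF regs(2)[where b=True]])
    then show ?thesis unfolding R_simps(1) d'(2) dups_split[OF x(1) m(1)]
      using mdiff_in_model[OF upsE_reg[OF x(1), of True] wC wmfd_Q m(1)] m(2) by simp
  qed
next
  fix p q assume pq: "(p, q) \<in> C2 R"
  obtain x0 x1 where x: "(x0, x1) \<in> C2 S" "p = ups x0" "q = ups x1" using pq by (rule C2_R_lift)
  have xC: "x0 \<in> mcarrier C" "x1 \<in> mcarrier C" using x(1) by (simp_all add: C2_iff)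
  have e1: "fst x1 \<in> mcarrier E" "fst x0 \<in> mcarrier E" using xC by (simp_all add: C_carrier)
  have z: "0 \<in> dDist S x1" by (rule subspace_0[OF S.Dist_subspace[OF xC(2)]])
  have "lift x0 x1 0 = 0" using S.P_zero[OF x(1)] mdiff_0[OF regs(1)[OF e1(1), of True]] by (simp add: zero_prod_def)
  then have "dP R p q (dups x1 0) = 0"
    using R_P[OF x(1) z] mdiff_0[OF upsE_reg[OF xC(1), of True]] x by simp
  then show "dP R p q 0 = 0" using mdiff_0[OF ups_reg(2)[OF xC(2), of True]] by simp
  fix \<delta> assume d: "\<delta> \<in> dDist R q"
  obtain \<delta>' where d': "\<delta>' \<in> dDist S x1" "\<delta> = dups x1 \<delta>'" using d unfolding x(3) R_Dist[OF xC(2)] by auto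
  have P: "dP R p q \<delta> = mdiff C Q upsE x0 (lift x0 x1 \<delta>')" unfolding x(2,3) d'(2) by (rule R_P[OF x(1) d'(1)])
  note lm = lift_model[OF x(1) d'(1)]
  show "dP R p q \<delta> \<in> mmodel (dE R)"
    unfolding P R_simps(1) by (rule mdiff_in_model[OF upsE_reg[OF xC(1), of True] wC wmfd_Q lm])
  have "mdiff Q B (dphi R) (fst (ups x0)) (dP R p q \<delta>) = mdiff M B piM (phi (fst x0)) (S.Dphi (fst x0) (dP S x0 x1 \<delta>'))"
    unfolding P using R_Dphi[OF xC(1) lm] by simp
  also have "S.Dphi (fst x0) (dP S x0 x1 \<delta>') = 0" by (rule S.P_vertical[OF x(1) d'(1)])
  also have "mdiff M B piM (phi (fst x0)) 0 = 0"
    by (rule mdiff_0[OF regs(2)[OF phi_closed[OF e1(2)], of True]])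
  finally show "mdiff (dE R) (dM R) (dphi R) (fst p) (dP R p q \<delta>) = 0" unfolding R_simps(1,2) x(2) .
qed

text \<open>
  Both motion sections are sums of values of \<open>dL\<close> on pairs, and the pair for \<open>R\<close> at \<open>\<Upsilon>(x\<^sub>0)\<close> is the
  image under \<open>d\<Upsilon>\<close> of the pair for \<open>S\<close> at \<open>x\<^sub>0\<close>.
\<close>

lemma motion_section_R:
  assumes x: "(x0, x1) \<in> C2 S" and d: "\<delta> \<in> dDist S x1"
  shows "motion_section R (ups x0) (ups x1) (dups x1 \<delta>) = motion_section S x0 x1 \<delta>"
proof -
  have xC: "x0 \<in> mcarrier C" "x1 \<in> mcarrier C" "phi (fst x1) = snd x0" using x by (simp_all add: C2_iff)
  have u: "ups x0 \<in> mcarrier (C1 R)" "ups x1 \<in> mcarrier (C1 R)" unfolding R_simps(4) by (rule ups_in xC)+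
  have e: "fst x1 \<in> mcarrier E" "fst x0 \<in> mcarrier E" using xC by (simp_all add: C_carrier)
  note m = Dist_model[OF xC(2) d] and lm = lift_model[OF x d]
  have z: "0 \<in> mmodel (dM R)" "0 \<in> mmodel M"
    using subspace_0[OF wmfdD(1)[OF R.wM]] subspace_0[OF wmfdD(1)[OF wmfds(3)]] by simp_all
  have p0: "mdiff M B piM (snd x1) 0 = 0" "mdiff M B piM (snd x0) 0 = 0"
    using xC mdiff_0[OF regs(2)[where b=True]] by (simp_all add: C_carrier)
  let ?v = "mdiff C Q upsE x1 \<delta>" and ?P = "mdiff C Q upsE x0 (lift x0 x1 \<delta>)"
  let ?r = "mdiff M B piM (snd x0) (S.Dphi (fst x1) (fst \<delta>))"
  have vQ: "?v \<in> mmodel (dE R)" "?P \<in> mmodel (dE R)"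
    unfolding R_simps(1) by (rule mdiff_in_model[OF upsE_reg[of _ True] wC wmfd_Q], rule xC, rule m lm)+
  have rB: "?r \<in> mmodel (dM R)"
    unfolding R_simps(2) using mdiff_in_model[OF regs(2)[of "snd x0" True] wmfds(3,5)] lm xC by (simp add: C_carrier C_model)
  have du1: "dups x1 \<delta> = (?v, 0)" unfolding dups_split[OF xC(2) m(1)] m(2) p0 ..
  have du0: "dups x0 (lift x0 x1 \<delta>) = (?P, ?r)" using dups_split[OF xC(1) lm] by simp
  have L1: "R.DL1 (ups x1) ?v = S.DL1 x1 (fst \<delta>)"
  proof -
    have "R.DL1 (ups x1) ?v = mdiff (C1 R) real_mfd (dL R) (ups x1) (?v, 0)"
      using R.DL_split[OF u(2) vQ(1) z(1)] linear_0[OF R.DL1_linear(2)[OF u(2)]] by simp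
    also have "\<dots> = mdiff C real_mfd (dL S) x1 \<delta>"
      unfolding R_simps(4) du1[symmetric] by (rule dL_dups[OF xC(2) m(1)])
    also have "\<dots> = S.DL1 x1 (fst \<delta>)"
      using S.DL_split[OF xC(2), of "fst \<delta>" 0] linear_0[OF S.DL1_linear(2)[OF xC(2)]] m z(2)
      by (cases \<delta>) (simp add: C_model)
    finally show ?thesis .
  qed
  have L0: "R.DL1 (ups x0) ?P + R.DL2 (ups x0) ?r = S.DL1 x0 (dP S x0 x1 \<delta>) + S.DL2 x0 (S.Dphi (fst x1) (fst \<delta>))"
  proof -
    have "R.DL1 (ups x0) ?P + R.DL2 (ups x0) ?r = mdiff (C1 R) real_mfd (dL R) (ups x0) (?P, ?r)"
      using R.DL_split[OF u(1) vQ(2) rB] by simp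
    also have "\<dots> = mdiff C real_mfd (dL S) x0 (lift x0 x1 \<delta>)"
      unfolding R_simps(4) du0[symmetric] by (rule dL_dups[OF xC(1) lm])
    also have "\<dots> = S.DL1 x0 (dP S x0 x1 \<delta>) + S.DL2 x0 (S.Dphi (fst x1) (fst \<delta>))"
      using S.DL_split[OF xC(1)] lm by (simp add: C_model)
    finally show ?thesis .
  qed
  have "R.Dphi (fst (ups x1)) ?v = ?r"
    unfolding R_simps(1,2) using R_Dphi[OF xC(2) m(1)] xC(3) by simp
  moreover have "dP R (ups x0) (ups x1) (dups x1 \<delta>) = ?P" by (rule R_P[OF x d])
  ultimately have "motion_section R (ups x0) (ups x1) (dups x1 \<delta>) =
      R.DL1 (ups x1) ?v + R.DL2 (ups x0) ?r + R.DL1 (ups x0) ?P"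
    unfolding R.motion_section_alt by (simp add: du1)
  then show ?thesis unfolding S.motion_section_alt using L1 L0 by simp
qed

lemma path_R:
  assumes path: "discrete_path S N x" and y: "y = (\<lambda>k\<in>{..<N}. ups (x k))"
  shows "discrete_path R N y"
proof -
  have p: "N \<ge> 2" "\<And>k. k < N \<Longrightarrow> x k \<in> mcarrier C" "\<forall>k\<in>{1..N-1}. phi (fst (x k)) = snd (x (k-1))"
    using path by (auto simp: discrete_path_def power_mfd_def)
  have "y \<in> mcarrier (power_mfd N (C1 R))"
    unfolding y R_simps(4) power_mfd_def using ups_in[OF p(2)] by simp
  moreover have "dphi R (fst (y k)) = snd (y (k-1))" if k: "k \<in> {1..N-1}" for k
  proof -
    have "k < N" "k - 1 < N" using k p(1) by auto
    then have "dphi R (fst (y k)) = piM (phi (fst (x k)))" using R_phi_ups[OF p(2)] by (simp add: y)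
    also have "phi (fst (x k)) = snd (x (k - 1))" using p(3) k by blast
    also have "piM (snd (x (k - 1))) = snd (ups (x (k - 1)))" by (simp only: ups_simp snd_conv)
    finally show ?thesis using \<open>k - 1 < N\<close> by (simp add: y)
  qed
  ultimately show ?thesis using p(1) by (simp add: discrete_path_def)
qed

lemma satisfies_motion_R:
  assumes path: "discrete_path S N x" and y: "y = (\<lambda>k\<in>{..<N}. ups (x k))"
  shows "satisfies_motion S N x \<longleftrightarrow> satisfies_motion R N y"
proof -
  have p: "N \<ge> 2" "\<And>k. k < N \<Longrightarrow> x k \<in> mcarrier C" "\<forall>k\<in>{1..N-1}. phi (fst (x k)) = snd (x (k-1))"
    using path by (auto simp: discrete_path_def power_mfd_def)
  have "x k \<in> dDd S \<longleftrightarrow> y k \<in> dDd R" if k: "k < N" for k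
  proof
    show "x k \<in> dDd S \<Longrightarrow> y k \<in> dDd R" using k by (simp add: y R_simps(5))
    assume "y k \<in> dDd R"
    then obtain z where z: "z \<in> dDd S" "ups z = ups (x k)" using k by (auto simp: y R_simps(5))
    obtain g where "g \<in> carrier G" "x k = dact g z" using ups_eqD[OF Dd_C[OF z(1)] p(2)[OF k] z(2)] .
    then show "x k \<in> dDd S" using symD(2) z(1) by simp
  qed
  moreover have "(\<forall>\<delta>\<in>dDist S (x k). motion_section S (x (k-1)) (x k) \<delta> = 0) \<longleftrightarrow>
      (\<forall>\<delta>\<in>dDist R (y k). motion_section R (y (k-1)) (y k) \<delta> = 0)" if k: "k \<in> {1..N-1}" for k
  proof -
    have kN: "k < N" "k - 1 < N" using k p(1) by auto
    have c2: "(x (k-1), x k) \<in> C2 S" using p kN k by (simp add: C2_iff)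
    show ?thesis using kN R_Dist[OF p(2)[OF kN(1)]] motion_section_R[OF c2] by (simp add: y)
  qed
  ultimately show ?thesis unfolding satisfies_motion_def by (metis (no_types, lifting))
qed

end

theorem corollary5p16:
  fixes G :: "'g monoid"
    and MG :: "('g, 'k::euclidean_space) mfd"
    and F\<^sub>0 :: "('c, 'h::euclidean_space) mfd"
    and S :: "('a, 'e::euclidean_space, 'b, 'f::euclidean_space) dldps"
    and actE :: "'g \<Rightarrow> 'a \<Rightarrow> 'a"
    and actM :: "'g \<Rightarrow> 'b \<Rightarrow> 'b"
    and actF :: "'c \<Rightarrow> 'g \<Rightarrow> 'c"
    and Hor :: "('b \<times> 'b) set"
    and N :: nat
    and x :: "nat \<Rightarrow> 'a \<times> 'b"
    and R :: "(('a \<times> 'g) set, 'e \<times> 'k, 'b set, 'f) dldps"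
    and y :: "nat \<Rightarrow> ('a \<times> 'g) set \<times> 'b set"
  assumes "lie_group G MG"
    and "is_dldps F\<^sub>0 S"
    and "symmetry_group G MG F\<^sub>0 actE actM actF S"
    and "discrete_connection G MG (dM S) actM Hor"
    and "connection_domain G actM Hor = mcarrier (dM S) \<times> mcarrier (dM S)"
    and "discrete_path S N x"
    and "y = (\<lambda>k\<in>{..<N}. Upsilon G actE actM Hor (dphi S) (x k))"
    and "R = reduced_system G MG actE actM Hor S"
  shows "(trajectory S N x \<longleftrightarrow> satisfies_motion S N x) \<and>
         (satisfies_motion S N x \<longleftrightarrow> trajectory R N y) \<and>
         (trajectory R N y \<longleftrightarrow> satisfies_motion R N y)"
proof -
  interpret group G using assms(1) by (simp add: lie_group_def)
  interpret reduction G MG F\<^sub>0 S actE actM actF Hor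
    by unfold_locales (use assms in \<open>simp_all add: is_dldps_def symmetry_group_def\<close>)
  show ?thesis
    using S.trajectory_iff_motion[OF assms(6)] satisfies_motion_R[OF assms(6,7)]
      R.trajectory_iff_motion[OF path_R[OF assms(6,7)]] unfolding assms(8) by blast
qed

end
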